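(* For every $0<\delta\le 1$ there exists an infinite set $I\subset\mathbb{N}$ of positive integers such that the Hausdorff dimension of $J_I$ equals $\delta$ and such that the $\delta$-dimensional Hausdorff measure restricted to $J_I$, $\mathcal{H}^\delta|_{J_I}$, is Ahlfors $\delta$-regular.
   Context: For a set $I$ of positive integers, $J_I$ is the set of irrational $x\in[0,1]$ all of whose continued fraction entries (in $x=[0;\omega_0,\omega_1,\ldots]$) lie in $I$. For $\delta>0$, a nonzero, Borel, locally finite measure $\mu$ on $\mathbb{R}$ is Ahlfors $\delta$-regular if there exist constants $C_1,C_2>0$ such that $C_1r^\delta\le\mu(B(x,r))\le C_2r^\delta$ for all $x$ in the topological support of $\mu$ and all $0<r\le 1$. *)

theory Defs
  imports "HOL-Analysis.Analysis"
begin

subsection \<open>Continued fractions\<close>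

text \<open>The finite continued fraction \<open>[0; \<omega>\<^sub>0, \<dots>, \<omega>\<^sub>n\<^sub>-\<^sub>1]\<close>.\<close>

primrec cf_convergent :: "nat \<Rightarrow> (nat \<Rightarrow> nat) \<Rightarrow> real" where
  "cf_convergent 0 \<omega> = 0"
| "cf_convergent (Suc n) \<omega> = 1 / (real (\<omega> 0) + cf_convergent n (\<omega> \<circ> Suc))"

text \<open>\<open>x = [0; \<omega>\<^sub>0, \<omega>\<^sub>1, \<dots>]\<close> as an infinite continued fraction with positive integer entries.
  For such \<open>x\<close> the sequence \<open>\<omega>\<close> is unique.\<close>

definition has_cf_expansion :: "real \<Rightarrow> (nat \<Rightarrow> nat) \<Rightarrow> bool" where
  "has_cf_expansion x \<omega> \<longleftrightarrow> (\<forall>n. 0 < \<omega> n) \<and> (\<lambda>n. cf_convergent n \<omega>) \<longlonglongrightarrow> x"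

definition cf_set :: "nat set \<Rightarrow> real set" where
  "cf_set I = {x \<in> {0..1}. x \<notin> \<rat> \<and> (\<exists>\<omega>. has_cf_expansion x \<omega> \<and> (\<forall>n. \<omega> n \<in> I))}"

subsection \<open>Hausdorff measure and dimension\<close>

text \<open>The weight \<open>diam(U)\<^sup>s\<close>, with the conventions \<open>diam({})\<^sup>s = 0\<close> and \<open>diam(U)\<^sup>0 = 1\<close> for nonempty
  \<open>U\<close>; the case split is needed because \<open>0 powr 0 = 0\<close>. It is only meaningful for bounded \<open>U\<close>.\<close>

definition diam_weight :: "real \<Rightarrow> 'a::metric_space set \<Rightarrow> ennreal" where
  "diam_weight s U =
     (if U = {} then 0 else if s = 0 then 1 else ennreal (diameter U powr s))"

definition hausdorff_premeasure :: "real \<Rightarrow> real \<Rightarrow> 'a::metric_space set \<Rightarrow> ennreal" where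
  "hausdorff_premeasure \<epsilon> s A =
     (INF U \<in> {U :: nat \<Rightarrow> 'a set. (\<forall>i. bounded (U i) \<and> diameter (U i) \<le> \<epsilon>) \<and> A \<subseteq> (\<Union>i. U i)}.
        \<Sum>i. diam_weight s (U i))"

definition hausdorff_outer_measure :: "real \<Rightarrow> 'a::metric_space set \<Rightarrow> ennreal" where
  "hausdorff_outer_measure s A = (SUP \<epsilon> \<in> {0<..}. hausdorff_premeasure \<epsilon> s A)"

text \<open>The restriction of the \<open>s\<close>-dimensional Hausdorff measure to \<open>A\<close>, as a Borel measure on the
  whole space: a Borel set \<open>B\<close> has measure \<open>H\<^sup>s(B \<inter> A)\<close>. By the Caratheodory criterion this set
  function is countably additive on the Borel sets, for every \<open>A\<close>.\<close>

definition hausdorff_measure_on :: "real \<Rightarrow> 'a::metric_space set \<Rightarrow> 'a measure" where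
  "hausdorff_measure_on s A =
     measure_of UNIV (sets borel) (\<lambda>B. hausdorff_outer_measure s (B \<inter> A))"

definition hausdorff_dim :: "'a::metric_space set \<Rightarrow> ereal" where
  "hausdorff_dim A = (INF s \<in> {s. 0 \<le> s \<and> hausdorff_outer_measure s A = 0}. ereal s)"

subsection \<open>Ahlfors regularity\<close>

definition measure_support :: "'a::topological_space measure \<Rightarrow> 'a set" where
  "measure_support \<mu> = {x. \<forall>U. open U \<longrightarrow> x \<in> U \<longrightarrow> 0 < emeasure \<mu> U}"

definition locally_finite_measure :: "'a::topological_space measure \<Rightarrow> bool" where
  "locally_finite_measure \<mu> \<longleftrightarrow> (\<forall>x. \<exists>U. open U \<and> x \<in> U \<and> emeasure \<mu> U < \<infinity>)"

definition ahlfors_regular :: "real \<Rightarrow> real measure \<Rightarrow> bool" where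
  "ahlfors_regular \<delta> \<mu> \<longleftrightarrow>
     sets \<mu> = sets borel \<and> emeasure \<mu> (space \<mu>) \<noteq> 0 \<and> locally_finite_measure \<mu> \<and>
     (\<exists>C1 C2 :: real. 0 < C1 \<and> 0 < C2 \<and>
        (\<forall>x \<in> measure_support \<mu>. \<forall>r. 0 < r \<and> r \<le> 1 \<longrightarrow>
           ennreal (C1 * r powr \<delta>) \<le> emeasure \<mu> (ball x r) \<and>
           emeasure \<mu> (ball x r) \<le> ennreal (C2 * r powr \<delta>)))"

end

(*
  A word w over the alphabet I has continuant q(w) and a cylinder of length about q(w)^-2, and
  continuants are multiplicative up to a factor 2. Hence Z_n = (sum of q(w)^(-2 delta) over words w
  of length n) satisfies Z_m Z_n / 4 <= Z_(m+n) <= Z_m Z_n, and I has critical exponent delta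
  exactly if 1 <= Z_n <= 4 for all n.

  If I is critical and Ahlfors delta-regular as a set of integers, i.e. card (I Int [a - R, a + R])
  is comparable to R^delta for a in I and R >= 1, then the mass of the words whose cylinder lies in
  an interval of length r around a point of the limit set is comparable to r^delta. Covering by
  cylinders and a Lebesgue number argument on the closure of the limit set, which only adds rational
  points, transfer these bounds to the Hausdorff measure.

  For delta = 1 the full alphabet is critical, since the cylinders of a given level partition the
  irrationals. For delta < 1 start from the largest subcritical interval {1..M}, add a sparse regular
  set far out, and then add greedily letters of another regular set S1 as long as Z_n <= 4 for all n.
  Every letter of S1 is outweighed by the larger letters of S1, so the greedy choice is critical.
*)

theory Submission
  imports Defs
begin

subsection \<open>Hausdorff measures\<close>

text \<open>The finite-level masses stand in for a conformal measure on the limit set: all bounds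
  are uniform in the level, so a cover by arbitrary sets is compared with the mass at one
  sufficiently deep level. For this the alphabet must be exactly critical; an exponent that is only
  approached would not give positive and finite Hausdorff measure. The greedy choice controls the
  exponent but not which letters are taken, so the set that it selects may fail to be regular from
  below. Lower regularity is therefore secured beforehand. The base alphabet contains a translate of
  a regular set S, and up to finitely many letters the candidates form a second translate of the
  same S. Each candidate then lies within a bounded distance of the base, so every choice of
  candidates keeps the lower bound, while the upper bound passes to subsets. All elements of S are
  even and the two translations differ by an odd number, which keeps the translates
  disjoint.\<close>

lemma hausdorff_premeasure_le_cover:
  assumes "\<And>i. bounded (U i)" "\<And>i. diameter (U i) \<le> \<epsilon>" "A \<subseteq> (\<Union>i. U i)"
  shows "hausdorff_premeasure \<epsilon> s A \<le> (\<Sum>i. diam_weight s (U i))"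
  unfolding hausdorff_premeasure_def by (rule INF_lower) (use assms in auto)

lemma hausdorff_premeasure_mono:
  "A \<subseteq> B \<Longrightarrow> hausdorff_premeasure \<epsilon> s A \<le> hausdorff_premeasure \<epsilon> s B"
  unfolding hausdorff_premeasure_def by (rule INF_superset_mono) auto

lemma hausdorff_premeasure_antimono:
  "\<epsilon> \<le> \<epsilon>' \<Longrightarrow> hausdorff_premeasure \<epsilon>' s A \<le> hausdorff_premeasure \<epsilon> s A"
  unfolding hausdorff_premeasure_def by (rule INF_superset_mono) (auto intro: order_trans)

lemma hausdorff_premeasure_le_outer:
  "0 < \<epsilon> \<Longrightarrow> hausdorff_premeasure \<epsilon> s A \<le> hausdorff_outer_measure s A"
  unfolding hausdorff_outer_measure_def by (rule SUP_upper) auto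

lemma hausdorff_outer_measure_le:
  "(\<And>\<epsilon>. 0 < \<epsilon> \<Longrightarrow> hausdorff_premeasure \<epsilon> s A \<le> c) \<Longrightarrow> hausdorff_outer_measure s A \<le> c"
  unfolding hausdorff_outer_measure_def by (rule SUP_least) auto

lemma hausdorff_outer_measure_mono:
  "A \<subseteq> B \<Longrightarrow> hausdorff_outer_measure s A \<le> hausdorff_outer_measure s B"
  by (meson hausdorff_outer_measure_le hausdorff_premeasure_le_outer hausdorff_premeasure_mono
      order_trans)

lemma hausdorff_outer_measure_empty [simp]: "hausdorff_outer_measure s {} = 0"
proof -
  have "hausdorff_outer_measure s ({} :: 'a set) \<le> 0"
  proof (rule hausdorff_outer_measure_le)
    fix \<epsilon> :: real
    assume "0 < \<epsilon>"
    then have "hausdorff_premeasure \<epsilon> s ({} :: 'a set) \<le> (\<Sum>i. diam_weight s ({} :: 'a set))"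
      by (intro hausdorff_premeasure_le_cover[where U = "\<lambda>i. {}"]) (auto simp: diameter_empty)
    then show "hausdorff_premeasure \<epsilon> s ({} :: 'a set) \<le> 0"
      by (simp add: diam_weight_def)
  qed
  then show ?thesis by simp
qed

lemma hausdorff_premeasure_countably_subadditive:
  "hausdorff_premeasure \<epsilon> s (\<Union>i. A i) \<le> (\<Sum>i. hausdorff_premeasure \<epsilon> s (A i))"
proof (cases "(\<Sum>i. hausdorff_premeasure \<epsilon> s (A i)) = top")
  case False
  have fin: "hausdorff_premeasure \<epsilon> s (A i) < \<infinity>" for i
    using ennreal_suminf_lessD[of "\<lambda>i. hausdorff_premeasure \<epsilon> s (A i)" top i] False
    by (simp add: less_top)
  show ?thesis
  proof (rule ennreal_le_epsilon)
    fix e :: real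
    assume e: "0 < e"
    have "\<exists>U. ((\<forall>j. bounded (U j) \<and> diameter (U j) \<le> \<epsilon>) \<and> A i \<subseteq> (\<Union>j. U j)) \<and>
        (\<Sum>j. diam_weight s (U j)) < hausdorff_premeasure \<epsilon> s (A i) + ennreal (e * (1/2) ^ Suc i)" for i
      using INF_approx_ennreal[OF _ hausdorff_premeasure_def, of "e * (1/2) ^ Suc i" \<epsilon> s "A i"] fin[of i] e
      by auto
    then obtain U where U: "\<And>i j. bounded (U i j)" "\<And>i j. diameter (U i j) \<le> \<epsilon>"
      "\<And>i. A i \<subseteq> (\<Union>j. U i j)"
      "\<And>i. (\<Sum>j. diam_weight s (U i j)) < hausdorff_premeasure \<epsilon> s (A i) + ennreal (e * (1/2) ^ Suc i)"
      by metis
    define V where "V n = (case prod_decode n of (i, j) \<Rightarrow> U i j)" for n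
    have "hausdorff_premeasure \<epsilon> s (\<Union>i. A i) \<le> (\<Sum>n. diam_weight s (V n))"
    proof (rule hausdorff_premeasure_le_cover)
      show "bounded (V i)" "diameter (V i) \<le> \<epsilon>" for i
        using U by (auto simp: V_def split: prod.split)
      show "(\<Union>i. A i) \<subseteq> (\<Union>i. V i)"
      proof
        fix x
        assume "x \<in> (\<Union>i. A i)"
        then obtain i where "x \<in> A i" by auto
        then obtain j where "x \<in> U i j" using U(3) by blast
        then have "x \<in> V (prod_encode (i, j))" by (simp add: V_def)
        then show "x \<in> (\<Union>i. V i)" by blast
      qed
    qed
    also have "\<dots> = (\<Sum>i. \<Sum>j. diam_weight s (U i j))"
    proof -
      have "diam_weight s (V n) = (\<lambda>(i, j). diam_weight s (U i j)) (prod_decode n)" for n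
        by (auto simp: V_def split: prod.split)
      then show ?thesis
        using suminf_ennreal_2dimen[of "\<lambda>i. \<Sum>j. diam_weight s (U i j)" "\<lambda>(i, j). diam_weight s (U i j)"]
        by simp
    qed
    also have "\<dots> \<le> (\<Sum>i. hausdorff_premeasure \<epsilon> s (A i) + ennreal (e * (1/2) ^ Suc i))"
      by (intro suminf_le less_imp_le[OF U(4)]) auto
    also have "\<dots> = (\<Sum>i. hausdorff_premeasure \<epsilon> s (A i)) + (\<Sum>i. ennreal (e * (1/2) ^ Suc i))"
      by (rule suminf_add[symmetric]) auto
    also have "(\<Sum>i. ennreal (e * (1/2) ^ Suc i)) = ennreal e"
      using sums_mult[OF power_half_series, of e] e
      by (intro suminf_ennreal_eq) auto
    finally show "hausdorff_premeasure \<epsilon> s (\<Union>i. A i) \<le> (\<Sum>i. hausdorff_premeasure \<epsilon> s (A i)) + ennreal e" .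
  qed
qed simp

lemma hausdorff_outer_measure_countably_subadditive:
  "hausdorff_outer_measure s (\<Union>i. A i) \<le> (\<Sum>i. hausdorff_outer_measure s (A i))"
proof (rule hausdorff_outer_measure_le)
  fix \<epsilon> :: real
  assume "0 < \<epsilon>"
  then have "(\<Sum>i. hausdorff_premeasure \<epsilon> s (A i)) \<le> (\<Sum>i. hausdorff_outer_measure s (A i))"
    by (intro suminf_le hausdorff_premeasure_le_outer) auto
  then show "hausdorff_premeasure \<epsilon> s (\<Union>i. A i) \<le> (\<Sum>i. hausdorff_outer_measure s (A i))"
    using hausdorff_premeasure_countably_subadditive order_trans by blast
qed

lemma hausdorff_outer_measure_Un:
  "hausdorff_outer_measure s (A \<union> B) \<le> hausdorff_outer_measure s A + hausdorff_outer_measure s B"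
proof -
  define C where "C i = (if i = 0 then A else if i = Suc 0 then B else {})" for i
  have "(\<Union>i. C i) = A \<union> B"
    by (auto simp: C_def split: if_splits)
  moreover have "(\<Sum>i. hausdorff_outer_measure s (C i)) = (\<Sum>i\<in>{0, 1}. hausdorff_outer_measure s (C i))"
    by (rule suminf_finite) (auto simp: C_def)
  ultimately show ?thesis
    using hausdorff_outer_measure_countably_subadditive[of s C] by (simp add: C_def)
qed

text \<open>Once the mesh is below \<open>e\<close>, no covering set meets both parts, so a cover of
  the union splits into two covers with no set counted twice.\<close>

lemma hausdorff_outer_measure_separated:
  assumes e: "0 < e" "\<And>a b. a \<in> A \<Longrightarrow> b \<in> B \<Longrightarrow> e \<le> dist a b"
  shows "hausdorff_outer_measure s A + hausdorff_outer_measure s B \<le> hausdorff_outer_measure s (A \<union> B)"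
proof -
  have pre: "hausdorff_premeasure \<epsilon> s A + hausdorff_premeasure \<epsilon> s B \<le> hausdorff_premeasure \<epsilon> s (A \<union> B)"
    if \<epsilon>: "0 < \<epsilon>" "\<epsilon> < e" for \<epsilon>
    unfolding hausdorff_premeasure_def[of \<epsilon> s "A \<union> B"]
  proof (rule INF_greatest)
    fix U :: "nat \<Rightarrow> 'a set"
    assume "U \<in> {U. (\<forall>i. bounded (U i) \<and> diameter (U i) \<le> \<epsilon>) \<and> A \<union> B \<subseteq> (\<Union>i. U i)}"
    then have U: "\<And>i. bounded (U i)" "\<And>i. diameter (U i) \<le> \<epsilon>" "A \<union> B \<subseteq> (\<Union>i. U i)" by auto
    define V where "V C i = (if U i \<inter> C = {} then {} else U i)" for C i
    have V: "hausdorff_premeasure \<epsilon> s C \<le> (\<Sum>i. diam_weight s (V C i))" if "C \<subseteq> A \<union> B" for C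
    proof (rule hausdorff_premeasure_le_cover)
      show "bounded (V C i)" "diameter (V C i) \<le> \<epsilon>" for i
        using U \<epsilon> by (auto simp: V_def)
      show "C \<subseteq> (\<Union>i. V C i)"
        using U(3) that by (fastforce simp: V_def)
    qed
    have "diam_weight s (V A i) + diam_weight s (V B i) \<le> diam_weight s (U i)" for i
    proof -
      have "U i \<inter> A = {} \<or> U i \<inter> B = {}"
      proof (rule ccontr)
        assume "\<not> ?thesis"
        then obtain a b where "a \<in> U i" "a \<in> A" "b \<in> U i" "b \<in> B" by blast
        then have "e \<le> dist a b" "dist a b \<le> diameter (U i)"
          using e(2) diameter_bounded_bound U(1) by blast+
        then show False using U(2)[of i] \<epsilon> by linarith
      qed
      then show ?thesis by (auto simp: V_def diam_weight_def)
    qed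
    then have "(\<Sum>i. diam_weight s (V A i)) + (\<Sum>i. diam_weight s (V B i)) \<le> (\<Sum>i. diam_weight s (U i))"
      by (subst suminf_add) (auto intro!: suminf_le)
    then show "hausdorff_premeasure \<epsilon> s A + hausdorff_premeasure \<epsilon> s B \<le> (\<Sum>i. diam_weight s (U i))"
      using V[of A] V[of B] by (meson Un_upper1 Un_upper2 add_mono order_trans)
  qed
  \<comment> \<open>The two suprema are taken one after the other, so the inequality is needed for
    independent mesh sizes; both are lowered to a common one below \<open>e\<close>.\<close>
  have two: "hausdorff_premeasure \<epsilon> s A + hausdorff_premeasure \<epsilon>' s B \<le> hausdorff_outer_measure s (A \<union> B)"
    if "0 < \<epsilon>" "0 < \<epsilon>'" for \<epsilon> \<epsilon>'
  proof -
    define \<eta> where "\<eta> = min (min \<epsilon> \<epsilon>') (e / 2)"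
    have \<eta>: "0 < \<eta>" "\<eta> < e" "\<eta> \<le> \<epsilon>" "\<eta> \<le> \<epsilon>'" using that e by (auto simp: \<eta>_def)
    have "hausdorff_premeasure \<epsilon> s A + hausdorff_premeasure \<epsilon>' s B
        \<le> hausdorff_premeasure \<eta> s A + hausdorff_premeasure \<eta> s B"
      by (intro add_mono hausdorff_premeasure_antimono \<eta>)
    also have "\<dots> \<le> hausdorff_premeasure \<eta> s (A \<union> B)"
      by (rule pre[OF \<eta>(1,2)])
    also have "\<dots> \<le> hausdorff_outer_measure s (A \<union> B)"
      by (rule hausdorff_premeasure_le_outer[OF \<eta>(1)])
    finally show ?thesis .
  qed
  have "hausdorff_premeasure \<epsilon> s A + hausdorff_outer_measure s B \<le> hausdorff_outer_measure s (A \<union> B)"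
    if "0 < \<epsilon>" for \<epsilon>
    unfolding hausdorff_outer_measure_def[of s B]
    by (subst ennreal_SUP_add_right) (auto intro!: SUP_least two that simp: gt_ex)
  then show ?thesis
    unfolding hausdorff_outer_measure_def[of s A]
    by (subst ennreal_SUP_add_left[symmetric]) (auto intro!: SUP_least simp: gt_ex)
qed

section \<open>Dependence on the exponent, and Hausdorff dimension\<close>

lemma diam_weight_le_powr_mult:
  assumes "0 \<le> s" "s < t" "bounded U" "diameter U \<le> \<epsilon>" "0 < \<epsilon>"
  shows "diam_weight t U \<le> ennreal (\<epsilon> powr (t - s)) * diam_weight s U"
proof -
  have d: "0 \<le> diameter U" using assms diameter_ge_0 by blast
  have *: "diameter U powr (t - s) \<le> \<epsilon> powr (t - s)"
    using assms d by (intro powr_mono2) auto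
  have "diameter U powr t = diameter U powr (t - s) * diameter U powr s"
    by (simp add: powr_add[symmetric])
  also have "\<dots> \<le> \<epsilon> powr (t - s) * diameter U powr s"
    using * by (intro mult_right_mono) auto
  finally show ?thesis
    using assms * by (auto simp: diam_weight_def ennreal_mult[symmetric] intro!: ennreal_leI)
qed

text \<open>Raising the exponent gains a factor \<open>\<epsilon> powr (t - s)\<close> on a cover of
  mesh \<open>\<epsilon>\<close>, which tends to 0 while the sum for exponent \<open>s\<close> stays
  below \<open>h + 1\<close>.\<close>

lemma hausdorff_outer_measure_eq_0:
  assumes "0 \<le> s" "s < t" "hausdorff_outer_measure s A < \<infinity>"
  shows "hausdorff_outer_measure t A = 0"
proof -
  obtain h where h: "hausdorff_outer_measure s A = ennreal h" "0 \<le> h"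
    using assms(3) by (cases "hausdorff_outer_measure s A") auto
  have 1: "hausdorff_premeasure \<epsilon> t A \<le> ennreal (\<epsilon> powr (t - s) * (h + 1))"
    if "0 < \<epsilon>" for \<epsilon>
  proof -
    have le: "hausdorff_premeasure \<epsilon> s A \<le> ennreal h"
      using hausdorff_premeasure_le_outer[OF that, of s A] h by simp
    then have "hausdorff_premeasure \<epsilon> s A \<noteq> \<infinity>"
      using ennreal_less_top leD by fastforce
    then obtain U where U: "\<And>i. bounded (U i)" "\<And>i. diameter (U i) \<le> \<epsilon>" "A \<subseteq> (\<Union>i. U i)"
      and "(\<Sum>i. diam_weight s (U i)) < hausdorff_premeasure \<epsilon> s A + ennreal 1"
      using INF_approx_ennreal[OF _ hausdorff_premeasure_def, of 1 \<epsilon> s A] by auto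
    then have *: "(\<Sum>i. diam_weight s (U i)) \<le> ennreal (h + 1)"
      using le h(2) by (metis add_right_mono ennreal_plus less_imp_le order_trans zero_le_one)
    have "hausdorff_premeasure \<epsilon> t A \<le> (\<Sum>i. diam_weight t (U i))"
      using U by (intro hausdorff_premeasure_le_cover) auto
    also have "\<dots> \<le> (\<Sum>i. ennreal (\<epsilon> powr (t - s)) * diam_weight s (U i))"
      using U assms that by (intro suminf_le diam_weight_le_powr_mult) auto
    also have "\<dots> \<le> ennreal (\<epsilon> powr (t - s)) * ennreal (h + 1)"
      using * by (simp add: mult_left_mono)
    finally show ?thesis
      using h by (simp add: ennreal_mult)
  qed
  have "hausdorff_outer_measure t A \<le> 0"
  proof (rule hausdorff_outer_measure_le)
    fix \<epsilon> :: real
    assume \<epsilon>: "0 < \<epsilon>"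
    have "((\<lambda>x. ennreal (x powr (t - s) * (h + 1))) \<longlongrightarrow> ennreal (0 * (h + 1))) (at_right 0)"
    proof (intro tendsto_ennrealI tendsto_mult tendsto_const)
      show "((\<lambda>x. x powr (t - s)) \<longlongrightarrow> 0) (at_right 0)"
        using assms by (intro tendsto_zero_powrI[where b = "t - s"] tendsto_ident_at tendsto_const)
          (auto simp: eventually_at_right_less eventually_at_filter)
    qed
    moreover have "\<forall>\<^sub>F x in at_right 0. hausdorff_premeasure \<epsilon> t A \<le> ennreal (x powr (t - s) * (h + 1))"
      using eventually_at_right_real[OF \<epsilon>]
    proof eventually_elim
      case (elim x)
      then have "hausdorff_premeasure \<epsilon> t A \<le> hausdorff_premeasure x t A"
        by (intro hausdorff_premeasure_antimono) auto
      then show ?case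
        using 1[of x] elim by simp
    qed
    ultimately have "hausdorff_premeasure \<epsilon> t A \<le> ennreal (0 * (h + 1))"
      by (rule tendsto_lowerbound) simp
    then show "hausdorff_premeasure \<epsilon> t A \<le> 0" by simp
  qed
  then show ?thesis by simp
qed

lemma hausdorff_dim_eqI:
  assumes "0 \<le> s" "0 < hausdorff_outer_measure s A" "hausdorff_outer_measure s A < \<infinity>"
  shows "hausdorff_dim A = ereal s"
  unfolding hausdorff_dim_def
proof (rule antisym)
  show "(INF t\<in>{t. 0 \<le> t \<and> hausdorff_outer_measure t A = 0}. ereal t) \<le> ereal s"
  proof (rule ereal_le_epsilon2)
    fix e :: real
    assume "0 < e"
    then have "s + e \<in> {t. 0 \<le> t \<and> hausdorff_outer_measure t A = 0}"
      using assms hausdorff_outer_measure_eq_0[of s "s + e" A] by auto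
    then show "(INF t\<in>{t. 0 \<le> t \<and> hausdorff_outer_measure t A = 0}. ereal t) \<le> ereal s + ereal e"
      by (auto intro: INF_lower)
  qed
  show "ereal s \<le> (INF t\<in>{t. 0 \<le> t \<and> hausdorff_outer_measure t A = 0}. ereal t)"
  proof (rule INF_greatest)
    fix t
    assume t: "t \<in> {t. 0 \<le> t \<and> hausdorff_outer_measure t A = 0}"
    have "\<not> t < s"
      using hausdorff_outer_measure_eq_0[of t s A] t assms by auto
    then show "ereal s \<le> ereal t" by simp
  qed
qed

text \<open>Half lines satisfy the Caratheodory condition because the part of \<open>A\<close> within \<open>e\<close> of the
  endpoint is negligible, while the remaining two parts are separated.\<close>

lemma emeasure_hausdorff_measure_on:
  fixes A :: "real set"
  assumes small: "\<And>t \<eta>. 0 < \<eta> \<Longrightarrow> \<exists>e>0. hausdorff_outer_measure s (A \<inter> {t - e..t + e}) \<le> ennreal \<eta>"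
    and B: "B \<in> sets borel"
  shows "emeasure (hausdorff_measure_on s A) B = hausdorff_outer_measure s (B \<inter> A)"
proof -
  let ?f = "\<lambda>B. hausdorff_outer_measure s (B \<inter> A)"
  let ?L = "lambda_system UNIV (Pow UNIV) ?f"
  interpret sigma_algebra UNIV "Pow (UNIV :: real set)"
    by (rule sigma_algebra_Pow)
  have oms: "outer_measure_space (Pow UNIV) ?f"
    unfolding outer_measure_space_def positive_def increasing_def countably_subadditive_def
    using hausdorff_outer_measure_countably_subadditive[of s "\<lambda>i. _ i \<inter> A"]
    by (auto intro!: hausdorff_outer_measure_mono)
  have ms: "measure_space UNIV ?L ?f"
    by (rule caratheodory_lemma[OF oms])
  have half: "{..t} \<in> ?L" for t
  proof -
    have "?f (X \<inter> {..t}) + ?f (X - {..t}) = ?f X" for X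
    proof (rule antisym)
      show "?f (X \<inter> {..t}) + ?f (X - {..t}) \<le> ?f X"
      proof (rule ennreal_le_epsilon)
        fix \<eta> :: real
        assume \<eta>: "0 < \<eta>"
        then obtain e where e: "e > 0" "hausdorff_outer_measure s (A \<inter> {t - e..t + e}) \<le> ennreal \<eta>"
          using small by blast
        have "?f (X \<inter> {..t}) \<le> ?f (X \<inter> {..t - e}) + hausdorff_outer_measure s (A \<inter> {t - e..t + e})"
          by (rule order_trans[OF hausdorff_outer_measure_mono hausdorff_outer_measure_Un])
             (use e in auto)
        then have "?f (X \<inter> {..t}) + ?f (X - {..t}) \<le> (?f (X \<inter> {..t - e}) + ennreal \<eta>) + ?f (X - {..t})"
          using e(2) by (meson add_left_mono add_right_mono order_trans)
        also have "\<dots> = (?f (X \<inter> {..t - e}) + ?f (X - {..t})) + ennreal \<eta>"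
          by (simp add: ac_simps)
        also have "\<dots> \<le> hausdorff_outer_measure s (X \<inter> {..t - e} \<inter> A \<union> (X - {..t}) \<inter> A) + ennreal \<eta>"
          by (intro add_right_mono hausdorff_outer_measure_separated[OF e(1)])
             (auto simp: dist_real_def)
        also have "\<dots> \<le> ?f X + ennreal \<eta>"
          by (intro add_right_mono hausdorff_outer_measure_mono) auto
        finally show "?f (X \<inter> {..t}) + ?f (X - {..t}) \<le> ?f X + ennreal \<eta>" .
      qed
      show "?f X \<le> ?f (X \<inter> {..t}) + ?f (X - {..t})"
        by (rule order_trans[OF hausdorff_outer_measure_mono hausdorff_outer_measure_Un]) auto
    qed
    then show ?thesis unfolding lambda_system_eq by auto
  qed
  have sub: "sets borel \<subseteq> ?L"
  proof -
    have "sigma_algebra UNIV ?L"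
      using ms by (simp add: measure_space_def)
    then have "sigma_sets UNIV (range (\<lambda>a. {..a})) \<subseteq> ?L"
      by (rule sigma_algebra.sigma_sets_subset) (use half in auto)
    then show ?thesis
      by (simp add: borel_eq_atMost)
  qed
  show ?thesis
    unfolding hausdorff_measure_on_def
  proof (rule emeasure_measure_of_sigma)
    show "sigma_algebra UNIV (sets borel :: real set set)"
      using sets.sigma_algebra_axioms[of "borel :: real measure"] by simp
    show "positive (sets borel) ?f"
      by (simp add: positive_def)
    show "countably_additive (sets borel) ?f"
      using ms sub unfolding measure_space_def countably_additive_def by blast
  qed (rule B)
qed

subsection \<open>Continued fraction cylinders\<close>

fun cf_map :: "nat list \<Rightarrow> real \<Rightarrow> real" where
  "cf_map [] x = x"
| "cf_map (a # w) x = 1 / (real a + cf_map w x)"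

text \<open>The denominator of \<open>cf_map w\<close>, written as a Moebius map in lowest terms; the derivative of
  \<open>cf_map w\<close> at \<open>x\<close> has modulus \<open>(cf_den w x)\<^sup>-\<^sup>2\<close>, and \<open>cf_den w 0\<close> is the continuant of \<open>w\<close>.\<close>

fun cf_den :: "nat list \<Rightarrow> real \<Rightarrow> real" where
  "cf_den [] x = 1"
| "cf_den (a # w) x = cf_den w x * (real a + cf_map w x)"

definition cyl :: "nat list \<Rightarrow> real set" where
  "cyl w = cf_map w ` {0..1}"

lemma cf_map_append: "cf_map (v @ w) x = cf_map v (cf_map w x)"
  by (induction v) auto

lemma cf_den_append: "cf_den (v @ w) x = cf_den v (cf_map w x) * cf_den w x"
  by (induction v) (auto simp: cf_map_append)

lemma cf_map_nonneg: "0 \<le> x \<Longrightarrow> 0 \<le> cf_map w x"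
  by (induction w) auto

lemma cf_map_le_1: "0 \<notin> set w \<Longrightarrow> 0 \<le> x \<Longrightarrow> x \<le> 1 \<Longrightarrow> cf_map w x \<le> 1"
proof (cases w)
  case (Cons a v)
  assume "0 \<notin> set w" "0 \<le> x"
  then have "1 \<le> real a + cf_map v x"
    using cf_map_nonneg[of x v] Cons by (auto simp: Suc_le_eq intro: add_increasing2)
  then show ?thesis using Cons by simp
qed simp

text \<open>The witness \<open>q\<close> is the continuant of \<open>w\<close>, and
  \<open>q'\<close> that of \<open>w\<close> without its last letter (0 for the empty word).
  Induction from the right is the classical recursion for continuants; \<open>q' \<le> q\<close> is
  the source of the distortion factor 2.\<close>

lemma cf_den_affine:
  assumes "0 \<notin> set w"
  shows "\<exists>q q'. 0 \<le> q' \<and> q' \<le> q \<and> 1 \<le> q \<and> (\<forall>x\<ge>0. cf_den w x = q + q' * x)"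
  using assms
proof (induction w rule: rev_induct)
  case Nil
  show ?case by (intro exI[of _ 1] exI[of _ 0]) auto
next
  case (snoc a w)
  then obtain q q' where q: "0 \<le> q'" "q' \<le> q" "1 \<le> q" "\<And>x. 0 \<le> x \<Longrightarrow> cf_den w x = q + q' * x"
    by auto
  have a: "1 \<le> real a" using snoc.prems by (auto simp: Suc_le_eq)
  have 1: "q * 1 \<le> q * real a" using a q by (intro mult_left_mono) auto
  then have 2: "q \<le> q * real a + q'" "1 \<le> q * real a + q'" using q by linarith+
  have "cf_den (w @ [a]) x = (q * real a + q') + q * x" if "0 \<le> x" for x
    using that a q(4)[of "1 / (real a + x)"] by (simp add: cf_den_append field_simps)
  then show ?case
    using q(3) 2 by (intro exI[of _ "q * real a + q'"] exI[of _ q]) auto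
qed

lemma cf_den_ge_1: "0 \<notin> set w \<Longrightarrow> 1 \<le> cf_den w 0"
  using cf_den_affine[of w] by auto

lemma cf_den_mono: "0 \<notin> set w \<Longrightarrow> 0 \<le> x \<Longrightarrow> x \<le> y \<Longrightarrow> cf_den w x \<le> cf_den w y"
  using cf_den_affine[of w] by (auto intro!: mult_left_mono)

lemma cf_den_le_double: "0 \<notin> set w \<Longrightarrow> 0 \<le> x \<Longrightarrow> x \<le> 1 \<Longrightarrow> cf_den w x \<le> 2 * cf_den w 0"
proof -
  assume "0 \<notin> set w" "0 \<le> x" "x \<le> 1"
  then obtain q q' where q: "0 \<le> q'" "q' \<le> q" "1 \<le> q" "\<And>x. 0 \<le> x \<Longrightarrow> cf_den w x = q + q' * x"
    using cf_den_affine by blast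
  have "q' * x \<le> q * 1" using q \<open>0 \<le> x\<close> \<open>x \<le> 1\<close> by (intro mult_mono) auto
  then show ?thesis using q \<open>0 \<le> x\<close> by auto
qed

section \<open>Multiplicativity and growth of continuants\<close>

lemma cf_den_append_ge:
  assumes "0 \<notin> set v" "0 \<notin> set w"
  shows "cf_den v 0 * cf_den w 0 \<le> cf_den (v @ w) 0"
  using cf_den_mono[OF assms(1), of 0 "cf_map w 0"] cf_den_ge_1[OF assms(2)] cf_map_nonneg[of 0 w]
  by (simp add: cf_den_append mult_right_mono)

lemma cf_den_append_le:
  assumes "0 \<notin> set v" "0 \<notin> set w"
  shows "cf_den (v @ w) 0 \<le> 2 * cf_den v 0 * cf_den w 0"
  using cf_den_le_double[OF assms(1), of "cf_map w 0"] cf_den_ge_1[OF assms(2)]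
    cf_map_nonneg[of 0 w] cf_map_le_1[OF assms(2), of 0]
  by (simp add: cf_den_append mult_right_mono)

text \<open>A single letter 1 may leave the continuant unchanged, but two consecutive letters at
  least double it, hence the induction by pairs.\<close>

lemma cf_den_ge_power: "0 \<notin> set w \<Longrightarrow> 2 ^ (length w div 2) \<le> cf_den w 0"
proof (induction w rule: induct_list012)
  case (2 x)
  then show ?case by (auto simp: Suc_le_eq)
next
  case (3 a b w)
  have a: "1 \<le> real a" "1 \<le> real b" using "3.prems" by (auto simp: Suc_le_eq)
  define y where "y = real b + cf_map w 0"
  have y: "1 \<le> y" using a cf_map_nonneg[of 0 w] by (simp add: y_def)
  have "1 * 1 \<le> real a * y" using a y by (intro mult_mono) auto
  then have "2 \<le> y * (real a + 1 / y)" using y by (simp add: field_simps)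
  then have "2 ^ (length w div 2) * 2 \<le> cf_den w 0 * (y * (real a + 1 / y))"
    using 3 cf_den_ge_1[of w] by (intro mult_mono) auto
  then show ?case by (simp add: y_def mult_ac)
qed simp

text \<open>An exact identity, because the Moebius map has determinant of modulus 1. The two
  estimates after it bound each denominator between the continuant and its double.\<close>

lemma cf_map_diff:
  assumes "0 \<notin> set w" "0 \<le> x" "0 \<le> y"
  shows "\<bar>cf_map w x - cf_map w y\<bar> = \<bar>x - y\<bar> / (cf_den w x * cf_den w y)"
  using assms
proof (induction w)
  case (Cons a w)
  have a: "0 < real a" using Cons.prems by auto
  let ?u = "real a + cf_map w x" and ?v = "real a + cf_map w y"
  have p: "0 < ?u" "0 < ?v" using a cf_map_nonneg Cons.prems by (auto intro: add_pos_nonneg)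
  have "\<bar>1 / ?u - 1 / ?v\<bar> = \<bar>cf_map w x - cf_map w y\<bar> / (?u * ?v)"
    using p by (simp add: diff_frac_eq abs_mult abs_minus_commute)
  then show ?case using Cons by (simp add: mult_ac)
qed simp

lemma cf_map_diff_le:
  assumes "0 \<notin> set w" "0 \<le> x" "0 \<le> y"
  shows "\<bar>cf_map w x - cf_map w y\<bar> \<le> \<bar>x - y\<bar> / (cf_den w 0)\<^sup>2"
proof -
  have d: "1 \<le> cf_den w 0" "cf_den w 0 \<le> cf_den w x" "cf_den w 0 \<le> cf_den w y"
    using cf_den_mono[OF assms(1), of 0] cf_den_ge_1[OF assms(1)] assms by auto
  then have "(cf_den w 0)\<^sup>2 \<le> cf_den w x * cf_den w y"
    unfolding power2_eq_square by (intro mult_mono) auto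
  then show ?thesis
    unfolding cf_map_diff[OF assms] using d by (intro divide_left_mono mult_pos_pos zero_less_power) auto
qed

lemma cf_map_diff_ge:
  assumes "0 \<notin> set w" "0 \<le> x" "x \<le> 1" "0 \<le> y" "y \<le> 1"
  shows "\<bar>x - y\<bar> \<le> 4 * (cf_den w 0)\<^sup>2 * \<bar>cf_map w x - cf_map w y\<bar>"
proof -
  have p: "0 < cf_den w x" "0 < cf_den w y"
    using cf_den_mono[OF assms(1), of 0] cf_den_ge_1[OF assms(1)] assms by force+
  have "cf_den w x * cf_den w y \<le> (2 * cf_den w 0) * (2 * cf_den w 0)"
    using p cf_den_le_double[OF assms(1)] cf_den_ge_1[OF assms(1)] assms by (intro mult_mono) auto
  then have "\<bar>x - y\<bar> / (cf_den w x * cf_den w y) * (cf_den w x * cf_den w y)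
      \<le> \<bar>x - y\<bar> / (cf_den w x * cf_den w y) * (4 * (cf_den w 0)\<^sup>2)"
    using p by (intro mult_left_mono) (auto simp: power2_eq_square)
  then show ?thesis
    using p by (simp add: cf_map_diff[OF assms(1,2,4)] mult_ac)
qed

lemma continuous_on_cf_map: "0 \<notin> set w \<Longrightarrow> continuous_on {0..} (cf_map w)"
proof (induction w)
  case (Cons a w)
  have "real a + cf_map w x \<noteq> 0" if "x \<in> {0..}" for x
    using cf_map_nonneg[of x w] that Cons.prems by (auto simp: add_nonneg_eq_0_iff)
  then show ?case using Cons by (auto intro!: continuous_intros)
qed simp

lemma cyl_subset_unit: "0 \<notin> set w \<Longrightarrow> cyl w \<subseteq> {0..1}"
  unfolding cyl_def using cf_map_nonneg cf_map_le_1 by force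

lemma cyl_append: "cyl (v @ w) = cf_map v ` cyl w"
  unfolding cyl_def by (simp add: cf_map_append image_image)

lemma cyl_append_subset: "0 \<notin> set w \<Longrightarrow> cyl (v @ w) \<subseteq> cyl v"
  unfolding cyl_append using cyl_subset_unit[of w] by (auto simp: cyl_def)

lemma cyl_Cons: "cyl (a # w) = (\<lambda>x. 1 / (real a + x)) ` cyl w"
  by (auto simp: cyl_def image_iff)

lemma compact_cyl: "0 \<notin> set w \<Longrightarrow> compact (cyl w)"
  unfolding cyl_def
  by (intro compact_continuous_image continuous_on_subset[OF continuous_on_cf_map]) auto

lemma cyl_nonempty: "cyl w \<noteq> {}"
  by (simp add: cyl_def)

lemma cyl_dist_le:
  assumes "0 \<notin> set w" "x \<in> cyl w" "y \<in> cyl w"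
  shows "\<bar>x - y\<bar> \<le> 1 / (cf_den w 0)\<^sup>2"
proof -
  obtain s t where st: "s \<in> {0..1}" "t \<in> {0..1}" "x = cf_map w s" "y = cf_map w t"
    using assms by (auto simp: cyl_def)
  have "\<bar>x - y\<bar> \<le> \<bar>s - t\<bar> / (cf_den w 0)\<^sup>2"
    using cf_map_diff_le[OF assms(1), of s t] st by auto
  also have "\<dots> \<le> 1 / (cf_den w 0)\<^sup>2"
    using st by (intro divide_right_mono) auto
  finally show ?thesis .
qed

lemma cyl_dist_le_power:
  assumes "0 \<notin> set w" "x \<in> cyl w" "y \<in> cyl w"
  shows "\<bar>x - y\<bar> \<le> (1 / 2) ^ (length w div 2)"
proof -
  have "2 ^ (length w div 2) * 1 \<le> cf_den w 0 * cf_den w 0"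
    using cf_den_ge_power[OF assms(1)] cf_den_ge_1[OF assms(1)] by (intro mult_mono) auto
  then have "1 / (cf_den w 0)\<^sup>2 \<le> 1 / 2 ^ (length w div 2)"
    by (intro divide_left_mono) (auto simp: power2_eq_square intro!: mult_pos_pos
        less_le_trans[OF _ cf_den_ge_1[OF assms(1)]])
  then show ?thesis
    using cyl_dist_le[OF assms] by (simp add: power_one_over)
qed

lemma cyl_endpoints_dist:
  assumes "0 \<notin> set w"
  shows "1 \<le> 4 * (cf_den w 0)\<^sup>2 * \<bar>cf_map w 1 - cf_map w 0\<bar>"
  using cf_map_diff_ge[OF assms, of 1 0] by simp

lemma diameter_cyl_le:
  assumes "0 \<notin> set w"
  shows "diameter (cyl w) \<le> 1 / (cf_den w 0)\<^sup>2"
  by (rule diameter_le) (use cyl_dist_le[OF assms] cyl_nonempty in auto)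

lemma cf_map_Rats: "x \<in> \<rat> \<Longrightarrow> cf_map w x \<in> \<rat>"
  by (induction w) auto

text \<open>Neighbouring cylinders share only endpoints. Irrationality excludes
  \<open>y = 1\<close>, the one case in which the floor of \<open>1 / x\<close> would not be the
  first letter.\<close>

lemma irrational_cyl_Cons:
  assumes "x \<notin> \<rat>" "x \<in> cyl (a # w)" "0 < a" "0 \<notin> set w"
  shows "int a = \<lfloor>1 / x\<rfloor>" "1 / x - real a \<in> cyl w" "1 / x - real a \<notin> \<rat>"
proof -
  obtain y where y: "y \<in> cyl w" "x = 1 / (real a + y)"
    using assms by (auto simp: cyl_Cons)
  have y01: "0 \<le> y" "y \<le> 1" using y(1) cyl_subset_unit[OF assms(4)] by auto
  have eq: "1 / x = real a + y" using y by simp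
  have "y \<notin> \<rat>" using assms(1) y(2) by auto
  then have "y \<noteq> 1" by auto
  then show "int a = \<lfloor>1 / x\<rfloor>" using eq y01 by (intro floor_unique[symmetric]) auto
  show "1 / x - real a \<in> cyl w" "1 / x - real a \<notin> \<rat>" using eq y \<open>y \<notin> \<rat>\<close> by auto
qed

lemma irrational_cyl_unique:
  assumes "length v = length w" "x \<notin> \<rat>" "x \<in> cyl v" "x \<in> cyl w" "0 \<notin> set v" "0 \<notin> set w"
  shows "v = w"
  using assms
proof (induction v w arbitrary: x rule: list_induct2)
  case (Cons a v b w)
  have a: "int a = \<lfloor>1 / x\<rfloor>" "1 / x - real a \<in> cyl v" "1 / x - real a \<notin> \<rat>"
    using irrational_cyl_Cons[of x a v] Cons.prems by auto
  have b: "int b = \<lfloor>1 / x\<rfloor>" "1 / x - real b \<in> cyl w"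
    using irrational_cyl_Cons[of x b w] Cons.prems by auto
  have "a = b" using a b by simp
  moreover have "1 / x - real a \<in> cyl w" using b(2) calculation by simp
  ultimately show ?case using Cons.IH[of "1 / x - real a"] a Cons.prems by auto
qed simp

subsection \<open>Expansions of irrational numbers\<close>

abbreviation prefix_word :: "(nat \<Rightarrow> nat) \<Rightarrow> nat \<Rightarrow> nat list" where
  "prefix_word \<omega> n \<equiv> map \<omega> [0..<n]"

lemma zero_notin_prefix_word: "(\<And>n. 0 < \<omega> n) \<Longrightarrow> 0 \<notin> set (prefix_word \<omega> n)"
  by (metis imageE list.set_map neq0_conv)

lemma prefix_word_Suc: "prefix_word \<omega> (Suc n) = \<omega> 0 # prefix_word (\<omega> \<circ> Suc) n"
  by (simp add: upt_conv_Cons map_Suc_upt[symmetric] del: upt_Suc)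

lemma cf_convergent_eq: "cf_convergent n \<omega> = cf_map (prefix_word \<omega> n) 0"
  by (induction n arbitrary: \<omega>) (simp_all add: prefix_word_Suc del: upt_Suc)

lemma prefix_word_add: "prefix_word \<omega> (m + n) = prefix_word \<omega> m @ prefix_word (\<lambda>k. \<omega> (m + k)) n"
  by (rule nth_equalityI) (auto simp: nth_append)

lemma cyl_prefix_word_antimono:
  assumes "\<And>n. 0 < \<omega> n" "m \<le> n"
  shows "cyl (prefix_word \<omega> n) \<subseteq> cyl (prefix_word \<omega> m)"
proof -
  have "0 \<notin> set (prefix_word (\<lambda>k. \<omega> (m + k)) (n - m))"
    by (rule zero_notin_prefix_word) (rule assms(1))
  then show ?thesis
    using cyl_append_subset prefix_word_add[of \<omega> m "n - m"] assms(2) by simp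
qed

lemma half_power_div_2_tendsto_0: "(\<lambda>n. (1 / 2 :: real) ^ (n div 2)) \<longlonglongrightarrow> 0"
proof -
  have "filterlim (\<lambda>n::nat. n div 2) sequentially sequentially"
    unfolding filterlim_at_top
  proof
    fix Z :: nat
    show "\<forall>\<^sub>F n in sequentially. Z \<le> n div 2"
      by (rule eventually_sequentiallyI[of "2 * Z"]) auto
  qed
  moreover have "(\<lambda>n. (1 / 2 :: real) ^ n) \<longlonglongrightarrow> 0"
    by (rule LIMSEQ_realpow_zero) auto
  ultimately show ?thesis
    by (rule filterlim_compose[rotated])
qed

lemma has_cf_expansionI:
  assumes "\<And>n. 0 < \<omega> n" "\<And>n. x \<in> cyl (prefix_word \<omega> n)"
  shows "has_cf_expansion x \<omega>"
proof -
  have pos: "0 \<notin> set (prefix_word \<omega> n)" for n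
    by (rule zero_notin_prefix_word) (rule assms)
  have "\<bar>cf_convergent n \<omega> - x\<bar> \<le> (1 / 2) ^ (n div 2)" for n
    using cyl_dist_le_power[OF pos, of "cf_convergent n \<omega>" n x] assms(2)[of n]
    by (auto simp: cf_convergent_eq cyl_def)
  then have "(\<lambda>n. cf_convergent n \<omega> - x) \<longlonglongrightarrow> 0"
    by (intro Lim_null_comparison[OF _ half_power_div_2_tendsto_0]) auto
  then show ?thesis
    using assms(1) by (auto simp: has_cf_expansion_def LIM_zero_iff)
qed

lemma has_cf_expansionD:
  assumes "has_cf_expansion x \<omega>"
  shows "0 < \<omega> n" "x \<in> cyl (prefix_word \<omega> n)"
proof -
  have \<omega>: "\<And>n. 0 < \<omega> n" using assms by (auto simp: has_cf_expansion_def)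
  show "0 < \<omega> n" by (rule \<omega>)
  have pos: "0 \<notin> set (prefix_word \<omega> n)" for n
    by (rule zero_notin_prefix_word) (rule \<omega>)
  have "cf_convergent m \<omega> \<in> cyl (prefix_word \<omega> n)" if "n \<le> m" for m
    using cyl_prefix_word_antimono[of \<omega>, OF \<omega> that] by (auto simp: cf_convergent_eq cyl_def)
  then have "\<forall>\<^sub>F m in sequentially. cf_convergent m \<omega> \<in> cyl (prefix_word \<omega> n)"
    by (auto simp: eventually_sequentially)
  then show "x \<in> cyl (prefix_word \<omega> n)"
    by (rule Lim_in_closed_set[OF compact_imp_closed[OF compact_cyl[OF pos]]])
       (use assms in \<open>auto simp: has_cf_expansion_def\<close>)
qed

text \<open>Here \<open>g\<close> is the Gauss map. It preserves irrationality, so the orbit of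
  \<open>x\<close> stays strictly between 0 and 1, and the entries are the floors of the reciprocals
  along it.\<close>

lemma irrational_has_cf_expansion:
  fixes x :: real
  assumes "x \<notin> \<rat>" "0 \<le> x" "x \<le> 1"
  shows "\<exists>\<omega>. has_cf_expansion x \<omega>"
proof -
  define g where "g y = 1 / y - real_of_int \<lfloor>1 / y\<rfloor>" for y :: real
  define \<omega> where "\<omega> n = nat \<lfloor>1 / (g ^^ n) x\<rfloor>" for n
  have g: "g y \<notin> \<rat> \<and> 0 < g y \<and> g y < 1" if "y \<notin> \<rat>" for y
  proof -
    have irr: "g y \<notin> \<rat>"
    proof
      assume "g y \<in> \<rat>"
      then have "g y + real_of_int \<lfloor>1 / y\<rfloor> \<in> \<rat>" by auto
      then have "1 / y \<in> \<rat>" unfolding g_def by simp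
      then have "1 / (1 / y) \<in> \<rat>" by (rule Rats_divide[OF Rats_1])
      then show False using that by simp
    qed
    have "0 \<le> g y" "g y < 1" unfolding g_def by linarith+
    then show ?thesis using irr by (metis Rats_0 order_less_le)
  qed
  have x01: "0 < x" "x < 1" using assms by (metis Rats_0 Rats_1 order_less_le)+
  have it: "(g ^^ n) x \<notin> \<rat> \<and> 0 < (g ^^ n) x \<and> (g ^^ n) x < 1" for n
    by (induction n) (use assms x01 g in auto)
  have \<omega>: "0 < \<omega> n" "(g ^^ n) x = 1 / (real (\<omega> n) + (g ^^ Suc n) x)" for n
  proof -
    have y: "0 < (g ^^ n) x" "(g ^^ n) x < 1" using it by auto
    then have "1 \<le> \<lfloor>1 / (g ^^ n) x\<rfloor>" by (simp add: le_floor_iff)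
    then show "0 < \<omega> n" "(g ^^ n) x = 1 / (real (\<omega> n) + (g ^^ Suc n) x)"
      using y by (auto simp: \<omega>_def g_def of_nat_nat)
  qed
  have "x = cf_map (prefix_word \<omega> n) ((g ^^ n) x)" for n
  proof (induction n)
    case (Suc n)
    have "cf_map (prefix_word \<omega> (Suc n)) y = cf_map (prefix_word \<omega> n) (1 / (real (\<omega> n) + y))" for y
      by (simp add: cf_map_append)
    then show ?case using Suc.IH by (simp only: \<omega>(2)[symmetric])
  qed simp
  then have "x \<in> cyl (prefix_word \<omega> n)" for n
    using it[of n] unfolding cyl_def by (metis atLeastAtMost_iff image_eqI less_imp_le)
  then show ?thesis using has_cf_expansionI \<omega>(1) by blast
qed

text \<open>Descent on the denominator \<open>b\<close>, via the Euclidean algorithm.\<close>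

lemma has_cf_expansion_imp_irrational:
  assumes "has_cf_expansion x \<omega>"
  shows "x \<notin> \<rat>"
proof -
  have "x \<noteq> real a / real b" if "\<And>n. 0 < \<omega> n" "\<And>n. x \<in> cyl (prefix_word \<omega> n)" for a b x \<omega>
    using that
  proof (induction b arbitrary: a x \<omega> rule: less_induct)
    case (less b)
    show ?case
    proof
      assume x: "x = real a / real b"
      define y where "y = 1 / x - real (\<omega> 0)"
      have S: "\<And>n. 0 < (\<omega> \<circ> Suc) n" using less.prems by simp
      have y: "y \<in> cyl (prefix_word (\<omega> \<circ> Suc) n)" and xy: "x = 1 / (real (\<omega> 0) + y)" for n :: nat
      proof -
        obtain z where "z \<in> cyl (prefix_word (\<omega> \<circ> Suc) n)" "x = 1 / (real (\<omega> 0) + z)"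
          using less.prems(2)[of "Suc n"] unfolding prefix_word_Suc cyl_Cons by auto
        moreover from this have "y = z" by (simp add: y_def)
        ultimately show "y \<in> cyl (prefix_word (\<omega> \<circ> Suc) n)" "x = 1 / (real (\<omega> 0) + y)" by auto
      qed
      have y01: "0 \<le> y" "y \<le> 1" using y[of 0] by (auto simp: cyl_def)
      have y0: "0 < y"
      proof -
        obtain z where "z \<in> {0..1}" "y = 1 / (real (\<omega> 1) + z)"
          using y[of 1] by (auto simp: cyl_def)
        then show ?thesis using less.prems(1)[of 1] by (auto intro!: divide_pos_pos add_pos_nonneg)
      qed
      have w0: "1 \<le> real (\<omega> 0)" using less.prems(1)[of 0] by (simp add: Suc_le_eq)
      have x01: "0 < x" "x < 1" using xy w0 y0 by auto
      \<comment> \<open>Positivity of \<open>x\<close> also rules out \<open>b = 0\<close>, where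
        the quotient is 0 by convention.\<close>
      then have ab: "0 < a" "0 < b" "a < b" using x by (auto simp: divide_less_eq zero_less_divide_iff split: if_splits)
      have "y = (real b - real (\<omega> 0) * real a) / real a"
        using ab unfolding y_def x by (simp add: field_simps)
      moreover have "\<omega> 0 * a \<le> b"
      proof -
        have "0 \<le> y * real a" using y0 by simp
        then have "real (\<omega> 0 * a) \<le> real b" using calculation ab by simp
        then show ?thesis by (simp only: of_nat_le_iff)
      qed
      ultimately have "y = real (b - \<omega> 0 * a) / real a" by (simp add: of_nat_diff)
      then show False using less.IH[OF ab(3) S y] by blast
    qed
  qed
  note * = this
  have "x \<in> {0..1}" using has_cf_expansionD(2)[OF assms, of 0] by (simp add: cyl_def)
  then show ?thesis
    using *[of \<omega> x] has_cf_expansionD[OF assms] Rats_abs_nat_div_natE[of x]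
    by (metis abs_of_nonneg atLeastAtMost_iff)
qed

lemma has_cf_expansion_exists:
  assumes "\<And>n. 0 < \<omega> n"
  shows "\<exists>x. has_cf_expansion x \<omega>"
proof -
  have pos: "0 \<notin> set (prefix_word \<omega> n)" for n
    by (rule zero_notin_prefix_word) (rule assms)
  have "\<Inter>(range (\<lambda>n. cyl (prefix_word \<omega> n))) \<noteq> {}"
    by (rule compact_nest) (auto simp: compact_cyl[OF pos] cyl_nonempty
        dest: cyl_prefix_word_antimono[of \<omega>, OF assms, THEN subsetD])
  then obtain x where "\<And>n. x \<in> cyl (prefix_word \<omega> n)" by auto
  then show ?thesis using has_cf_expansionI assms by blast
qed

lemma cf_set_iff:
  "x \<in> cf_set I \<longleftrightarrow> (\<exists>\<omega>. has_cf_expansion x \<omega> \<and> (\<forall>n. \<omega> n \<in> I))"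
proof
  assume "\<exists>\<omega>. has_cf_expansion x \<omega> \<and> (\<forall>n. \<omega> n \<in> I)"
  then obtain \<omega> where \<omega>: "has_cf_expansion x \<omega>" "\<forall>n. \<omega> n \<in> I" by blast
  have "x \<in> {0..1}" using has_cf_expansionD(2)[OF \<omega>(1), of 0] by (simp add: cyl_def)
  then show "x \<in> cf_set I"
    using \<omega> has_cf_expansion_imp_irrational by (auto simp: cf_set_def)
qed (auto simp: cf_set_def)

lemma cf_set_subset_unit: "cf_set I \<subseteq> {0..1}"
  by (auto simp: cf_set_def)

text \<open>The word is continued by a constant letter of \<open>I\<close>.\<close>

lemma cf_set_meets_cyl:
  assumes "set w \<subseteq> I" "0 \<notin> I" "I \<noteq> {}"
  shows "cf_set I \<inter> cyl w \<noteq> {}"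
proof -
  obtain a where a: "a \<in> I" using assms by auto
  define \<omega> where "\<omega> n = (if n < length w then w ! n else a)" for n
  have \<omega>: "\<omega> n \<in> I" for n using assms a nth_mem[of n w] by (auto simp: \<omega>_def simp del: nth_mem)
  then have "0 < \<omega> n" for n using assms(2) by (metis neq0_conv)
  then obtain x where x: "has_cf_expansion x \<omega>" using has_cf_expansion_exists by blast
  have "prefix_word \<omega> (length w) = w" by (rule nth_equalityI) (auto simp: \<omega>_def)
  then have "x \<in> cyl w" using has_cf_expansionD(2)[OF x, of "length w"] by simp
  moreover have "x \<in> cf_set I" using x \<omega> cf_set_iff by blast
  ultimately show ?thesis by blast
qed

text \<open>An irrational point is interior to the cylinder of each of its prefixes, and every
  irrational point of that cylinder has the same prefix. So the entries of an irrational limit point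
  are those of nearby points of the set.\<close>

lemma closure_cf_set_subset: "closure (cf_set I) \<subseteq> cf_set I \<union> \<rat>"
proof
  fix x
  assume x: "x \<in> closure (cf_set I)"
  show "x \<in> cf_set I \<union> \<rat>"
  proof (cases "x \<in> \<rat>")
    case False
    have "x \<in> {0..1}"
      using x closure_minimal[OF cf_set_subset_unit closed_atLeastAtMost] by blast
    then obtain \<omega> where \<omega>: "has_cf_expansion x \<omega>"
      using irrational_has_cf_expansion False by auto
    have "\<omega> k \<in> I" for k
    proof -
      let ?w = "prefix_word \<omega> (Suc k)"
      have pos: "0 \<notin> set ?w" by (rule zero_notin_prefix_word) (rule has_cf_expansionD(1)[OF \<omega>])
      have inj: "inj_on (cf_map ?w) {0<..<1}"
      proof (rule inj_onI)
        fix s t :: real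
        assume st: "s \<in> {0<..<1}" "t \<in> {0<..<1}" "cf_map ?w s = cf_map ?w t"
        then have "\<bar>s - t\<bar> \<le> 4 * (cf_den ?w 0)\<^sup>2 * \<bar>cf_map ?w s - cf_map ?w t\<bar>"
          by (intro cf_map_diff_ge[OF pos]) auto
        also have "\<dots> = 0" by (simp only: st(3)) simp
        finally show "s = t" by simp
      qed
      have "continuous_on {0<..<1} (cf_map ?w)"
        by (rule continuous_on_subset[OF continuous_on_cf_map[OF pos]]) auto
      then have "open (cf_map ?w ` {0<..<1})"
        using injective_eq_1d_open_map_UNIV[of "{0<..<1}" "cf_map ?w"] inj
        by (simp add: is_interval_oo)
      moreover have "x \<in> cf_map ?w ` {0<..<1}"
      proof -
        obtain y where y: "y \<in> {0..1}" "x = cf_map ?w y"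
          using has_cf_expansionD(2)[OF \<omega>, of "Suc k"] by (auto simp: cyl_def)
        moreover from this have "y \<noteq> 0" "y \<noteq> 1" using False cf_map_Rats by (metis Rats_0, metis Rats_1)
        ultimately show ?thesis by auto
      qed
      ultimately obtain z where z: "z \<in> cf_set I" "z \<in> cf_map ?w ` {0<..<1}"
        using x closure_iff_nhds_not_empty[of x "cf_set I"] by blast
      then have zw: "z \<in> cyl ?w" by (auto simp: cyl_def)
      obtain \<nu> where \<nu>: "has_cf_expansion z \<nu>" "\<forall>n. \<nu> n \<in> I" using z(1) cf_set_iff by blast
      have "prefix_word \<nu> (Suc k) = ?w"
      proof (rule irrational_cyl_unique)
        show "z \<notin> \<rat>" using z(1) by (simp add: cf_set_def)
        show "z \<in> cyl (prefix_word \<nu> (Suc k))" by (rule has_cf_expansionD(2)[OF \<nu>(1)])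
        show "0 \<notin> set (prefix_word \<nu> (Suc k))"
          by (rule zero_notin_prefix_word) (rule has_cf_expansionD(1)[OF \<nu>(1)])
      qed (use zw pos in auto)
      then have "\<nu> k = \<omega> k" by simp
      then show ?thesis using \<nu>(2) by metis
    qed
    then show ?thesis using \<omega> cf_set_iff by blast
  qed simp
qed

subsection \<open>Weighted sets of words\<close>

definition words :: "nat set \<Rightarrow> nat \<Rightarrow> nat list set" where
  "words I n = {w. length w = n \<and> set w \<subseteq> I}"

definition wt :: "real \<Rightarrow> nat list \<Rightarrow> real" where
  "wt \<delta> w = cf_den w 0 powr (- (2 * \<delta>))"

text \<open>Encoded as a measure on the type of all words, so that subadditivity, disjoint unions
  and continuity from below come from measure theory, and infinite masses are allowed.\<close>

definition mass :: "real \<Rightarrow> nat list set \<Rightarrow> ennreal" where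
  "mass \<delta> = emeasure (density (count_space UNIV) (\<lambda>w. ennreal (wt \<delta> w)))"

definition concat_words :: "nat list set \<Rightarrow> nat list set \<Rightarrow> nat list set" where
  "concat_words A B = (\<Union>v\<in>A. (@) v ` B)"

lemma wt_nonneg [simp]: "0 \<le> wt \<delta> w"
  by (simp add: wt_def)

lemma mass_eq_nn_integral: "mass \<delta> W = (\<integral>\<^sup>+ w. ennreal (wt \<delta> w) \<partial>count_space W)"
  by (simp add: mass_def emeasure_density nn_integral_count_space_indicator)

lemma mass_mono: "V \<subseteq> W \<Longrightarrow> mass \<delta> V \<le> mass \<delta> W"
  unfolding mass_def by (rule emeasure_mono) auto

lemma mass_empty [simp]: "mass \<delta> {} = 0"
  by (simp add: mass_def)

lemma mass_Un_le: "mass \<delta> (V \<union> W) \<le> mass \<delta> V + mass \<delta> W"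
  unfolding mass_def by (rule emeasure_subadditive) auto

lemma mass_UN_le: "mass \<delta> (\<Union>i. W i) \<le> (\<Sum>i::nat. mass \<delta> (W i))"
  unfolding mass_def by (rule emeasure_subadditive_countably) auto

lemma mass_finite: "finite W \<Longrightarrow> mass \<delta> W = ennreal (\<Sum>w\<in>W. wt \<delta> w)"
  by (simp add: mass_eq_nn_integral nn_integral_count_space_finite sum_ennreal)

lemma mass_incseq: "incseq W \<Longrightarrow> mass \<delta> (\<Union>i::nat. W i) = (SUP i. mass \<delta> (W i))"
  unfolding mass_def by (rule SUP_emeasure_incseq[symmetric]) auto

lemma mass_UN_disjoint:
  "countable J \<Longrightarrow> disjoint_family_on W J \<Longrightarrow>
    mass \<delta> (\<Union>i\<in>J. W i) = (\<integral>\<^sup>+ i. mass \<delta> (W i) \<partial>count_space J)"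
  unfolding mass_def by (rule emeasure_UN_countable) auto

lemma mass_image_le:
  assumes "0 \<le> c" "\<And>w. w \<in> W \<Longrightarrow> wt \<delta> (f w) \<le> c * wt \<delta> w" "inj_on f W"
  shows "mass \<delta> (f ` W) \<le> ennreal c * mass \<delta> W"
proof -
  have "mass \<delta> (f ` W) = (\<integral>\<^sup>+ w. ennreal (wt \<delta> (f w)) \<partial>count_space W)"
    using nn_integral_bij_count_space[OF inj_on_imp_bij_betw[OF assms(3)], of "\<lambda>w. ennreal (wt \<delta> w)"]
    by (simp add: mass_eq_nn_integral)
  also have "\<dots> \<le> (\<integral>\<^sup>+ w. ennreal c * ennreal (wt \<delta> w) \<partial>count_space W)"
    using assms by (intro nn_integral_mono) (auto simp: ennreal_mult[symmetric] intro!: ennreal_leI)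
  also have "\<dots> = ennreal c * mass \<delta> W"
    by (simp add: mass_eq_nn_integral nn_integral_cmult)
  finally show ?thesis .
qed

lemma mass_image_ge:
  assumes "0 \<le> c" "\<And>w. w \<in> W \<Longrightarrow> c * wt \<delta> w \<le> wt \<delta> (f w)" "inj_on f W"
  shows "ennreal c * mass \<delta> W \<le> mass \<delta> (f ` W)"
proof -
  have "ennreal c * mass \<delta> W = (\<integral>\<^sup>+ w. ennreal c * ennreal (wt \<delta> w) \<partial>count_space W)"
    by (simp add: mass_eq_nn_integral nn_integral_cmult)
  also have "\<dots> \<le> (\<integral>\<^sup>+ w. ennreal (wt \<delta> (f w)) \<partial>count_space W)"
    using assms by (intro nn_integral_mono) (auto simp: ennreal_mult[symmetric] intro!: ennreal_leI)
  also have "\<dots> = mass \<delta> (f ` W)"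
    using nn_integral_bij_count_space[OF inj_on_imp_bij_betw[OF assms(3)], of "\<lambda>w. ennreal (wt \<delta> w)"]
    by (simp add: mass_eq_nn_integral)
  finally show ?thesis .
qed

text \<open>A common length of the words in \<open>A\<close> makes the splitting of a concatenated
  word unique, so the pieces are disjoint.\<close>

lemma mass_concat_eq:
  assumes "\<And>v. v \<in> A \<Longrightarrow> length v = k"
  shows "mass \<delta> (concat_words A B) = (\<integral>\<^sup>+ v. mass \<delta> ((@) v ` B) \<partial>count_space A)"
  unfolding concat_words_def using assms
  by (intro mass_UN_disjoint) (auto simp: disjoint_family_on_def)

lemma Cons_in_concat_words: "[a] \<in> A \<Longrightarrow> w \<in> B \<Longrightarrow> a # w \<in> concat_words A B"
  unfolding concat_words_def by (rule UN_I[of "[a]"]) auto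

lemma words_0 [simp]: "words I 0 = {[]}"
  by (auto simp: words_def)

lemma words_add: "words I (m + n) = concat_words (words I m) (words I n)"
proof (intro set_eqI iffI)
  fix w
  assume w: "w \<in> words I (m + n)"
  then have "take m w \<in> words I m" "drop m w \<in> words I n"
    by (auto simp: words_def dest: in_set_takeD in_set_dropD)
  then show "w \<in> concat_words (words I m) (words I n)"
    unfolding concat_words_def by (metis UN_iff append_take_drop_id image_eqI)
qed (auto simp: words_def concat_words_def)

lemma words_1: "words I 1 = (\<lambda>a. [a]) ` I"
  by (auto simp: words_def length_Suc_conv)

lemma words_mono: "I \<subseteq> J \<Longrightarrow> words I n \<subseteq> words J n"
  by (auto simp: words_def)

lemma words_pos: "0 \<notin> I \<Longrightarrow> w \<in> words I n \<Longrightarrow> 0 \<notin> set w"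
  by (auto simp: words_def)

lemma wt_Nil [simp]: "wt \<delta> [] = 1"
  by (simp add: wt_def)

lemma wt_single: "wt \<delta> [a] = real a powr (- (2 * \<delta>))"
  by (simp add: wt_def)

lemma mass_words_1_finite:
  "finite B \<Longrightarrow> mass \<delta> (words B 1) = ennreal (\<Sum>b\<in>B. real b powr (- (2 * \<delta>)))"
  unfolding words_1 by (simp add: mass_finite sum.reindex inj_on_def wt_single)

text \<open>Since \<open>\<delta> \<le> 1\<close>, \<open>k powr \<delta> \<le> k\<close>. This
  turns each rescaling of a radius into a plain numerical factor.\<close>

lemma powr_scale_le:
  fixes x k \<delta> :: real
  assumes "1 \<le> k" "0 \<le> x" "0 \<le> \<delta>" "\<delta> \<le> 1"
  shows "(k * x) powr \<delta> \<le> k * x powr \<delta>"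
  using powr_mono[of \<delta> 1 k] assms by (simp add: powr_mult mult_right_mono)

text \<open>The two halves of regularity are kept apart because this one passes to subsets and
  finite unions, whereas the lower bound has to be arranged. The window may start at any real
  number, which is what makes subsets and unions inherit the bound.\<close>

definition upper_regular :: "real \<Rightarrow> real \<Rightarrow> nat set \<Rightarrow> bool" where
  "upper_regular \<delta> C I \<longleftrightarrow> 0 < C \<and>
     (\<forall>a R. 1 \<le> R \<longrightarrow> real (card {b \<in> I. a \<le> real b \<and> real b \<le> a + R}) \<le> C * R powr \<delta>)"

definition lower_regular :: "real \<Rightarrow> real \<Rightarrow> nat set \<Rightarrow> bool" where
  "lower_regular \<delta> c I \<longleftrightarrow> 0 < c \<and>
     (\<forall>a\<in>I. \<forall>R\<ge>1. c * R powr \<delta> \<le> real (card {b \<in> I. \<bar>real b - real a\<bar> \<le> R}))"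

lemma finite_nat_real_le: "finite {b :: nat. P b \<and> real b \<le> r}"
  by (rule finite_subset[of _ "{..nat \<lfloor>r\<rfloor>}"]) (auto simp: le_nat_floor)

lemma ex_power_bracket:
  fixes b x :: real
  assumes "1 < b" "1 \<le> x"
  shows "\<exists>j. b ^ j \<le> x \<and> x < b ^ Suc j"
proof -
  define j where "j = (LEAST j. x < b ^ Suc j)"
  obtain i where "x < b ^ i" using real_arch_pow[OF assms(1)] by blast
  also have "b ^ i \<le> b ^ Suc i" using assms(1) by (intro power_increasing) auto
  finally have 1: "x < b ^ Suc j" unfolding j_def by (rule LeastI)
  have "b ^ j \<le> x"
  proof (cases j)
    case (Suc i)
    then have "\<not> x < b ^ Suc i"
      using not_less_Least[of i "\<lambda>j. x < b ^ Suc j"] by (simp add: j_def)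
    then show ?thesis using Suc by simp
  qed (use assms in simp)
  then show ?thesis using 1 by blast
qed

section \<open>Multiplicativity of masses and the weight of tails, for a fixed exponent\<close>

locale cf_exponent =
  fixes \<delta> :: real
  assumes \<delta>_pos: "0 < \<delta>" and \<delta>_le_1: "\<delta> \<le> 1"
begin

lemma powr_scale: "1 \<le> k \<Longrightarrow> 0 \<le> x \<Longrightarrow> (k * x) powr \<delta> \<le> k * x powr \<delta>"
  using powr_scale_le \<delta>_pos \<delta>_le_1 by simp

lemma wt_append_le:
  assumes "0 \<notin> set v" "0 \<notin> set w"
  shows "wt \<delta> (v @ w) \<le> wt \<delta> v * wt \<delta> w"
proof -
  have "cf_den (v @ w) 0 powr (- (2 * \<delta>)) \<le> (cf_den v 0 * cf_den w 0) powr (- (2 * \<delta>))"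
    using cf_den_append_ge[OF assms] cf_den_ge_1[OF assms(1)] cf_den_ge_1[OF assms(2)] \<delta>_pos
    by (intro powr_mono2') auto
  then show ?thesis by (simp add: wt_def powr_mult)
qed

text \<open>The factor 2 for continuants becomes \<open>2 powr (- (2 * \<delta>))\<close>, which is
  at least \<open>1 / 4\<close> because \<open>\<delta> \<le> 1\<close>; this is the origin of every
  later 4 in comparisons of level masses.\<close>

lemma wt_append_ge:
  assumes "0 \<notin> set v" "0 \<notin> set w"
  shows "wt \<delta> v * wt \<delta> w / 4 \<le> wt \<delta> (v @ w)"
proof -
  have "(2 * (cf_den v 0 * cf_den w 0)) powr (- (2 * \<delta>)) \<le> cf_den (v @ w) 0 powr (- (2 * \<delta>))"
    using cf_den_append_le[OF assms] cf_den_append_ge[OF assms] cf_den_ge_1[OF assms(1)]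
      cf_den_ge_1[OF assms(2)] \<delta>_pos
    by (intro powr_mono2') (auto simp: mult_ac intro: less_le_trans[of 0 "cf_den v 0 * cf_den w 0"])
  then have 1: "2 powr (- (2 * \<delta>)) * (wt \<delta> v * wt \<delta> w) \<le> wt \<delta> (v @ w)"
    by (simp add: wt_def powr_mult)
  have "2 powr (- 2 :: real) \<le> 2 powr (- (2 * \<delta>))"
    using \<delta>_le_1 by (intro powr_mono) auto
  then have "1 / 4 * (wt \<delta> v * wt \<delta> w) \<le> 2 powr (- (2 * \<delta>)) * (wt \<delta> v * wt \<delta> w)"
    by (intro mult_right_mono) (auto simp: powr_minus divide_simps)
  then show ?thesis using 1 by simp
qed

lemma mass_append_le:
  assumes "0 \<notin> set v" "\<And>w. w \<in> B \<Longrightarrow> 0 \<notin> set w"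
  shows "mass \<delta> ((@) v ` B) \<le> ennreal (wt \<delta> v) * mass \<delta> B"
  using assms wt_append_le by (intro mass_image_le) (auto simp: inj_on_def)

lemma mass_append_ge:
  assumes "0 \<notin> set v" "\<And>w. w \<in> B \<Longrightarrow> 0 \<notin> set w"
  shows "ennreal (wt \<delta> v / 4) * mass \<delta> B \<le> mass \<delta> ((@) v ` B)"
  using assms wt_append_ge by (intro mass_image_ge) (auto simp: inj_on_def)

lemma mass_concat_le:
  assumes "\<And>v. v \<in> A \<Longrightarrow> length v = k" "\<And>v. v \<in> A \<Longrightarrow> 0 \<notin> set v" "\<And>w. w \<in> B \<Longrightarrow> 0 \<notin> set w"
  shows "mass \<delta> (concat_words A B) \<le> mass \<delta> A * mass \<delta> B"
proof -
  have eq: "mass \<delta> (concat_words A B) = (\<integral>\<^sup>+ v. mass \<delta> ((@) v ` B) \<partial>count_space A)"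
    using assms(1) by (rule mass_concat_eq)
  have "mass \<delta> (concat_words A B) \<le> (\<integral>\<^sup>+ v. ennreal (wt \<delta> v) * mass \<delta> B \<partial>count_space A)"
    unfolding eq using assms by (intro nn_integral_mono mass_append_le) auto
  also have "\<dots> = mass \<delta> A * mass \<delta> B"
    by (simp add: mass_eq_nn_integral[of _ A] nn_integral_multc)
  finally show ?thesis .
qed

lemma mass_concat_ge:
  assumes "\<And>v. v \<in> A \<Longrightarrow> length v = k" "\<And>v. v \<in> A \<Longrightarrow> 0 \<notin> set v" "\<And>w. w \<in> B \<Longrightarrow> 0 \<notin> set w"
  shows "mass \<delta> A * mass \<delta> B \<le> 4 * mass \<delta> (concat_words A B)"
proof -
  have eq: "mass \<delta> (concat_words A B) = (\<integral>\<^sup>+ v. mass \<delta> ((@) v ` B) \<partial>count_space A)"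
    using assms(1) by (rule mass_concat_eq)
  have "ennreal (wt \<delta> v) = 4 * ennreal (wt \<delta> v / 4)" for v
    using ennreal_mult[of 4 "wt \<delta> v / 4"] by simp
  then have "mass \<delta> A * mass \<delta> B = (\<integral>\<^sup>+ v. 4 * (ennreal (wt \<delta> v / 4) * mass \<delta> B) \<partial>count_space A)"
    by (simp add: mass_eq_nn_integral[of _ A] nn_integral_multc mult.assoc[symmetric])
  also have "\<dots> = 4 * (\<integral>\<^sup>+ v. ennreal (wt \<delta> v / 4) * mass \<delta> B \<partial>count_space A)"
    by (rule nn_integral_cmult) auto
  also have "\<dots> \<le> 4 * mass \<delta> (concat_words A B)"
    unfolding eq using assms by (intro mult_left_mono nn_integral_mono mass_append_ge) auto
  finally show ?thesis .
qed

lemma mass_words_add_le: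
  assumes "0 \<notin> I"
  shows "mass \<delta> (words I (m + n)) \<le> mass \<delta> (words I m) * mass \<delta> (words I n)"
  unfolding words_add
  by (rule mass_concat_le) (use words_pos[OF assms] in \<open>auto simp: words_def\<close>)

lemma mass_words_add_ge:
  assumes "0 \<notin> I"
  shows "mass \<delta> (words I m) * mass \<delta> (words I n) \<le> 4 * mass \<delta> (words I (m + n))"
  unfolding words_add
  by (rule mass_concat_ge) (use words_pos[OF assms] in \<open>auto simp: words_def\<close>)

lemma mass_letters_le:
  assumes "finite B" "\<And>b. b \<in> B \<Longrightarrow> x \<le> real b" "0 < x"
  shows "mass \<delta> (words B 1) \<le> ennreal (real (card B) * x powr (- (2 * \<delta>)))"
proof -
  have "(\<Sum>b\<in>B. real b powr (- (2 * \<delta>))) \<le> (\<Sum>b\<in>B. x powr (- (2 * \<delta>)))"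
    using assms \<delta>_pos by (intro sum_mono powr_mono2') auto
  then show ?thesis using assms by (simp only: mass_words_1_finite) (simp add: ennreal_leI)
qed

lemma mass_letters_ge:
  assumes "finite B" "\<And>b. b \<in> B \<Longrightarrow> 0 < b" "\<And>b. b \<in> B \<Longrightarrow> real b \<le> x"
  shows "ennreal (real (card B) * x powr (- (2 * \<delta>))) \<le> mass \<delta> (words B 1)"
proof -
  have "(\<Sum>b\<in>B. x powr (- (2 * \<delta>))) \<le> (\<Sum>b\<in>B. real b powr (- (2 * \<delta>)))"
    using assms \<delta>_pos by (intro sum_mono powr_mono2') auto
  then show ?thesis using assms by (simp only: mass_words_1_finite) (simp add: ennreal_leI)
qed

text \<open>\<open>C\<close> times the geometric series of ratio \<open>2 powr (- \<delta>)\<close>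
  that arises from a dyadic decomposition.\<close>

definition tail_const :: "real \<Rightarrow> real" where
  "tail_const C = C / (1 - 2 powr (- \<delta>))"

lemma tail_const_pos: "0 < C \<Longrightarrow> 0 < tail_const C"
  using powr_less_mono[of "- \<delta>" 0 2] \<delta>_pos by (simp add: tail_const_def)

text \<open>With \<open>x = 2^j m\<close>, the dyadic block from \<open>x\<close> to
  \<open>2 x\<close> has at most \<open>C x^\<delta>\<close> letters, each of weight at most
  \<open>x^(-2 \<delta>)\<close>. The blocks contribute \<open>C x^(-\<delta>)\<close>, a geometric
  series in \<open>j\<close>.\<close>

lemma mass_tail_le:
  assumes U: "upper_regular \<delta> C I" and m: "1 \<le> m"
  shows "mass \<delta> (words {b \<in> I. m \<le> real b} 1) \<le> ennreal (tail_const C * m powr (- \<delta>))"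
proof -
  have C: "0 < C" using U by (simp add: upper_regular_def)
  define B where "B j = {b \<in> I. 2 ^ j * m \<le> real b \<and> real b \<le> 2 ^ j * m + 2 ^ j * m}" for j :: nat
  have "words {b \<in> I. m \<le> real b} 1 \<subseteq> (\<Union>j. words (B j) 1)"
  proof -
    have "\<exists>j. b \<in> B j" if b: "b \<in> I" "m \<le> real b" for b
    proof -
      have "1 \<le> real b / m" using b m by (simp add: pos_le_divide_eq)
      then obtain j where "2 ^ j \<le> real b / m" "real b / m < 2 ^ Suc j"
        using ex_power_bracket[of 2 "real b / m"] by auto
      then have 1: "2 ^ j * m \<le> real b" "real b < 2 ^ Suc j * m"
        using m by (simp_all add: pos_le_divide_eq pos_divide_less_eq)
      have "real b \<le> 2 ^ j * m + 2 ^ j * m" using 1(2) by (simp add: mult_ac)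
      then have "b \<in> B j" using b 1(1) by (simp add: B_def)
      then show ?thesis by blast
    qed
    then show ?thesis unfolding words_1 by blast
  qed
  then have "mass \<delta> (words {b \<in> I. m \<le> real b} 1) \<le> mass \<delta> (\<Union>j. words (B j) 1)"
    by (rule mass_mono)
  also have "\<dots> \<le> (\<Sum>j. mass \<delta> (words (B j) 1))"
    by (rule mass_UN_le)
  also have "\<dots> \<le> (\<Sum>j. ennreal (C * m powr (- \<delta>) * (2 powr (- \<delta>)) ^ j))"
  proof (intro suminf_le)
    fix j
    let ?x = "2 ^ j * m"
    have x: "1 \<le> ?x" using m by (simp add: mult_ge1_I)
    have card: "real (card (B j)) \<le> C * ?x powr \<delta>"
      using U x unfolding B_def upper_regular_def by blast
    have "mass \<delta> (words (B j) 1) \<le> ennreal (real (card (B j)) * ?x powr (- (2 * \<delta>)))"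
      using x finite_nat_real_le[of "\<lambda>b. b \<in> I \<and> ?x \<le> real b" "?x + ?x"]
      by (intro mass_letters_le) (auto simp: B_def conj_ac)
    also have "\<dots> \<le> ennreal (C * ?x powr \<delta> * ?x powr (- (2 * \<delta>)))"
      using card by (intro ennreal_leI mult_right_mono) auto
    also have "C * ?x powr \<delta> * ?x powr (- (2 * \<delta>)) = C * ?x powr (- \<delta>)"
      by (simp add: powr_add[symmetric] mult.assoc)
    also have "\<dots> = C * m powr (- \<delta>) * (2 powr (- \<delta>)) ^ j"
      using m by (simp add: powr_mult powr_realpow[symmetric] powr_powr mult_ac)
    finally show "mass \<delta> (words (B j) 1) \<le> ennreal (C * m powr (- \<delta>) * (2 powr (- \<delta>)) ^ j)" .
  qed auto
  also have "\<dots> = ennreal (tail_const C * m powr (- \<delta>))"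
  proof (rule suminf_ennreal_eq)
    have "(2::real) powr (- \<delta>) < 1" using powr_less_mono[of "- \<delta>" 0 "2::real"] \<delta>_pos by simp
    then have "(\<lambda>j. (2 powr (- \<delta>)) ^ j) sums (1 / (1 - 2 powr (- \<delta>) :: real))"
      by (intro geometric_sums) auto
    from sums_mult[OF this, of "C * m powr (- \<delta>)"]
    show "(\<lambda>j. C * m powr (- \<delta>) * (2 powr (- \<delta>)) ^ j) sums (tail_const C * m powr (- \<delta>))"
      by (simp add: tail_const_def mult_ac)
  qed (use C in auto)
  finally show ?thesis .
qed

end

subsection \<open>The mass of words whose cylinder lies in a small set\<close>

locale regular_alphabet = cf_exponent +
  fixes I :: "nat set" and C c :: real
  assumes I_pos: "0 \<notin> I" and I_nonempty: "I \<noteq> {}"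
    and upper: "upper_regular \<delta> C I" and lower: "lower_regular \<delta> c I"
    and mass_words_le: "\<And>n. mass \<delta> (words I n) \<le> 4"
    and mass_words_ge: "\<And>n. 1 \<le> mass \<delta> (words I n)"
begin

lemma ennreal_times_4: "0 \<le> x \<Longrightarrow> ennreal x * 4 = ennreal (4 * x)"
  using ennreal_mult[of x 4] by (simp add: mult.commute)

lemma C_pos: "0 < C"
  using upper by (simp add: upper_regular_def)

lemma tail_pos: "0 < tail_const C"
  using tail_const_pos C_pos .

lemma card_interval_le:
  "1 \<le> R \<Longrightarrow> real (card {b \<in> I. a \<le> real b \<and> real b \<le> a + R}) \<le> C * R powr \<delta>"
  using upper by (auto simp: upper_regular_def)

lemma wordsD: "w \<in> words I n \<Longrightarrow> 0 \<notin> set w"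
  using words_pos I_pos by blast

lemma letter_pos: "a \<in> I \<Longrightarrow> 1 \<le> real a"
  using I_pos by (cases a) auto

lemma mass_Cons_le: "a \<in> I \<Longrightarrow> (\<And>w. w \<in> W \<Longrightarrow> 0 \<notin> set w) \<Longrightarrow>
    mass \<delta> ((#) a ` W) \<le> ennreal (real a powr (- (2 * \<delta>))) * mass \<delta> W"
  using mass_append_le[of "[a]" W] letter_pos[of a] by (force simp: wt_single)

text \<open>For \<open>t \<ge> 1/2\<close> the bound is trivial; otherwise the first letter is at least \<open>1/(2t)\<close>.\<close>

definition K0 :: real where
  "K0 = 8 * (tail_const C + 1)"

lemma K0_ge: "8 \<le> K0"
  using tail_pos by (simp add: K0_def)

lemma mass_le_if_large: "1 / 2 \<le> t \<Longrightarrow> W \<subseteq> words I n \<Longrightarrow> mass \<delta> W \<le> ennreal (8 * t powr \<delta>)"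
proof -
  assume t: "1 / 2 \<le> t" and W: "W \<subseteq> words I n"
  have "1 powr \<delta> \<le> (2 * t) powr \<delta>" using t \<delta>_pos by (intro powr_mono2) auto
  also have "\<dots> \<le> 2 * t powr \<delta>" using t by (intro powr_scale) auto
  finally have "4 \<le> 8 * t powr \<delta>" by simp
  then have "ennreal 4 \<le> ennreal (8 * t powr \<delta>)" by (rule ennreal_leI)
  then show ?thesis using mass_mono[OF W, of \<delta>] mass_words_le[of n] by (simp add: order_trans)
qed

lemma mass_near_0:
  assumes t: "0 < t"
  shows "mass \<delta> {w \<in> words I n. cyl w \<subseteq> {..t}} \<le> ennreal (K0 * t powr \<delta>)"
proof (cases "1 / 2 \<le> t")
  case True
  then have "mass \<delta> {w \<in> words I n. cyl w \<subseteq> {..t}} \<le> ennreal (8 * t powr \<delta>)"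
    by (intro mass_le_if_large) auto
  also have "\<dots> \<le> ennreal (K0 * t powr \<delta>)"
    using K0_ge by (intro ennreal_leI mult_right_mono) auto
  finally show ?thesis .
next
  case False
  show ?thesis
  proof (cases n)
    case 0
    have "\<not> cyl [] \<subseteq> {..t}" using False by (auto simp: cyl_def)
    then have "{w \<in> words I n. cyl w \<subseteq> {..t}} = {}" using 0 by auto
    then show ?thesis by (simp only: mass_empty) simp
  next
    case (Suc m)
    let ?T = "{b \<in> I. 1 / (2 * t) \<le> real b}"
    have "{w \<in> words I n. cyl w \<subseteq> {..t}} \<subseteq> concat_words (words ?T 1) (words I m)"
    proof clarify
      fix w
      assume w: "w \<in> words I n" "cyl w \<subseteq> {..t}"
      then obtain a v where v: "w = a # v" "a \<in> I" "v \<in> words I m"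
        using Suc by (auto simp: words_def length_Suc_conv)
      obtain x where x: "x \<in> cyl v" using cyl_nonempty by blast
      then have x01: "0 \<le> x" "x \<le> 1" using cyl_subset_unit[OF wordsD[OF v(3)]] by auto
      have "1 / (real a + x) \<le> t" using x w v by (auto simp: cyl_Cons)
      moreover have "1 / (2 * real a) \<le> 1 / (real a + x)"
        using x01 letter_pos[OF v(2)] by (intro divide_left_mono) auto
      ultimately have "1 / (2 * real a) \<le> t" by linarith
      then have "1 / (2 * t) \<le> real a" using t letter_pos[OF v(2)] by (simp add: field_simps)
      then have "[a] \<in> words ?T 1" using v by (simp add: words_def)
      then show "w \<in> concat_words (words ?T 1) (words I m)"
        unfolding v(1) using v(3) by (rule Cons_in_concat_words)
    qed
    then have "mass \<delta> {w \<in> words I n. cyl w \<subseteq> {..t}} \<le> mass \<delta> (concat_words (words ?T 1) (words I m))"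
      by (rule mass_mono)
    also have "\<dots> \<le> mass \<delta> (words ?T 1) * mass \<delta> (words I m)"
      by (rule mass_concat_le[of _ 1]) (use wordsD I_pos in \<open>auto simp: words_def\<close>)
    also have "\<dots> \<le> ennreal (tail_const C * (1 / (2 * t)) powr (- \<delta>)) * 4"
      using mass_words_le[of m] t False by (intro mult_mono mass_tail_le[OF upper]) auto
    also have "\<dots> = ennreal (4 * tail_const C * (2 * t) powr \<delta>)"
      using t tail_pos by (subst ennreal_times_4) (auto simp: powr_divide powr_minus_divide mult_ac)
    also have "\<dots> \<le> ennreal (4 * tail_const C * (2 * t powr \<delta>))"
      using t tail_pos powr_scale[of 2 t] by (intro ennreal_leI mult_left_mono) auto
    also have "\<dots> \<le> ennreal (K0 * t powr \<delta>)"
      using tail_pos by (intro ennreal_leI) (simp add: K0_def algebra_simps)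
    finally show ?thesis .
  qed
qed

text \<open>Points near \<open>1\<close> have first letter \<open>1\<close>, and \<open>x \<mapsto> 1 / (1 + x)\<close> carries a neighbourhood of
  \<open>0\<close> to a neighbourhood of \<open>1\<close>.\<close>

lemma mass_near_1:
  assumes t: "0 < t"
  shows "mass \<delta> {w \<in> words I n. cyl w \<subseteq> {1 - t..}} \<le> ennreal (2 * K0 * t powr \<delta>)"
proof (cases "1 / 2 \<le> t")
  case True
  then have "mass \<delta> {w \<in> words I n. cyl w \<subseteq> {1 - t..}} \<le> ennreal (8 * t powr \<delta>)"
    by (intro mass_le_if_large) auto
  also have "\<dots> \<le> ennreal (2 * K0 * t powr \<delta>)"
    using K0_ge by (intro ennreal_leI mult_right_mono) auto
  finally show ?thesis .
next
  case False
  show ?thesis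
  proof (cases n)
    case 0
    have "\<not> cyl [] \<subseteq> {1 - t..}" using False by (auto simp: cyl_def)
    then have "{w \<in> words I n. cyl w \<subseteq> {1 - t..}} = {}" using 0 by auto
    then show ?thesis by (simp only: mass_empty) simp
  next
    case (Suc m)
    let ?W = "{v \<in> words I m. cyl v \<subseteq> {..2 * t}}"
    have sub: "{w \<in> words I n. cyl w \<subseteq> {1 - t..}} \<subseteq> (if 1 \<in> I then (#) 1 ` ?W else {})"
    proof clarify
      fix w
      assume w: "w \<in> words I n" "cyl w \<subseteq> {1 - t..}"
      then obtain a v where v: "w = a # v" "a \<in> I" "v \<in> words I m"
        using Suc by (auto simp: words_def length_Suc_conv)
      have x: "a = 1 \<and> x \<le> 2 * t" if "x \<in> cyl v" for x
      proof -
        have x01: "0 \<le> x" "x \<le> 1" using that cyl_subset_unit[OF wordsD[OF v(3)]] by auto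
        have a: "1 \<le> real a" by (rule letter_pos[OF v(2)])
        have "1 - t \<le> 1 / (real a + x)" using that w v by (auto simp: cyl_Cons)
        then have le: "(1 - t) * (real a + x) \<le> 1" using a x01 by (simp add: pos_le_divide_eq)
        have "1 / 2 * (real a + x) < (1 - t) * (real a + x)"
          using False a x01 by (intro mult_strict_right_mono) auto
        then have "real a + x < 2" using le by simp
        then have a1: "a = 1" using a x01 by linarith
        then have "x * (1 - t) \<le> t" using le by (simp add: algebra_simps)
        moreover have "x * (1 / 2) \<le> x * (1 - t)" using x01 False by (intro mult_left_mono) auto
        ultimately show ?thesis using a1 by auto
      qed
      obtain x where "x \<in> cyl v" using cyl_nonempty by blast
      then have "a = 1" using x by blast
      moreover have "v \<in> ?W" using x v by auto
      ultimately show "w \<in> (if 1 \<in> I then (#) 1 ` ?W else {})" using v by auto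
    qed
    show ?thesis
    proof (cases "1 \<in> I")
      case True
      have "mass \<delta> {w \<in> words I n. cyl w \<subseteq> {1 - t..}} \<le> mass \<delta> ((#) 1 ` ?W)"
        using sub True by (intro mass_mono) auto
      also have "\<dots> \<le> ennreal (real 1 powr (- (2 * \<delta>))) * mass \<delta> ?W"
        using True wordsD by (intro mass_Cons_le) auto
      also have "\<dots> \<le> ennreal (K0 * (2 * t) powr \<delta>)"
        using mass_near_0[of "2 * t" m] t by simp
      also have "\<dots> \<le> ennreal (K0 * (2 * t powr \<delta>))"
        using t K0_ge powr_scale[of 2 t] by (intro ennreal_leI mult_left_mono) auto
      finally show ?thesis by (simp add: mult_ac)
    next
      case False
      then have "{w \<in> words I n. cyl w \<subseteq> {1 - t..}} = {}" using sub by auto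
      then show ?thesis by (simp only: mass_empty) simp
    qed
  qed
qed

text \<open>The summands serve the configurations of the next lemma: a window of letters
  (\<open>C\<close>), a tail of letters (\<open>tail_const C\<close>), and two adjacent letters
  (\<open>K0\<close>).\<close>

definition K2 :: real where
  "K2 = 32 * C + 32 * tail_const C + 32 * K0"

text \<open>Let \<open>a\<close> be the smallest first letter. Either all first letters lie in a
  window of length \<open>8 a^2 l\<close> above \<open>a\<close>, or they all are at least
  \<open>1 / (8 l)\<close>, or only \<open>a\<close> and \<open>a + 1\<close> occur. In the last
  case the cylinders cluster at the common endpoint \<open>1 / (a + 1)\<close>, and the bounds near
  0 and 1 apply to the tails.\<close>

lemma mass_two_first_letters:
  assumes W: "W \<subseteq> words I (Suc n)" and l: "0 < l"
    and close: "\<And>v w x y. v \<in> W \<Longrightarrow> w \<in> W \<Longrightarrow> x \<in> cyl v \<Longrightarrow> y \<in> cyl w \<Longrightarrow> \<bar>x - y\<bar> \<le> l"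
    and two: "v \<in> W" "w \<in> W" "hd v \<noteq> hd w"
  shows "mass \<delta> W \<le> ennreal (K2 * l powr \<delta>)"
proof -
  define B where "B = hd ` W"
  have split: "\<exists>a v. w = a # v \<and> a \<in> I \<and> a \<in> B \<and> v \<in> words I n" if "w \<in> W" for w
    using W that by (force simp: words_def length_Suc_conv B_def)
  have BI: "B \<subseteq> I"
  proof
    fix b
    assume "b \<in> B"
    then obtain w where "w \<in> W" "b = hd w" by (auto simp: B_def)
    then show "b \<in> I" using split[of w] by auto
  qed
  define a where "a = (LEAST b. b \<in> B)"
  have B: "hd v \<in> B" "hd w \<in> B" using two by (auto simp: B_def)
  have aB: "a \<in> B" unfolding a_def by (rule LeastI[of _ "hd v"]) (rule B)
  have a_le: "a \<le> b" if "b \<in> B" for b unfolding a_def by (rule Least_le) (rule that)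
  have aI: "a \<in> I" using aB BI by auto
  have a1: "1 \<le> real a" by (rule letter_pos[OF aI])
  have W_sub: "W \<subseteq> concat_words (words B 1) (words I n)"
  proof
    fix w
    assume "w \<in> W"
    then obtain b v where "w = b # v" "b \<in> B" "v \<in> words I n" using split by blast
    then show "w \<in> concat_words (words B 1) (words I n)"
      by (auto intro!: Cons_in_concat_words simp: words_def)
  qed
  have mass_W: "mass \<delta> W \<le> mass \<delta> (words B 1) * 4"
  proof -
    have "mass \<delta> W \<le> mass \<delta> (words B 1) * mass \<delta> (words I n)"
      by (rule order_trans[OF mass_mono[OF W_sub] mass_concat_le[of _ 1]])
         (use wordsD BI I_pos in \<open>auto simp: words_def\<close>)
    also have "\<dots> \<le> mass \<delta> (words B 1) * 4"
      by (intro mult_left_mono mass_words_le) auto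
    finally show ?thesis .
  qed
  have point: "\<exists>x. 0 \<le> x \<and> x \<le> 1 \<and> 1 / (real b + x) \<in> cyl w" if "w \<in> W" "w = b # v" for b v w
  proof -
    obtain x where x: "x \<in> cyl v" using cyl_nonempty by blast
    have "0 \<notin> set v" using W that wordsD by (auto simp: words_def I_pos)
    then have "x \<in> {0..1}" using x cyl_subset_unit by blast
    then show ?thesis using x that by (auto simp: cyl_Cons)
  qed
  have pointB: "\<exists>w\<in>W. \<exists>x. 0 \<le> x \<and> x \<le> 1 \<and> 1 / (real b + x) \<in> cyl w" if b: "b \<in> B" for b
  proof -
    obtain w where w: "w \<in> W" "b = hd w" using b unfolding B_def by blast
    then obtain v where "w = b # v" using split by force
    then show ?thesis using point w by blast
  qed
  show ?thesis
  \<comment> \<open>A first letter \<open>c \<ge> a + 2\<close> leaves a whole first-level cylinder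
    between those of \<open>a\<close> and \<open>c\<close>, so distances bound differences of
    letters. Cylinders of adjacent letters touch and give no such bound.\<close>
  proof (cases "\<exists>c\<in>B. a + 2 \<le> c")
    case True
    then obtain c0 where c0: "c0 \<in> B" "a + 2 \<le> c0" by auto
    \<comment> \<open>The distance estimate bounds \<open>c - a - 1\<close>, which is at least half
      of \<open>c - a\<close>; with \<open>a + 1 \<le> 2 a\<close> this yields the factor 4.\<close>
    have gap: "real c - real a \<le> 4 * real a * real c * l" if c: "c \<in> B" "a + 2 \<le> c" for c
    proof -
      obtain v x where x: "v \<in> W" "0 \<le> x" "x \<le> 1" "1 / (real a + x) \<in> cyl v"
        using pointB[OF aB] by auto
      obtain w y where y: "w \<in> W" "0 \<le> y" "y \<le> 1" "1 / (real c + y) \<in> cyl w"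
        using pointB[OF c(1)] by auto
      have "1 / (real a + 1) - 1 / real c \<le> 1 / (real a + x) - 1 / (real c + y)"
        using x y a1 c by (intro diff_mono divide_left_mono) auto
      also have "\<dots> \<le> l" using close[OF x(1) y(1) x(4) y(4)] by linarith
      finally have "(real c - real a - 1) / ((real a + 1) * real c) \<le> l"
        using a1 c by (simp add: field_simps)
      then have "real c - real a - 1 \<le> l * ((real a + 1) * real c)"
        using a1 c by (simp add: pos_divide_le_eq)
      also have "\<dots> \<le> l * ((2 * real a) * real c)"
        using a1 l by (intro mult_left_mono mult_right_mono) auto
      finally show ?thesis using c by (simp add: algebra_simps)
    qed
    show ?thesis
    \<comment> \<open>In the first case \<open>gap\<close> gives \<open>c - a \<le> c / 2\<close>,
      so that all first letters are comparable to \<open>a\<close>. In the second case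
      \<open>a\<close> itself is so large that the tail bound suffices.\<close>
    proof (cases "4 * real a * l \<le> 1 / 2")
      case True
      define R where "R = 8 * (real a)\<^sup>2 * l"
      have far: "real c - real a \<le> R" if c: "c \<in> B" "a + 2 \<le> c" for c
      proof -
        have "4 * real a * l * real c \<le> 1 / 2 * real c" using True by (intro mult_right_mono) auto
        then have "real c \<le> 2 * real a" using gap[OF c] by (simp add: algebra_simps)
        then have "4 * real a * real c * l \<le> 4 * real a * (2 * real a) * l"
          using l by (intro mult_right_mono mult_left_mono) auto
        then show ?thesis using gap[OF c] by (simp add: R_def power2_eq_square algebra_simps)
      qed
      \<comment> \<open>This also places the letter \<open>a + 1\<close>, to which
        \<open>far\<close> does not apply, in the window.\<close>
      have R: "2 \<le> R" using far[OF c0] c0(2) by linarith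
      have sub: "B \<subseteq> {b \<in> I. real a \<le> real b \<and> real b \<le> real a + R}"
      proof
        fix b
        assume b: "b \<in> B"
        show "b \<in> {b \<in> I. real a \<le> real b \<and> real b \<le> real a + R}"
          using far[OF b] a_le[OF b] BI b R by (cases "a + 2 \<le> b") auto
      qed
      have fin: "finite {b \<in> I. real a \<le> real b \<and> real b \<le> real a + R}"
        using finite_nat_real_le[of "\<lambda>b. b \<in> I \<and> real a \<le> real b"] by (simp add: conj_ac)
      have "real (card B) \<le> C * R powr \<delta>"
        using card_mono[OF fin sub] card_interval_le[of R "real a"] R by linarith
      then have "real (card B) * real a powr (- (2 * \<delta>)) \<le> C * R powr \<delta> * real a powr (- (2 * \<delta>))"
        by (intro mult_right_mono) auto
      also have "R powr \<delta> = 8 powr \<delta> * real a powr (2 * \<delta>) * l powr \<delta>"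
        using a1 l by (simp add: R_def powr_mult powr_powr[symmetric] flip: powr_numeral)
      also have "C * (8 powr \<delta> * real a powr (2 * \<delta>) * l powr \<delta>) * real a powr (- (2 * \<delta>))
          = C * (8 powr \<delta> * l powr \<delta>)"
        using a1 by (simp add: powr_minus field_simps)
      also have "\<dots> \<le> C * (8 * l powr \<delta>)"
        using C_pos l powr_scale[of 8 l] by (intro mult_left_mono) (auto simp: powr_mult)
      finally have bd: "real (card B) * real a powr (- (2 * \<delta>)) \<le> 8 * C * l powr \<delta>" by simp
      have "mass \<delta> W \<le> ennreal (real (card B) * real a powr (- (2 * \<delta>))) * 4"
        by (rule order_trans[OF mass_W], intro mult_right_mono mass_letters_le)
           (use a_le a1 finite_subset[OF sub fin] in auto)
      also have "\<dots> \<le> ennreal (8 * C * l powr \<delta>) * 4"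
        using bd by (intro mult_right_mono ennreal_leI) auto
      also have "\<dots> = ennreal (32 * C * l powr \<delta>)"
        using C_pos by (subst ennreal_times_4) auto
      also have "\<dots> \<le> ennreal (K2 * l powr \<delta>)"
        using tail_pos K0_ge by (intro ennreal_leI mult_right_mono) (auto simp: K2_def)
      finally show ?thesis .
    next
      case False
      then have al: "1 / (8 * l) \<le> real a" using l by (simp add: field_simps)
      show ?thesis
      proof (cases "1 \<le> 1 / (8 * l)")
        case True
        have "mass \<delta> W \<le> ennreal (tail_const C * (1 / (8 * l)) powr (- \<delta>)) * 4"
        proof (rule order_trans[OF mass_W], intro mult_right_mono)
          have "words B 1 \<subseteq> words {b \<in> I. 1 / (8 * l) \<le> real b} 1"
            using BI a_le al by (intro words_mono) (auto intro: order_trans)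
          then show "mass \<delta> (words B 1) \<le> ennreal (tail_const C * (1 / (8 * l)) powr (- \<delta>))"
            using mass_tail_le[OF upper True] mass_mono order_trans by blast
        qed auto
        also have "\<dots> = ennreal (4 * tail_const C * (8 * l) powr \<delta>)"
          using l tail_pos by (subst ennreal_times_4) (auto simp: powr_divide powr_minus_divide mult_ac)
        also have "\<dots> \<le> ennreal (4 * tail_const C * (8 * l powr \<delta>))"
          using l tail_pos powr_scale[of 8 l] by (intro ennreal_leI mult_left_mono) auto
        also have "\<dots> \<le> ennreal (K2 * l powr \<delta>)"
          using C_pos K0_ge by (intro ennreal_leI) (simp add: K2_def algebra_simps)
        finally show ?thesis .
      next
        case False
        then have "1 \<le> (8 * l) powr \<delta>" using l \<delta>_pos by (intro ge_one_powr_ge_zero) auto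
        also have "\<dots> \<le> 8 * l powr \<delta>" using l by (intro powr_scale) auto
        finally have "4 \<le> 32 * l powr \<delta>" by simp
        also have "\<dots> \<le> K2 * l powr \<delta>"
          using C_pos K0_ge tail_pos by (intro mult_right_mono) (auto simp: K2_def)
        finally have "ennreal 4 \<le> ennreal (K2 * l powr \<delta>)" by (rule ennreal_leI)
        then show ?thesis
          using mass_mono[OF W, of \<delta>] mass_words_le[of "Suc n"] by (simp add: order_trans)
      qed
    qed
  next
    case False
    have B2: "b = a \<or> b = a + 1" if "b \<in> B" for b
      using a_le[OF that] that False by force
    then have a'B: "a + 1 \<in> B" using B two(3) aB by metis
    \<comment> \<open>Undoing the branches of \<open>a\<close> and \<open>a + 1\<close> turns an
      interval of length \<open>l\<close> at their common endpoint into one of length at most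
      \<open>t\<close> at 1, respectively at 0; the 2 comes from
      \<open>a + 2 \<le> 2 (a + 1)\<close>.\<close>
    define t where "t = 2 * l * (real a + 1)\<^sup>2"
    have t: "0 < t" using l a1 by (simp add: t_def)
    let ?U = "{v \<in> words I n. cyl v \<subseteq> {1 - t..}}" and ?V = "{v \<in> words I n. cyl v \<subseteq> {..t}}"
    have sub: "W \<subseteq> (#) a ` ?U \<union> (#) (a + 1) ` ?V"
    proof
      fix w
      assume w: "w \<in> W"
      then obtain b v where v: "w = b # v" "b \<in> B" "v \<in> words I n" using split by blast
      have v01: "0 \<le> x \<and> x \<le> 1" if "x \<in> cyl v" for x
        using that cyl_subset_unit[OF wordsD[OF v(3)]] by auto
      show "w \<in> (#) a ` ?U \<union> (#) (a + 1) ` ?V"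
      proof (cases "b = a")
        case True
        obtain w' y where y: "w' \<in> W" "0 \<le> y" "y \<le> 1" "1 / (real (a + 1) + y) \<in> cyl w'"
          using pointB[OF a'B] by auto
        have "1 - t \<le> x" if x: "x \<in> cyl v" for x
        proof -
          have x01: "0 \<le> x" "x \<le> 1" using v01[OF x] by auto
          have "1 / (real a + x) \<in> cyl w" using x v True by (auto simp: cyl_Cons)
          from close[OF w y(1) this y(4)]
          have "1 / (real a + x) - 1 / (real (a + 1) + y) \<le> l" by linarith
          moreover have "1 / (real (a + 1) + y) \<le> 1 / (real a + 1)"
            using y a1 by (intro divide_left_mono) auto
          ultimately have "1 / (real a + x) - 1 / (real a + 1) \<le> l" by linarith
          then have "(1 - x) / ((real a + x) * (real a + 1)) \<le> l"
            using a1 x01 by (simp add: field_simps)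
          then have "1 - x \<le> l * ((real a + x) * (real a + 1))"
            using a1 x01 by (simp add: pos_divide_le_eq)
          also have "\<dots> \<le> l * ((real a + 1) * (real a + 1))"
            using a1 x01 l by (intro mult_left_mono mult_right_mono) auto
          also have "\<dots> \<le> t" using l by (simp add: t_def power2_eq_square)
          finally show ?thesis by simp
        qed
        then show ?thesis using v True by auto
      next
        case False
        then have b: "b = a + 1" using B2 v by blast
        obtain w' y where y: "w' \<in> W" "0 \<le> y" "y \<le> 1" "1 / (real a + y) \<in> cyl w'"
          using pointB[OF aB] by auto
        have "x \<le> t" if x: "x \<in> cyl v" for x
        proof -
          have x01: "0 \<le> x" "x \<le> 1" using v01[OF x] by auto
          have "1 / (real b + x) \<in> cyl w" using x v by (auto simp: cyl_Cons)
          from close[OF y(1) w y(4) this]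
          have "1 / (real a + y) - 1 / (real a + 1 + x) \<le> l" using b by (simp add: add_ac)
          moreover have "1 / (real a + 1) \<le> 1 / (real a + y)"
            using y a1 by (intro divide_left_mono) auto
          ultimately have "1 / (real a + 1) - 1 / (real a + 1 + x) \<le> l" by linarith
          then have "x / ((real a + 1) * (real a + 1 + x)) \<le> l"
            using a1 x01 by (simp add: field_simps)
          then have "x \<le> l * ((real a + 1) * (real a + 1 + x))"
            using a1 x01 by (simp add: pos_divide_le_eq)
          also have "\<dots> \<le> l * ((real a + 1) * (2 * (real a + 1)))"
            using a1 x01 l by (intro mult_left_mono) auto
          also have "\<dots> = t" by (simp add: t_def power2_eq_square)
          finally show ?thesis .
        qed
        then show ?thesis using v b by auto
      qed
    qed
    have a2: "real (a + 1) powr (- (2 * \<delta>)) \<le> real a powr (- (2 * \<delta>))"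
      using a1 \<delta>_pos by (intro powr_mono2') auto
    have "mass \<delta> W \<le> mass \<delta> ((#) a ` ?U) + mass \<delta> ((#) (a + 1) ` ?V)"
      using mass_mono[OF sub] mass_Un_le order_trans by blast
    also have "\<dots> \<le> ennreal (real a powr (- (2 * \<delta>))) * ennreal (2 * K0 * t powr \<delta>)
        + ennreal (real (a + 1) powr (- (2 * \<delta>))) * ennreal (K0 * t powr \<delta>)"
    proof (rule add_mono)
      show "mass \<delta> ((#) a ` ?U) \<le> ennreal (real a powr (- (2 * \<delta>))) * ennreal (2 * K0 * t powr \<delta>)"
        using wordsD mass_near_1[OF t, of n]
        by (intro order_trans[OF mass_Cons_le[OF aI]] mult_left_mono) auto
      have "a + 1 \<in> I" using a'B BI by auto
      then show "mass \<delta> ((#) (a + 1) ` ?V) \<le> ennreal (real (a + 1) powr (- (2 * \<delta>))) * ennreal (K0 * t powr \<delta>)"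
        using wordsD mass_near_0[OF t, of n]
        by (intro order_trans[OF mass_Cons_le] mult_left_mono) auto
    qed
    also have "\<dots> = ennreal (real a powr (- (2 * \<delta>)) * (2 * K0 * t powr \<delta>)
        + real (a + 1) powr (- (2 * \<delta>)) * (K0 * t powr \<delta>))"
      using K0_ge by (simp add: ennreal_mult ennreal_plus)
    also have "\<dots> \<le> ennreal (real a powr (- (2 * \<delta>)) * (2 * K0 * t powr \<delta>)
        + real a powr (- (2 * \<delta>)) * (K0 * t powr \<delta>))"
      using a2 K0_ge by (intro ennreal_leI add_left_mono mult_right_mono) auto
    also have "\<dots> = ennreal (3 * K0 * (real a powr (- (2 * \<delta>)) * t powr \<delta>))"
      by (simp add: algebra_simps)
    also have "\<dots> \<le> ennreal (3 * K0 * (8 * l powr \<delta>))"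
    proof (intro ennreal_leI mult_left_mono)
      have "(real a + 1)\<^sup>2 \<le> (2 * real a)\<^sup>2" using a1 by (intro power_mono) auto
      then have "2 * l * (real a + 1)\<^sup>2 \<le> 2 * l * (2 * real a)\<^sup>2" using l by (intro mult_left_mono) auto
      then have "t powr \<delta> \<le> (8 * (real a)\<^sup>2 * l) powr \<delta>"
        using t \<delta>_pos by (intro powr_mono2) (auto simp: t_def power_mult_distrib)
      also have "\<dots> = 8 powr \<delta> * real a powr (2 * \<delta>) * l powr \<delta>"
        using a1 l by (simp add: powr_mult powr_powr[symmetric] flip: powr_numeral)
      finally have "real a powr (- (2 * \<delta>)) * t powr \<delta>
          \<le> real a powr (- (2 * \<delta>)) * (8 powr \<delta> * real a powr (2 * \<delta>) * l powr \<delta>)"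
        by (intro mult_left_mono) auto
      also have "\<dots> = (8 * l) powr \<delta>" using a1 l by (simp add: powr_minus powr_mult field_simps)
      also have "\<dots> \<le> 8 * l powr \<delta>" using l by (intro powr_scale) auto
      finally show "real a powr (- (2 * \<delta>)) * t powr \<delta> \<le> 8 * l powr \<delta>" .
    qed (use K0_ge in auto)
    also have "\<dots> \<le> ennreal (K2 * l powr \<delta>)"
      using C_pos K0_ge tail_pos by (intro ennreal_leI) (simp add: K2_def algebra_simps)
    finally show ?thesis .
  qed
qed

text \<open>\<open>4 * K2\<close> is the branching case after one distortion, and 4 is the case of a
  single word.\<close>

definition K :: real where
  "K = 4 * K2 + 4"

lemma K2_pos: "0 < K2"
  using C_pos K0_ge tail_pos by (simp add: K2_def)

text \<open>Blowing up by the inverse of the cylinder length, up to constants, cancels the weight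
  exactly. This is how estimates at unit scale return to the original scale.\<close>

lemma wt_mult_powr: "0 \<notin> set w \<Longrightarrow> 0 < x \<Longrightarrow>
    wt \<delta> w * ((cf_den w 0)\<^sup>2 * x) powr \<delta> = x powr \<delta>"
proof -
  assume w: "0 \<notin> set w" and x: "0 < x"
  have q: "0 < cf_den w 0" using cf_den_ge_1[OF w] by simp
  then have "((cf_den w 0)\<^sup>2 * x) powr \<delta> = cf_den w 0 powr (2 * \<delta>) * x powr \<delta>"
    using x by (simp add: powr_mult powr_powr[symmetric] flip: powr_numeral)
  then show ?thesis using q by (simp add: wt_def powr_minus field_simps)
qed

text \<open>Induction on \<open>n\<close>, extending the common prefix \<open>v\<close> as long as all words share their first
  letter: this way the distortion of \<open>cf_map v\<close> enters only once.\<close>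

lemma mass_prefix_small:
  assumes "0 \<notin> set v" "0 < d" "\<And>x y. x \<in> U \<Longrightarrow> y \<in> U \<Longrightarrow> \<bar>x - y\<bar> \<le> d"
  shows "mass \<delta> ((@) v ` {w \<in> words I n. cyl (v @ w) \<subseteq> U}) \<le> ennreal (K * d powr \<delta>)"
  using assms(1)
proof (induction n arbitrary: v)
  case 0
  have q: "1 \<le> cf_den v 0" by (rule cf_den_ge_1[OF 0])
  show ?case
  proof (cases "cyl v \<subseteq> U")
    case True
    then have "\<bar>cf_map v 1 - cf_map v 0\<bar> \<le> d"
      by (intro assms(3)) (auto simp: cyl_def)
    then have "4 * (cf_den v 0)\<^sup>2 * \<bar>cf_map v 1 - cf_map v 0\<bar> \<le> 4 * (cf_den v 0)\<^sup>2 * d"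
      by (intro mult_left_mono) auto
    then have "1 \<le> (cf_den v 0)\<^sup>2 * (4 * d)" using cyl_endpoints_dist[OF 0] by simp
    then have "wt \<delta> v * 1 \<le> wt \<delta> v * ((cf_den v 0)\<^sup>2 * (4 * d)) powr \<delta>"
      using \<delta>_pos by (intro mult_left_mono ge_one_powr_ge_zero) auto
    also have "\<dots> = (4 * d) powr \<delta>" using assms(2) by (intro wt_mult_powr[OF 0]) auto
    also have "\<dots> \<le> 4 * d powr \<delta>" using assms(2) by (intro powr_scale) auto
    also have "\<dots> \<le> K * d powr \<delta>" using K2_pos by (intro mult_right_mono) (auto simp: K_def)
    finally have "wt \<delta> v \<le> K * d powr \<delta>" by simp
    moreover have "{w \<in> words I 0. cyl (v @ w) \<subseteq> U} = {[]}" using True by auto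
    ultimately show ?thesis by (simp only:) (simp add: mass_finite ennreal_leI)
  next
    case False
    then have "(@) v ` {w \<in> words I 0. cyl (v @ w) \<subseteq> U} = {}" by auto
    then show ?thesis by (simp only: mass_empty) simp
  qed
next
  case (Suc n)
  let ?W = "{w \<in> words I (Suc n). cyl (v @ w) \<subseteq> U}"
  show ?case
  proof (cases "\<exists>w1\<in>?W. \<exists>w2\<in>?W. hd w1 \<noteq> hd w2")
    case True
    then obtain w1 w2 where w12: "w1 \<in> ?W" "w2 \<in> ?W" "hd w1 \<noteq> hd w2" by blast
    \<comment> \<open>By \<open>cf_map_diff_ge\<close>, points of the unit interval whose images
      under \<open>cf_map v\<close> are at distance at most \<open>d\<close> are within
      \<open>l\<close> of each other.\<close>
    define l where "l = (cf_den v 0)\<^sup>2 * (4 * d)"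
    have l: "0 < l" using cf_den_ge_1[OF Suc.prems] assms(2) by (simp add: l_def)
    have "mass \<delta> ?W \<le> ennreal (K2 * l powr \<delta>)"
    proof (rule mass_two_first_letters[OF _ l _ w12])
      fix u w x y
      assume u: "u \<in> ?W" "w \<in> ?W" "x \<in> cyl u" "y \<in> cyl w"
      then have xy: "x \<in> {0..1}" "y \<in> {0..1}" using cyl_subset_unit wordsD by blast+
      have "cf_map v x \<in> U" "cf_map v y \<in> U" using u by (auto simp: cyl_append)
      then have "\<bar>cf_map v x - cf_map v y\<bar> \<le> d" by (rule assms(3))
      then have "4 * (cf_den v 0)\<^sup>2 * \<bar>cf_map v x - cf_map v y\<bar> \<le> 4 * (cf_den v 0)\<^sup>2 * d"
        by (intro mult_left_mono) auto
      then show "\<bar>x - y\<bar> \<le> l"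
        using cf_map_diff_ge[OF Suc.prems, of x y] xy by (simp add: l_def)
    qed auto
    then have "mass \<delta> ((@) v ` ?W) \<le> ennreal (wt \<delta> v) * ennreal (K2 * l powr \<delta>)"
      using wordsD by (intro order_trans[OF mass_append_le[OF Suc.prems]] mult_left_mono) auto
    also have "\<dots> = ennreal (K2 * (wt \<delta> v * l powr \<delta>))"
      using K2_pos by (simp add: ennreal_mult[symmetric] mult_ac)
    also have "wt \<delta> v * l powr \<delta> = (4 * d) powr \<delta>"
      unfolding l_def using assms(2) by (intro wt_mult_powr[OF Suc.prems]) auto
    also have "ennreal (K2 * (4 * d) powr \<delta>) \<le> ennreal (K2 * (4 * d powr \<delta>))"
      using K2_pos assms(2) powr_scale[of 4 d] by (intro ennreal_leI mult_left_mono) auto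
    also have "\<dots> \<le> ennreal (K * d powr \<delta>)"
      by (intro ennreal_leI) (simp add: K_def algebra_simps)
    finally show ?thesis .
  next
    case False
    show ?thesis
    proof (cases "?W = {}")
      case True
      then show ?thesis by (simp only: image_empty mass_empty) simp
    next
      case nonempty: False
      then obtain w0 where w0: "w0 \<in> ?W" by blast
      then obtain a u0 where a: "w0 = a # u0" "a \<in> I" by (auto simp: words_def length_Suc_conv)
      let ?V = "{w \<in> words I n. cyl ((v @ [a]) @ w) \<subseteq> U}"
      have "(@) v ` ?W \<subseteq> (@) (v @ [a]) ` ?V"
      proof clarify
        fix w
        assume w: "w \<in> words I (Suc n)" "cyl (v @ w) \<subseteq> U"
        then obtain b u where u: "w = b # u" "u \<in> words I n"
          by (auto simp: words_def length_Suc_conv)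
        have "hd w = hd w0" using False w w0 by blast
        then have "v @ w = (v @ [a]) @ u" using u a by simp
        then show "v @ w \<in> (@) (v @ [a]) ` ?V" using u w by (metis (mono_tags, lifting) image_eqI mem_Collect_eq)
      qed
      then have "mass \<delta> ((@) v ` ?W) \<le> mass \<delta> ((@) (v @ [a]) ` ?V)"
        by (rule mass_mono)
      also have "\<dots> \<le> ennreal (K * d powr \<delta>)"
        using Suc.prems a letter_pos[OF a(2)] by (intro Suc.IH) auto
      finally show ?thesis .
    qed
  qed
qed

lemma mass_small:
  assumes "0 < d" "\<And>x y. x \<in> U \<Longrightarrow> y \<in> U \<Longrightarrow> \<bar>x - y\<bar> \<le> d"
  shows "mass \<delta> {w \<in> words I n. cyl w \<subseteq> U} \<le> ennreal (K * d powr \<delta>)"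
  using mass_prefix_small[of "[]" d U n] assms by simp

end

context cf_exponent
begin

text \<open>The letters within \<open>M N\<close> of a fixed letter \<open>a\<close> number at least
  \<open>c (M N)^\<delta>\<close>, and at most \<open>C N^\<delta>\<close> of them are at most
  \<open>N\<close>. The choice of \<open>M\<close> leaves at least \<open>N^\<delta>\<close> letters
  between \<open>N\<close> and \<open>(a + M) N\<close>, which already have the required
  weight.\<close>

lemma lower_tail:
  assumes U: "upper_regular \<delta> C I" and L: "lower_regular \<delta> c I" and I: "0 \<notin> I" "a \<in> I"
  shows "\<exists>\<kappa>>0. \<forall>N\<ge>1. ennreal (\<kappa> * N powr (- \<delta>)) \<le> mass \<delta> (words {b \<in> I. N \<le> real b} 1)"
proof -
  have C: "0 < C" and c: "0 < c" using U L by (auto simp: upper_regular_def lower_regular_def)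
  define M where "M = max 1 (((C + 1) / c) powr (1 / \<delta>))"
  have M: "1 \<le> M" by (simp add: M_def)
  have cM: "C + 1 \<le> c * M powr \<delta>"
  proof -
    have "(((C + 1) / c) powr (1 / \<delta>)) powr \<delta> \<le> M powr \<delta>"
      using \<delta>_pos by (intro powr_mono2) (auto simp: M_def)
    then have "(C + 1) / c \<le> M powr \<delta>" using C c \<delta>_pos by (simp add: powr_powr)
    then show ?thesis using c by (simp add: pos_divide_le_eq mult.commute)
  qed
  define \<kappa> where "\<kappa> = (real a + M) powr (- (2 * \<delta>))"
  have "ennreal (\<kappa> * N powr (- \<delta>)) \<le> mass \<delta> (words {b \<in> I. N \<le> real b} 1)" if N: "1 \<le> N" for N
  proof -
    define R where "R = M * N"
    have R: "1 \<le> R" using M N mult_mono[of 1 M 1 N] by (simp add: R_def)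
    define D where "D = {b \<in> I. N \<le> real b \<and> real b \<le> real a + R}"
    let ?E = "{b \<in> I. 0 \<le> real b \<and> real b \<le> 0 + N}" and ?F = "{b \<in> I. \<bar>real b - real a\<bar> \<le> R}"
    have finD: "finite D" using finite_nat_real_le[of "\<lambda>b. b \<in> I \<and> N \<le> real b"] by (simp add: D_def conj_ac)
    have finE: "finite ?E" using finite_nat_real_le[of "\<lambda>b. b \<in> I" N] by simp
    have "?F \<subseteq> ?E \<union> D" by (auto simp: D_def)
    then have "card ?F \<le> card ?E + card D"
      using card_mono[of "?E \<union> D" ?F] finD finE card_Un_le[of ?E D] by simp
    moreover have "c * R powr \<delta> \<le> real (card ?F)"
      using L R I(2) by (simp add: lower_regular_def)
    moreover have "real (card ?E) \<le> C * N powr \<delta>"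
      using U N unfolding upper_regular_def by blast
    ultimately have "c * R powr \<delta> - C * N powr \<delta> \<le> real (card D)" by linarith
    moreover have "(C + 1) * N powr \<delta> \<le> c * R powr \<delta>"
      using cM M N mult_right_mono[of "C + 1" "c * M powr \<delta>" "N powr \<delta>"]
      by (simp add: R_def powr_mult)
    ultimately have cardD: "N powr \<delta> \<le> real (card D)" by (simp add: algebra_simps)
    have "real a * 1 \<le> real a * N" using N by (intro mult_left_mono) auto
    then have le: "real a + R \<le> (real a + M) * N" by (simp add: R_def algebra_simps)
    have "\<kappa> * N powr (- \<delta>) = N powr \<delta> * ((real a + M) * N) powr (- (2 * \<delta>))"
      using M N by (simp add: \<kappa>_def powr_mult powr_add[symmetric] mult_ac)
    also have "\<dots> \<le> real (card D) * (real a + R) powr (- (2 * \<delta>))"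
      using cardD le R \<delta>_pos by (intro mult_mono powr_mono2') auto
    finally have "ennreal (\<kappa> * N powr (- \<delta>)) \<le> ennreal (real (card D) * (real a + R) powr (- (2 * \<delta>)))"
      by (rule ennreal_leI)
    also have "\<dots> \<le> mass \<delta> (words D 1)"
      using finD I(1) by (intro mass_letters_ge) (auto simp: D_def intro: gr0I)
    also have "\<dots> \<le> mass \<delta> (words {b \<in> I. N \<le> real b} 1)"
      by (intro mass_mono words_mono) (auto simp: D_def)
    finally show ?thesis .
  qed
  moreover have "0 < \<kappa>" using M by (auto simp: \<kappa>_def intro!: powr_gt_zero[THEN iffD2])
  ultimately show ?thesis by blast
qed

section \<open>Covers by cylinders\<close>

lemma diam_weight_eq: "diam_weight \<delta> U = ennreal (diameter U powr \<delta>)"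
  using \<delta>_pos by (auto simp: diam_weight_def)

lemma diam_weight_cyl_le: "0 \<notin> set w \<Longrightarrow> diam_weight \<delta> (cyl w) \<le> ennreal (wt \<delta> w)"
proof -
  assume w: "0 \<notin> set w"
  have q: "1 \<le> cf_den w 0" by (rule cf_den_ge_1[OF w])
  have "diameter (cyl w) powr \<delta> \<le> (1 / (cf_den w 0)\<^sup>2) powr \<delta>"
    using diameter_cyl_le[OF w] \<delta>_pos diameter_ge_0[OF compact_imp_bounded[OF compact_cyl[OF w]]]
    by (intro powr_mono2) auto
  also have "\<dots> = wt \<delta> w"
    using q by (simp add: wt_def powr_divide powr_minus_divide powr_powr[symmetric] flip: powr_numeral)
  finally show ?thesis unfolding diam_weight_eq by (rule ennreal_leI)
qed

lemma hausdorff_premeasure_le_mass: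
  assumes A: "A \<subseteq> (\<Union>w\<in>W. cyl w)"
    and W: "\<And>w. w \<in> W \<Longrightarrow> 0 \<notin> set w" "\<And>w. w \<in> W \<Longrightarrow> (1 / 2) ^ (length w div 2) \<le> \<epsilon>" and \<epsilon>: "0 < \<epsilon>"
  shows "hausdorff_premeasure \<epsilon> \<delta> A \<le> mass \<delta> W"
proof -
  \<comment> \<open>Covers are sequences, so the cylinders are placed at the codes of their words;
    the remaining indices carry the empty set, of weight 0.\<close>
  define U where "U i = (if i \<in> to_nat ` W then cyl (from_nat i) else {})" for i
  have "hausdorff_premeasure \<epsilon> \<delta> A \<le> (\<Sum>i. diam_weight \<delta> (U i))"
  proof (rule hausdorff_premeasure_le_cover)
    fix i
    show "bounded (U i)"
      using W(1) by (auto simp: U_def intro!: compact_imp_bounded compact_cyl)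
    show "diameter (U i) \<le> \<epsilon>"
    proof (cases "i \<in> to_nat ` W")
      case True
      then obtain w where w: "w \<in> W" "i = to_nat w" by auto
      have "diameter (cyl w) \<le> \<epsilon>"
        using cyl_dist_le_power[OF W(1)[OF w(1)]] W(2)[OF w(1)] cyl_nonempty
        by (intro diameter_le) (auto intro: order_trans)
      then show ?thesis using w by (simp add: U_def)
    qed (use \<epsilon> in \<open>simp add: U_def\<close>)
    show "A \<subseteq> (\<Union>i. U i)"
    proof
      fix x
      assume "x \<in> A"
      then obtain w where w: "w \<in> W" "x \<in> cyl w" using A by blast
      then have "x \<in> U (to_nat w)" by (simp add: U_def)
      then show "x \<in> (\<Union>i. U i)" by blast
    qed
  qed
  also have "\<dots> \<le> (\<Sum>i. ennreal (wt \<delta> (from_nat i)) * indicator (to_nat ` W) i)"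
  proof (intro suminf_le)
    show "diam_weight \<delta> (U i) \<le> ennreal (wt \<delta> (from_nat i)) * indicator (to_nat ` W) i" for i
      using diam_weight_cyl_le[OF W(1)] by (auto simp: U_def diam_weight_def[of _ "{}"])
  qed auto
  also have "\<dots> = (\<integral>\<^sup>+ i. ennreal (wt \<delta> (from_nat i)) \<partial>count_space (to_nat ` W))"
    by (simp add: nn_integral_count_space_indicator nn_integral_count_space_nat)
  also have "\<dots> = (\<integral>\<^sup>+ w. ennreal (wt \<delta> (from_nat (to_nat w))) \<partial>count_space W)"
    by (rule nn_integral_bij_count_space[symmetric]) (auto simp: bij_betw_def inj_on_def)
  also have "\<dots> = mass \<delta> W"
    by (simp add: mass_eq_nn_integral)
  finally show ?thesis .
qed

end

subsection \<open>Hausdorff measure of limit sets of regular alphabets\<close>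

lemma ex_half_power_le: "0 < (e :: real) \<Longrightarrow> \<exists>N. \<forall>n\<ge>N. (1 / 2) ^ (n div 2) < e"
  using order_tendstoD(2)[OF half_power_div_2_tendsto_0] by (auto simp: eventually_sequentially)

context regular_alphabet
begin

abbreviation J :: "real set" where
  "J \<equiv> cf_set I"

lemma K_pos: "0 < K"
  using K2_pos by (simp add: K_def)

lemma J_point:
  assumes "x \<in> J"
  obtains \<omega> where "\<And>n. \<omega> n \<in> I" "\<And>n. 0 < \<omega> n" "\<And>n. x \<in> cyl (prefix_word \<omega> n)"
    "\<And>n. prefix_word \<omega> n \<in> words I n"
proof -
  obtain \<omega> where \<omega>: "has_cf_expansion x \<omega>" "\<forall>n. \<omega> n \<in> I" using assms cf_set_iff by blast
  then show thesis using that[of \<omega>] has_cf_expansionD[OF \<omega>(1)] by (auto simp: words_def)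
qed

text \<open>At a level where cylinders are shorter than \<open>d\<close>, those meeting the interval
  lie in the interval of twice the radius, and \<open>mass_small\<close> bounds their mass
  independently of the level.\<close>

lemma hausdorff_interval_le:
  assumes d: "0 < d"
  shows "hausdorff_outer_measure \<delta> (J \<inter> {u - d..u + d}) \<le> ennreal (4 * K * d powr \<delta>)"
proof (rule hausdorff_outer_measure_le)
  fix \<epsilon> :: real
  assume \<epsilon>: "0 < \<epsilon>"
  have "0 < min \<epsilon> d" using d \<epsilon> by simp
  then obtain n where n: "(1 / 2) ^ (n div 2) < min \<epsilon> d"
    using ex_half_power_le by blast
  let ?U = "{u - 2 * d..u + 2 * d}"
  define W where "W = {w \<in> words I n. cyl w \<inter> {u - d..u + d} \<noteq> {}}"
  have "hausdorff_premeasure \<epsilon> \<delta> (J \<inter> {u - d..u + d}) \<le> mass \<delta> W"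
  proof (rule hausdorff_premeasure_le_mass)
    show "J \<inter> {u - d..u + d} \<subseteq> (\<Union>w\<in>W. cyl w)"
    proof
      fix x
      assume x: "x \<in> J \<inter> {u - d..u + d}"
      then have "x \<in> J" by simp
      then obtain \<omega> where "x \<in> cyl (prefix_word \<omega> n)" "prefix_word \<omega> n \<in> words I n"
        by (rule J_point) blast
      then show "x \<in> (\<Union>w\<in>W. cyl w)" using x unfolding W_def by blast
    qed
  qed (use n \<epsilon> wordsD in \<open>auto simp: W_def words_def\<close>)
  also have "\<dots> \<le> mass \<delta> {w \<in> words I n. cyl w \<subseteq> ?U}"
  proof (rule mass_mono)
    show "W \<subseteq> {w \<in> words I n. cyl w \<subseteq> ?U}"
    proof clarify
      fix w
      assume w: "w \<in> W"
      then obtain x where x: "w \<in> words I n" "x \<in> cyl w" "x \<in> {u - d..u + d}"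
        unfolding W_def by blast
      have "y \<in> ?U" if "y \<in> cyl w" for y
      proof -
        have "\<bar>y - x\<bar> \<le> (1 / 2) ^ (length w div 2)"
          by (rule cyl_dist_le_power[OF wordsD[OF x(1)] that x(2)])
        then have "\<bar>y - x\<bar> \<le> d" using n x(1) by (auto simp: words_def)
        then show ?thesis using x(3) by auto
      qed
      then show "w \<in> words I n \<and> cyl w \<subseteq> ?U" using x by blast
    qed
  qed
  also have "\<dots> \<le> ennreal (K * (4 * d) powr \<delta>)"
    using d by (intro mass_small) auto
  also have "\<dots> \<le> ennreal (4 * K * d powr \<delta>)"
    using powr_scale[of 4 d] K_pos d mult_left_mono[of "(4 * d) powr \<delta>" "4 * d powr \<delta>" K]
    by (intro ennreal_leI) (auto simp: mult_ac)
  finally show "hausdorff_premeasure \<epsilon> \<delta> (J \<inter> {u - d..u + d}) \<le> ennreal (4 * K * d powr \<delta>)" .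
qed

text \<open>The closure of \<open>J\<close> is compact and differs from \<open>J\<close> by rational points only. So a cover of
  \<open>J\<close>, together with tiny neighbourhoods of the rationals, has a Lebesgue number, and all cylinders
  of a sufficiently deep level are contained in single members of it.\<close>

lemma mass_le_cover:
  assumes B: "compact B" and m: "\<And>n. N \<le> n \<Longrightarrow> ennreal m \<le> mass \<delta> {w \<in> words I n. cyl w \<subseteq> B}"
    and U: "\<And>i. bounded (U i)" "J \<inter> B \<subseteq> (\<Union>i. U i)" and e: "0 < e"
  shows "ennreal m \<le> ennreal (4 * K) * (\<Sum>i. diam_weight \<delta> (U i)) + ennreal (6 * K * e)"
proof -
  \<comment> \<open>The numbers \<open>\<eta> i powr \<delta>\<close> sum to \<open>e\<close>. Hence
    fattening the given cover and covering all rationals each cost only a multiple of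
    \<open>e\<close>.\<close>
  define \<eta> where "\<eta> i = (e * (1 / 2) ^ Suc i) powr (1 / \<delta>)" for i :: nat
  have \<eta>: "0 < \<eta> i" "\<eta> i powr \<delta> = e * (1 / 2) ^ Suc i" for i
    using e \<delta>_pos by (auto simp: \<eta>_def powr_powr)
  define D where "D i = diameter (U i)" for i
  have D: "0 \<le> D i" for i by (simp add: D_def diameter_ge_0 U)
  \<comment> \<open>For empty \<open>U i\<close> the center is an arbitrary default and the radius
    is just \<open>\<eta> i\<close>, so the same bounds hold there.\<close>
  define V where "V i = ball (SOME x. x \<in> U i) (D i + \<eta> i)" for i
  define r where "r = from_nat_into (\<rat> :: real set)"
  have r: "range r = \<rat>" unfolding r_def
    by (rule range_from_nat_into) (use Rats_0 countable_rat in auto)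
  define Q where "Q i = ball (r i) (\<eta> i)" for i
  have UV: "U i \<subseteq> V i" for i
  proof
    fix x
    assume x: "x \<in> U i"
    then have "(SOME x. x \<in> U i) \<in> U i" by (rule someI)
    then have "dist (SOME x. x \<in> U i) x \<le> D i"
      unfolding D_def using x by (intro diameter_bounded_bound U)
    then show "x \<in> V i" using \<eta>(1)[of i] by (simp add: V_def)
  qed
  obtain \<epsilon> where \<epsilon>: "0 < \<epsilon>" "\<And>x. x \<in> closure J \<inter> B \<Longrightarrow> \<exists>G\<in>range V \<union> range Q. ball x \<epsilon> \<subseteq> G"
  proof (rule Heine_Borel_lemma[of "closure J \<inter> B" "range V \<union> range Q"])
    show "compact (closure J \<inter> B)"
      by (intro closed_Int_compact B) auto
    show "closure J \<inter> B \<subseteq> \<Union>(range V \<union> range Q)"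
    proof
      fix x
      assume x: "x \<in> closure J \<inter> B"
      then consider "x \<in> J" | "x \<in> \<rat>" using closure_cf_set_subset by blast
      then show "x \<in> \<Union>(range V \<union> range Q)"
      proof cases
        case 1
        then show ?thesis using x U(2) UV by blast
      next
        case 2
        then obtain i where "x = r i" using r by blast
        then have "x \<in> Q i" using \<eta>(1) by (simp add: Q_def)
        then show ?thesis by blast
      qed
    qed
    show "open G" if "G \<in> range V \<union> range Q" for G
      using that by (auto simp: V_def Q_def)
  qed blast
  obtain M where M: "\<And>n. M \<le> n \<Longrightarrow> (1 / 2) ^ (n div 2) < \<epsilon>" using ex_half_power_le[OF \<epsilon>(1)] by blast
  define n where "n = max M N"
  let ?S = "\<lambda>G. {w \<in> words I n. cyl w \<subseteq> G}"
  have geo: "(\<Sum>i. ennreal (k * (e * (1 / 2) ^ Suc i))) = ennreal (k * e)" if "0 \<le> k" for k :: real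
    using sums_mult[OF power_half_series, of "k * e"] that e
    by (intro suminf_ennreal_eq) (auto simp: mult_ac)
  have "?S B \<subseteq> (\<Union>i. ?S (V i)) \<union> (\<Union>i. ?S (Q i))"
  proof
    fix w
    assume w: "w \<in> ?S B"
    then have "cf_set I \<inter> cyl w \<noteq> {}"
      using I_pos I_nonempty by (intro cf_set_meets_cyl) (auto simp: words_def)
    then obtain x where x: "x \<in> J" "x \<in> cyl w" by blast
    have "x \<in> closure J \<inter> B" using x w closure_subset by blast
    then obtain G where G: "G \<in> range V \<union> range Q" "ball x \<epsilon> \<subseteq> G" using \<epsilon>(2) by blast
    have "y \<in> ball x \<epsilon>" if y: "y \<in> cyl w" for y
    proof -
      have "\<bar>x - y\<bar> \<le> (1 / 2) ^ (length w div 2)"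
        by (rule cyl_dist_le_power) (use w x y wordsD in auto)
      also have "length w = n" using w by (simp add: words_def)
      also have "(1 / 2) ^ (n div 2) < \<epsilon>" by (rule M) (simp add: n_def)
      finally show ?thesis by (simp add: dist_real_def)
    qed
    then have "w \<in> ?S G" using w G(2) by blast
    then show "w \<in> (\<Union>i. ?S (V i)) \<union> (\<Union>i. ?S (Q i))" using G(1) by blast
  qed
  then have "mass \<delta> (?S B) \<le> mass \<delta> (\<Union>i. ?S (V i)) + mass \<delta> (\<Union>i. ?S (Q i))"
    using mass_mono mass_Un_le order_trans by meson
  also have "\<dots> \<le> (\<Sum>i. mass \<delta> (?S (V i))) + (\<Sum>i. mass \<delta> (?S (Q i)))"
    by (intro add_mono mass_UN_le)
  also have "\<dots> \<le> (\<Sum>i. ennreal (4 * K) * diam_weight \<delta> (U i) + ennreal (4 * K * (e * (1 / 2) ^ Suc i)))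
      + (\<Sum>i. ennreal (2 * K * (e * (1 / 2) ^ Suc i)))"
  proof (intro add_mono suminf_le)
    fix i
    have "mass \<delta> (?S (V i)) \<le> ennreal (K * (2 * (D i + \<eta> i)) powr \<delta>)"
    proof (rule mass_small)
      show "0 < 2 * (D i + \<eta> i)" using D[of i] \<eta>(1)[of i] by simp
      show "\<bar>x - y\<bar> \<le> 2 * (D i + \<eta> i)" if "x \<in> V i" "y \<in> V i" for x y
        using that by (auto simp: V_def dist_real_def)
    qed
    also have "\<dots> \<le> ennreal (4 * K * (D i powr \<delta> + \<eta> i powr \<delta>))"
    proof (rule ennreal_leI)
      have "(2 * (D i + \<eta> i)) powr \<delta> \<le> (4 * max (D i) (\<eta> i)) powr \<delta>"
        using D[of i] \<eta>(1)[of i] \<delta>_pos by (intro powr_mono2) auto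
      also have "\<dots> \<le> 4 * max (D i) (\<eta> i) powr \<delta>" using D[of i] by (intro powr_scale) auto
      also have "\<dots> \<le> 4 * (D i powr \<delta> + \<eta> i powr \<delta>)" by (auto simp: max_def)
      finally have "K * (2 * (D i + \<eta> i)) powr \<delta> \<le> K * (4 * (D i powr \<delta> + \<eta> i powr \<delta>))"
        using K_pos by (intro mult_left_mono) auto
      then show "K * (2 * (D i + \<eta> i)) powr \<delta> \<le> 4 * K * (D i powr \<delta> + \<eta> i powr \<delta>)"
        by (simp add: mult_ac)
    qed
    also have "\<dots> = ennreal (4 * K) * diam_weight \<delta> (U i) + ennreal (4 * K * (e * (1 / 2) ^ Suc i))"
      using K_pos e by (simp add: diam_weight_eq D_def \<eta>(2) distrib_left ennreal_plus ennreal_mult)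
    finally show "mass \<delta> (?S (V i))
        \<le> ennreal (4 * K) * diam_weight \<delta> (U i) + ennreal (4 * K * (e * (1 / 2) ^ Suc i))" .
    have "mass \<delta> (?S (Q i)) \<le> ennreal (K * (2 * \<eta> i) powr \<delta>)"
      using \<eta>(1)[of i] by (intro mass_small) (auto simp: Q_def dist_real_def)
    also have "\<dots> \<le> ennreal (K * (2 * \<eta> i powr \<delta>))"
      using K_pos \<eta>(1)[of i] powr_scale[of 2 "\<eta> i"] by (intro ennreal_leI mult_left_mono) auto
    finally show "mass \<delta> (?S (Q i)) \<le> ennreal (2 * K * (e * (1 / 2) ^ Suc i))"
      by (simp add: \<eta>(2) mult_ac)
  qed auto
  also have "\<dots> = ennreal (4 * K) * (\<Sum>i. diam_weight \<delta> (U i)) + ennreal (4 * K * e) + ennreal (2 * K * e)"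
  proof -
    have "(\<Sum>i. ennreal (4 * K) * diam_weight \<delta> (U i) + ennreal (4 * K * (e * (1 / 2) ^ Suc i)))
        = (\<Sum>i. ennreal (4 * K) * diam_weight \<delta> (U i)) + (\<Sum>i. ennreal (4 * K * (e * (1 / 2) ^ Suc i)))"
      by (rule suminf_add[symmetric]) auto
    then show ?thesis
      using geo[of "4 * K"] geo[of "2 * K"] K_pos by (simp only: ennreal_suminf_cmult)
  qed
  also have "\<dots> = ennreal (4 * K) * (\<Sum>i. diam_weight \<delta> (U i)) + ennreal (6 * K * e)"
    using K_pos e by (simp add: add.assoc ennreal_plus[symmetric] del: ennreal_plus)
  finally show ?thesis using m[of n] by (auto simp: n_def)
qed

text \<open>A mass distribution principle with level masses in place of a measure: the premeasure of
  mesh 1 already has this lower bound, by letting the error \<open>e\<close> of the covering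
  inequality tend to 0.\<close>

lemma hausdorff_ge:
  assumes B: "compact B" and m: "\<And>n. N \<le> n \<Longrightarrow> ennreal m \<le> mass \<delta> {w \<in> words I n. cyl w \<subseteq> B}"
  shows "ennreal (m / (4 * K)) \<le> hausdorff_outer_measure \<delta> (J \<inter> B)"
proof -
  have "ennreal (m / (4 * K)) \<le> hausdorff_premeasure 1 \<delta> (J \<inter> B)"
    unfolding hausdorff_premeasure_def
  proof (rule INF_greatest)
    fix U :: "nat \<Rightarrow> real set"
    assume "U \<in> {U. (\<forall>i. bounded (U i) \<and> diameter (U i) \<le> 1) \<and> J \<inter> B \<subseteq> (\<Union>i. U i)}"
    then have U: "\<And>i. bounded (U i)" "J \<inter> B \<subseteq> (\<Union>i. U i)" by auto
    show "ennreal (m / (4 * K)) \<le> (\<Sum>i. diam_weight \<delta> (U i))"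
    proof (cases "\<Sum>i. diam_weight \<delta> (U i)")
      case (real s)
      have "ennreal m \<le> ennreal (4 * K * s)"
      proof (rule ennreal_le_epsilon)
        fix e :: real
        assume e: "0 < e"
        have "ennreal m \<le> ennreal (4 * K) * ennreal s + ennreal (6 * K * (e / (6 * K)))"
          using mass_le_cover[OF B m U, where e = "e / (6 * K)"] e K_pos real by simp
        then show "ennreal m \<le> ennreal (4 * K * s) + ennreal e"
          using K_pos real by (simp add: ennreal_mult)
      qed
      then have "m \<le> 4 * K * s" using K_pos real by (simp add: ennreal_le_iff)
      then show ?thesis using K_pos real by (simp add: pos_divide_le_eq mult_ac ennreal_leI)
    qed simp
  qed
  then show ?thesis using hausdorff_premeasure_le_outer[of 1] order_trans by (metis zero_less_one)
qed

text \<open>The set consists of the letters whose first-level cylinder lies within \<open>l\<close>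
  of \<open>y\<close>. If \<open>a l \<ge> 4\<close>, the interval around \<open>y\<close> extends
  below 0 and contains the cylinders of a whole tail of letters; otherwise it contains those of the
  letters within \<open>a^2 l / 8\<close> of \<open>a\<close>.\<close>

lemma mass_first_letters:
  "\<exists>\<kappa>>0. \<forall>a\<in>I. \<forall>y l. 1 / (real a + 1) \<le> y \<longrightarrow> y \<le> 1 / real a \<longrightarrow> 8 \<le> (real a)\<^sup>2 * l \<longrightarrow> l \<le> 1 \<longrightarrow>
     ennreal (\<kappa> * l powr \<delta>) \<le> mass \<delta> (words {b \<in> I. 1 / real b \<le> y + l \<and> y - l \<le> 1 / (real b + 1)} 1)"
proof -
  have c: "0 < c" using lower by (simp add: lower_regular_def)
  obtain a0 where "a0 \<in> I" using I_nonempty by blast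
  then obtain \<kappa>1 where \<kappa>1: "0 < \<kappa>1"
    "\<And>N. 1 \<le> N \<Longrightarrow> ennreal (\<kappa>1 * N powr (- \<delta>)) \<le> mass \<delta> (words {b \<in> I. N \<le> real b} 1)"
    using lower_tail[OF upper lower I_pos] by blast
  \<comment> \<open>The first entry serves the tail, where the cutoff is \<open>2 / l\<close>. The
    second serves the window, where \<open>R / (2 a)^2 = l / 32\<close>.\<close>
  define \<kappa> where "\<kappa> = min (\<kappa>1 / 2) (c / 32)"
  have "ennreal (\<kappa> * l powr \<delta>) \<le> mass \<delta> (words {b \<in> I. 1 / real b \<le> y + l \<and> y - l \<le> 1 / (real b + 1)} 1)"
    if a: "a \<in> I" and y: "1 / (real a + 1) \<le> y" "y \<le> 1 / real a"
      and l: "8 \<le> (real a)\<^sup>2 * l" "l \<le> 1" for a y l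
  proof -
    let ?B = "{b \<in> I. 1 / real b \<le> y + l \<and> y - l \<le> 1 / (real b + 1)}"
    have a1: "1 \<le> real a" by (rule letter_pos[OF a])
    have l0: "0 < l"
    proof (rule ccontr)
      assume "\<not> 0 < l"
      then have "(real a)\<^sup>2 * l \<le> 0" by (intro mult_nonneg_nonpos) auto
      then show False using l by linarith
    qed
    show ?thesis
    proof (cases "4 \<le> real a * l")
      case True
      have "{b \<in> I. 2 / l \<le> real b} \<subseteq> ?B"
      proof clarify
        fix b
        assume b: "b \<in> I" "2 / l \<le> real b"
        have b1: "1 \<le> real b" by (rule letter_pos[OF b(1)])
        have "1 / real b \<le> l / 2" using b(2) b1 l0 by (simp add: field_simps)
        moreover have "0 < 1 / (real a + 1)" using a1 by simp
        ultimately have "1 / real b \<le> y + l" using y(1) l0 by linarith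
        moreover have "1 / real a \<le> l / 4" using True a1 by (simp add: field_simps)
        then have "y - l \<le> 0" using y(2) l0 by linarith
        moreover have "0 \<le> 1 / (real b + 1)" by simp
        ultimately show "1 / real b \<le> y + l \<and> y - l \<le> 1 / (real b + 1)" by linarith
      qed
      then have "mass \<delta> (words {b \<in> I. 2 / l \<le> real b} 1) \<le> mass \<delta> (words ?B 1)"
        by (intro mass_mono words_mono)
      moreover have "ennreal (\<kappa>1 * (2 / l) powr (- \<delta>)) \<le> mass \<delta> (words {b \<in> I. 2 / l \<le> real b} 1)"
        using l l0 by (intro \<kappa>1(2)) (simp add: pos_le_divide_eq)
      moreover have "\<kappa> * l powr \<delta> \<le> \<kappa>1 * (2 / l) powr (- \<delta>)"
      proof -
        have "l powr \<delta> = (2 * (l / 2)) powr \<delta>" by simp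
        also have "\<dots> \<le> 2 * (l / 2) powr \<delta>" using l0 by (intro powr_scale) auto
        also have "(l / 2) powr \<delta> = (2 / l) powr (- \<delta>)"
          using l0 by (simp add: powr_divide powr_minus_divide)
        finally have "\<kappa>1 / 2 * l powr \<delta> \<le> \<kappa>1 / 2 * (2 * (2 / l) powr (- \<delta>))"
          using \<kappa>1 by (intro mult_left_mono) auto
        moreover have "\<kappa> * l powr \<delta> \<le> \<kappa>1 / 2 * l powr \<delta>"
          by (intro mult_right_mono) (auto simp: \<kappa>_def)
        ultimately show ?thesis by simp
      qed
      ultimately show ?thesis by (meson ennreal_leI order_trans)
    next
      case False
      \<comment> \<open>The bound \<open>a^2 l \<ge> 8\<close> gives \<open>R \<ge> 1\<close>, as
        lower regularity demands, and \<open>a l < 4\<close> gives \<open>R \<le> a / 2\<close>, so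
        that the letters of the window are comparable to \<open>a\<close>.\<close>
      define R where "R = (real a)\<^sup>2 * l / 8"
      have R1: "1 \<le> R" using l by (simp add: R_def)
      have "(real a * l) * real a \<le> 4 * real a" using False a1 by (intro mult_right_mono) auto
      then have Ra: "R \<le> real a / 2" by (simp add: R_def power2_eq_square mult_ac)
      define D where "D = {b \<in> I. \<bar>real b - real a\<bar> \<le> R}"
      have D: "real a / 2 \<le> real b" "real b \<le> 2 * real a" if "b \<in> D" for b
        using that Ra by (auto simp: D_def)
      have finD: "finite D"
        by (rule finite_subset[OF _ finite_nat_real_le[of "\<lambda>b. True" "2 * real a"]]) (use D in auto)
      have sub: "D \<subseteq> ?B"
      proof
        fix b
        assume b: "b \<in> D"
        have b0: "0 < real b" using D(1)[OF b] a1 by simp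
        have ab: "\<bar>real b - real a\<bar> \<le> R" using b by (simp add: D_def)
        \<comment> \<open>The endpoints of cylinders shift the difference of letters by one; since
          \<open>R \<ge> 1\<close>, the allowance \<open>2 * R\<close> covers this.\<close>
        have 1: "\<bar>z\<bar> / (real a * real b) \<le> l" if z: "\<bar>z\<bar> \<le> 2 * R" for z
        proof -
          have "real a * (real a / 2) \<le> real a * real b" using D(1)[OF b] by (intro mult_left_mono) auto
          then have "l * (real a * (real a / 2)) \<le> l * (real a * real b)"
            by (rule mult_left_mono) (use l0 in simp)
          moreover have "2 * R \<le> l * (real a * (real a / 2))"
            using l0 by (simp add: R_def power2_eq_square)
          ultimately have "\<bar>z\<bar> \<le> l * (real a * real b)" using z by linarith
          then show ?thesis using a1 b0 by (simp add: pos_divide_le_eq)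
        qed
        have "1 / real b - 1 / (real a + 1) = (real a + 1 - real b) / ((real a + 1) * real b)"
          using a1 b0 by (simp add: field_simps)
        also have "\<dots> \<le> \<bar>real a + 1 - real b\<bar> / (real a * real b)"
          using a1 b0 by (intro frac_le) auto
        also have "\<dots> \<le> l" using ab R1 by (intro 1) linarith
        finally have "1 / real b \<le> y + l" using y by linarith
        moreover have "1 / real a - 1 / (real b + 1) = (real b + 1 - real a) / (real a * (real b + 1))"
          using a1 b0 by (simp add: field_simps)
        moreover have "\<dots> \<le> \<bar>real b + 1 - real a\<bar> / (real a * real b)"
          using a1 b0 by (intro frac_le) auto
        moreover have "\<dots> \<le> l" using ab R1 by (intro 1) linarith
        ultimately have "1 / real b \<le> y + l \<and> y - l \<le> 1 / (real b + 1)" using y by linarith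
        then show "b \<in> ?B" using b by (simp add: D_def)
      qed
      have "\<kappa> * l powr \<delta> \<le> c / 32 * l powr \<delta>" by (intro mult_right_mono) (auto simp: \<kappa>_def)
      also have "\<dots> \<le> c / 32 * (32 * (l / 32) powr \<delta>)"
        using c l0 powr_scale[of 32 "l / 32"] by (intro mult_left_mono) auto
      also have "\<dots> = c * (l / 32) powr \<delta>" by simp
      also have "(l / 32) powr \<delta> = R powr \<delta> * (2 * real a) powr (- (2 * \<delta>))"
      proof -
        have "(2 * real a) powr (- (2 * \<delta>)) = ((2 * real a) powr (- 2)) powr \<delta>"
          by (simp add: powr_powr)
        also have "(2 * real a) powr (- 2) = 1 / (4 * (real a)\<^sup>2)"
          using a1 powr_numeral[of "2 * real a" Num.One] powr_realpow[of "2 * real a" 2]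
          by (simp add: powr_minus_divide power2_eq_square)
        finally show ?thesis
          using a1 l0 by (simp add: R_def powr_mult[symmetric])
      qed
      also have "c * (R powr \<delta> * (2 * real a) powr (- (2 * \<delta>))) \<le> real (card D) * (2 * real a) powr (- (2 * \<delta>))"
      proof -
        have "c * R powr \<delta> \<le> real (card D)"
          using lower a R1 by (simp add: lower_regular_def D_def)
        then show ?thesis by (simp add: mult.assoc[symmetric] mult_right_mono)
      qed
      finally have "ennreal (\<kappa> * l powr \<delta>) \<le> ennreal (real (card D) * (2 * real a) powr (- (2 * \<delta>)))"
        by (rule ennreal_leI)
      also have "\<dots> \<le> mass \<delta> (words D 1)"
        using finD D I_pos by (intro mass_letters_ge) (auto simp: D_def intro: gr0I)
      also have "\<dots> \<le> mass \<delta> (words ?B 1)"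
        using sub by (intro mass_mono words_mono)
      finally show ?thesis .
    qed
  qed
  moreover have "0 < \<kappa>" using c \<kappa>1 by (simp add: \<kappa>_def)
  ultimately show ?thesis by blast
qed

text \<open>Let \<open>v @ [a]\<close> be the shortest prefix of the expansion of \<open>x\<close> whose cylinder lies in the ball.
  Either this cylinder alone already has enough mass, or one uses those \<open>v @ [b]\<close> in the ball for
  which \<open>b\<close> is close to \<open>a\<close> or large.\<close>

lemma mass_ball_ge:
  "\<exists>\<kappa>>0. \<forall>x\<in>J. \<forall>r. 0 < r \<longrightarrow> r \<le> 1 \<longrightarrow>
     (\<exists>N. \<forall>n\<ge>N. ennreal (\<kappa> * r powr \<delta>) \<le> mass \<delta> {w \<in> words I n. cyl w \<subseteq> cball x r})"
proof -
  obtain \<kappa>2 where \<kappa>2: "0 < \<kappa>2" "\<And>a y l. a \<in> I \<Longrightarrow> 1 / (real a + 1) \<le> y \<Longrightarrow> y \<le> 1 / real a \<Longrightarrow>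
      8 \<le> (real a)\<^sup>2 * l \<Longrightarrow> l \<le> 1 \<Longrightarrow>
     ennreal (\<kappa>2 * l powr \<delta>) \<le> mass \<delta> (words {b \<in> I. 1 / real b \<le> y + l \<and> y - l \<le> 1 / (real b + 1)} 1)"
    using mass_first_letters by blast
  \<comment> \<open>Here 128 is 32 from the comparison of \<open>r\<close> with the cylinder of
    \<open>v @ [a]\<close>, times 4 for appending words; 16 is a factor 4 for each of two
    concatenations.\<close>
  define \<kappa> where "\<kappa> = min (1 / 128) (\<kappa>2 / 16)"
  have "\<exists>N. \<forall>n\<ge>N. ennreal (\<kappa> * r powr \<delta>) \<le> mass \<delta> {w \<in> words I n. cyl w \<subseteq> cball x r}"
    if x: "x \<in> J" and r: "0 < r" "r \<le> 1" for x r
  proof -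
    obtain \<omega> where \<omega>: "\<And>n. \<omega> n \<in> I" "\<And>n. x \<in> cyl (prefix_word \<omega> n)" "\<And>n. prefix_word \<omega> n \<in> words I n"
      by (rule J_point[OF x]) blast
    have pos: "0 \<notin> set (prefix_word \<omega> n)" for n by (rule wordsD[OF \<omega>(3)])
    have ex: "\<exists>k. cyl (prefix_word \<omega> k) \<subseteq> cball x r"
    proof -
      obtain k where "(1 / 2) ^ (k div 2) < r" using ex_half_power_le[OF r(1)] by blast
      moreover have "\<bar>x - y\<bar> \<le> (1 / 2) ^ (k div 2)" if "y \<in> cyl (prefix_word \<omega> k)" for y
        using cyl_dist_le_power[OF pos \<omega>(2) that] by simp
      ultimately show ?thesis by (intro exI[of _ k]) (force simp: dist_real_def)
    qed
    define k where "k = (LEAST k. cyl (prefix_word \<omega> k) \<subseteq> cball x r)"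
    have k: "cyl (prefix_word \<omega> k) \<subseteq> cball x r" unfolding k_def by (rule LeastI_ex[OF ex])
    show ?thesis
    proof (cases k)
      case 0
      have "ennreal (\<kappa> * r powr \<delta>) \<le> mass \<delta> {w \<in> words I n. cyl w \<subseteq> cball x r}" for n
      proof -
        have "{w \<in> words I n. cyl w \<subseteq> cball x r} = words I n"
          using k 0 cyl_subset_unit wordsD by (auto simp: cyl_def)
        moreover have "\<kappa> * r powr \<delta> \<le> 1 * 1"
          using r \<delta>_pos by (intro mult_mono) (auto simp: \<kappa>_def powr_le1)
        then have "ennreal (\<kappa> * r powr \<delta>) \<le> 1" using ennreal_leI[of "\<kappa> * r powr \<delta>" 1] by simp
        ultimately show ?thesis using mass_words_ge[of n] by (metis order_trans)
      qed
      then show ?thesis by blast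
    next
      case (Suc j)
      define v where "v = prefix_word \<omega> j"
      define a where "a = \<omega> j"
      define q where "q = cf_den v 0"
      have va: "prefix_word \<omega> k = v @ [a]" using Suc by (simp add: v_def a_def)
      have v: "v \<in> words I j" "0 \<notin> set v" "x \<in> cyl v" using \<omega> pos by (auto simp: v_def)
      have a: "a \<in> I" "1 \<le> real a" using \<omega> letter_pos by (auto simp: a_def)
      have q: "1 \<le> q" unfolding q_def by (rule cf_den_ge_1[OF v(2)])
      have "\<not> cyl v \<subseteq> cball x r"
        using not_less_Least[of j "\<lambda>k. cyl (prefix_word \<omega> k) \<subseteq> cball x r"] Suc by (simp add: k_def v_def)
      then obtain z where z: "z \<in> cyl v" "r < \<bar>x - z\<bar>" by (force simp: dist_real_def)
      have "\<bar>x - z\<bar> \<le> 1 / q\<^sup>2" unfolding q_def by (rule cyl_dist_le[OF v(2,3) z(1)])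
      then have "r * q\<^sup>2 \<le> 1" using z q by (simp add: pos_le_divide_eq[symmetric])
      \<comment> \<open>The map \<open>cf_map v\<close> contracts by at least \<open>q^2\<close>, so
        nonnegative points within \<open>l\<close> of the preimage of \<open>x\<close> land in the
        ball. Minimality of \<open>k\<close> gives \<open>l \<le> 1\<close>.\<close>
      define l where "l = q\<^sup>2 * r"
      have l: "l \<le> 1" "0 < l" using \<open>r * q\<^sup>2 \<le> 1\<close> q r by (auto simp: l_def mult.commute)
      have "ennreal (\<kappa> * r powr \<delta>) \<le> mass \<delta> {w \<in> words I n. cyl w \<subseteq> cball x r}" if n: "k \<le> n" for n
      proof -
        define m where "m = n - k"
        have nm: "n = j + (1 + m)" using n Suc by (simp add: m_def)
        show ?thesis
        \<comment> \<open>If this fails, the cylinder of \<open>v @ [a]\<close>, which lies in the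
          ball, has length comparable to \<open>r\<close>.\<close>
        proof (cases "8 \<le> (real a)\<^sup>2 * l")
          case False
          have "(@) (v @ [a]) ` words I m \<subseteq> {w \<in> words I n. cyl w \<subseteq> cball x r}"
          proof clarify
            fix w
            assume w: "w \<in> words I m"
            have "cyl ((v @ [a]) @ w) \<subseteq> cyl (v @ [a])" by (rule cyl_append_subset[OF wordsD[OF w]])
            then show "(v @ [a]) @ w \<in> words I n \<and> cyl ((v @ [a]) @ w) \<subseteq> cball x r"
              using k v a w nm unfolding va by (auto simp: words_def)
          qed
          then have 1: "mass \<delta> ((@) (v @ [a]) ` words I m) \<le> mass \<delta> {w \<in> words I n. cyl w \<subseteq> cball x r}"
            by (rule mass_mono)
          have 2: "ennreal (wt \<delta> (v @ [a]) / 4) * mass \<delta> (words I m) \<le> mass \<delta> ((@) (v @ [a]) ` words I m)"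
            using pos[of k] wordsD unfolding va by (intro mass_append_ge) auto
          have 3: "ennreal (wt \<delta> (v @ [a]) / 4) * 1 \<le> ennreal (wt \<delta> (v @ [a]) / 4) * mass \<delta> (words I m)"
            by (intro mult_left_mono mass_words_ge) auto
          have "\<kappa> * r powr \<delta> \<le> wt \<delta> (v @ [a]) / 4"
          proof -
            let ?q = "cf_den (v @ [a]) 0"
            have pos': "0 \<notin> set (v @ [a])" using pos[of k] unfolding va .
            have q1: "1 \<le> ?q" by (rule cf_den_ge_1[OF pos'])
            have "?q \<le> 2 * q * real a" using cf_den_append_le[OF v(2), of "[a]"] a by (simp add: q_def)
            then have "?q\<^sup>2 * r \<le> (2 * q * real a)\<^sup>2 * r" using q1 r by (intro mult_right_mono power_mono) auto
            also have "\<dots> = 4 * ((real a)\<^sup>2 * l)" by (simp add: l_def power_mult_distrib mult_ac)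
            also have "\<dots> \<le> 32" using False by (simp add: mult.commute)
            finally have "?q\<^sup>2 * (r / 32) \<le> 1" by simp
            then have "(?q\<^sup>2 * (r / 32)) powr \<delta> \<le> 1" using r \<delta>_pos by (intro powr_le1) auto
            then have "wt \<delta> (v @ [a]) * (?q\<^sup>2 * (r / 32)) powr \<delta> \<le> wt \<delta> (v @ [a]) * 1"
              by (intro mult_left_mono) auto
            then have 1: "(r / 32) powr \<delta> \<le> wt \<delta> (v @ [a])"
              using wt_mult_powr[OF pos', of "r / 32"] r by simp
            have "r powr \<delta> \<le> 32 * (r / 32) powr \<delta>" using powr_scale[of 32 "r / 32"] r by simp
            then have "r powr \<delta> / 128 \<le> wt \<delta> (v @ [a]) / 4" using 1 by simp
            moreover have "\<kappa> * r powr \<delta> \<le> 1 / 128 * r powr \<delta>" by (intro mult_right_mono) (auto simp: \<kappa>_def)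
            ultimately show ?thesis by simp
          qed
          then have "ennreal (\<kappa> * r powr \<delta>) \<le> ennreal (wt \<delta> (v @ [a]) / 4) * 1" by (simp add: ennreal_leI)
          also note 3
          also note 2
          also note 1
          finally show ?thesis .
        next
          case True
          obtain y where y: "y \<in> cyl [a]" "x = cf_map v y"
            using \<omega>(2)[of k] unfolding va cyl_append by blast
          then obtain s where s: "0 \<le> s" "s \<le> 1" "y = 1 / (real a + s)" by (auto simp: cyl_def)
          have y1: "1 / (real a + 1) \<le> y" "y \<le> 1 / real a"
            unfolding s(3) using a s by (auto intro!: divide_left_mono)
          have y0: "0 \<le> y" using y1 a by (auto intro: order_trans[rotated])
          define B where "B = {b \<in> I. 1 / real b \<le> y + l \<and> y - l \<le> 1 / (real b + 1)}"
          have massB: "ennreal (\<kappa>2 * l powr \<delta>) \<le> mass \<delta> (words B 1)"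
            unfolding B_def by (rule \<kappa>2(2)[OF a(1) y1 True l(1)])
          let ?W = "concat_words (words B 1) (words I m)"
          have Wpos: "0 \<notin> set w" if "w \<in> ?W" for w
            using that wordsD I_pos by (auto simp: concat_words_def words_def B_def)
          have "(@) v ` ?W \<subseteq> {w \<in> words I n. cyl w \<subseteq> cball x r}"
          proof clarify
            fix w
            assume w: "w \<in> ?W"
            then obtain b u where b: "w = b # u" "b \<in> B" "u \<in> words I m"
              by (auto simp: concat_words_def words_1[unfolded One_nat_def])
            have b1: "1 \<le> real b" using b letter_pos by (auto simp: B_def)
            have "z \<in> cball x r" if z: "z \<in> cyl (v @ w)" for z
            proof -
              obtain t where t: "t \<in> cyl w" "z = cf_map v t" using z unfolding cyl_append by blast
              obtain s' where s': "s' \<in> cyl u" "t = 1 / (real b + s')" using t b by (auto simp: cyl_Cons)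
              have s'1: "0 \<le> s'" "s' \<le> 1" using s'(1) cyl_subset_unit[OF wordsD[OF b(3)]] by auto
              have "1 / (real b + 1) \<le> t" "t \<le> 1 / real b"
                unfolding s'(2) using b1 s'1 by (auto intro!: divide_left_mono)
              then have "\<bar>y - t\<bar> \<le> l" using b(2) by (auto simp: B_def)
              have t0: "0 \<le> t" using s'1 b1 unfolding s'(2) by auto
              have "\<bar>x - z\<bar> \<le> \<bar>y - t\<bar> / q\<^sup>2"
                unfolding y(2) t(2) q_def by (rule cf_map_diff_le[OF v(2) y0 t0])
              also have "\<dots> \<le> l / q\<^sup>2" using \<open>\<bar>y - t\<bar> \<le> l\<close> by (intro divide_right_mono) auto
              also have "\<dots> = r" using q by (simp add: l_def)
              finally show ?thesis by (simp add: dist_real_def)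
            qed
            moreover have "v @ w \<in> words I n" using v b nm by (auto simp: words_def B_def)
            ultimately show "v @ w \<in> words I n \<and> cyl (v @ w) \<subseteq> cball x r" by blast
          qed
          then have 1: "mass \<delta> ((@) v ` ?W) \<le> mass \<delta> {w \<in> words I n. cyl w \<subseteq> cball x r}"
            by (rule mass_mono)
          have "ennreal (\<kappa>2 * l powr \<delta>) \<le> mass \<delta> (words B 1) * mass \<delta> (words I m)"
            using mult_mono[OF massB mass_words_ge[of m]] by simp
          also have "\<dots> \<le> 4 * mass \<delta> ?W"
            using wordsD I_pos by (intro mass_concat_ge[of _ 1]) (auto simp: words_def B_def)
          finally have 2: "ennreal (\<kappa>2 * l powr \<delta>) \<le> 4 * mass \<delta> ?W" .
          have "ennreal (\<kappa> * r powr \<delta>) \<le> ennreal (wt \<delta> v / 16 * (\<kappa>2 * l powr \<delta>))"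
          proof (rule ennreal_leI)
            have eq: "wt \<delta> v * l powr \<delta> = r powr \<delta>"
              unfolding l_def q_def by (rule wt_mult_powr[OF v(2) r(1)])
            have "wt \<delta> v / 16 * (\<kappa>2 * l powr \<delta>) = \<kappa>2 / 16 * (wt \<delta> v * l powr \<delta>)" by simp
            then have "wt \<delta> v / 16 * (\<kappa>2 * l powr \<delta>) = \<kappa>2 / 16 * r powr \<delta>" unfolding eq .
            moreover have "\<kappa> * r powr \<delta> \<le> \<kappa>2 / 16 * r powr \<delta>"
              by (intro mult_right_mono) (auto simp: \<kappa>_def)
            ultimately show "\<kappa> * r powr \<delta> \<le> wt \<delta> v / 16 * (\<kappa>2 * l powr \<delta>)" by linarith
          qed
          also have "\<dots> = ennreal (wt \<delta> v / 16) * ennreal (\<kappa>2 * l powr \<delta>)"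
            by (rule ennreal_mult) (use \<kappa>2(1) in auto)
          also have "\<dots> \<le> ennreal (wt \<delta> v / 16) * (4 * mass \<delta> ?W)"
            using 2 by (intro mult_left_mono) auto
          also have "\<dots> = ennreal (wt \<delta> v / 4) * mass \<delta> ?W"
            using ennreal_times_4[of "wt \<delta> v / 16"] by (simp add: mult.assoc[symmetric])
          also have "\<dots> \<le> mass \<delta> ((@) v ` ?W)"
            by (rule mass_append_ge[OF v(2) Wpos])
          also note 1
          finally show ?thesis .
        qed
      qed
      then show ?thesis by blast
    qed
  qed
  moreover have "0 < \<kappa>" using \<kappa>2(1) by (simp add: \<kappa>_def)
  ultimately show ?thesis by blast
qed

theorem hausdorff_dim_and_ahlfors_regular:
  "hausdorff_dim J = ereal \<delta> \<and> ahlfors_regular \<delta> (hausdorff_measure_on \<delta> J)"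
proof -
  let ?H = "hausdorff_outer_measure \<delta>"
  obtain \<kappa> where \<kappa>: "0 < \<kappa>" "\<And>x r. x \<in> J \<Longrightarrow> 0 < r \<Longrightarrow> r \<le> 1 \<Longrightarrow>
     \<exists>N. \<forall>n\<ge>N. ennreal (\<kappa> * r powr \<delta>) \<le> mass \<delta> {w \<in> words I n. cyl w \<subseteq> cball x r}"
    using mass_ball_ge by blast
  have ge: "ennreal (\<kappa> * r powr \<delta> / (4 * K)) \<le> ?H (J \<inter> cball x r)"
    if "x \<in> J" "0 < r" "r \<le> 1" for x r
    using \<kappa>(2)[OF that] hausdorff_ge[OF compact_cball] by blast
  obtain x0 where x0: "x0 \<in> J"
    using cf_set_meets_cyl[of "[]" I] I_pos I_nonempty by auto
  have pos: "0 < ?H J"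
  proof -
    have "0 < ennreal (\<kappa> * 1 powr \<delta> / (4 * K))" using \<kappa>(1) K_pos by simp
    also have "\<dots> \<le> ?H (J \<inter> cball x0 1)" using x0 by (intro ge) auto
    also have "\<dots> \<le> ?H J" by (intro hausdorff_outer_measure_mono) auto
    finally show ?thesis .
  qed
  have fin: "?H J < \<infinity>"
  proof -
    have "?H J \<le> ?H (J \<inter> {0 - 1..0 + 1})"
      using cf_set_subset_unit by (intro hausdorff_outer_measure_mono) force
    also have "\<dots> \<le> ennreal (4 * K * 1 powr \<delta>)" by (intro hausdorff_interval_le) auto
    also have "\<dots> < \<infinity>" by simp
    finally show ?thesis .
  qed
  have em: "emeasure (hausdorff_measure_on \<delta> J) B = ?H (B \<inter> J)" if "B \<in> sets borel" for B
  proof (rule emeasure_hausdorff_measure_on[OF _ that])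
    fix t \<eta> :: real
    assume \<eta>: "0 < \<eta>"
    define e where "e = (\<eta> / (4 * K)) powr (1 / \<delta>)"
    have "0 < e" "4 * K * e powr \<delta> = \<eta>"
      using \<eta> K_pos \<delta>_pos by (auto simp: e_def powr_powr)
    then show "\<exists>e>0. ?H (J \<inter> {t - e..t + e}) \<le> ennreal \<eta>"
      using hausdorff_interval_le[of e t] by auto
  qed
  have upper_ball: "emeasure (hausdorff_measure_on \<delta> J) (ball x r) \<le> ennreal (4 * K * r powr \<delta>)"
    if "0 < r" for x r
  proof -
    have "?H (ball x r \<inter> J) \<le> ?H (J \<inter> {x - r..x + r})"
      by (intro hausdorff_outer_measure_mono) (auto simp: dist_real_def)
    then show ?thesis using hausdorff_interval_le[OF that, of x] em[of "ball x r"] by auto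
  qed
  have supp: "x \<in> closure J" if "x \<in> measure_support (hausdorff_measure_on \<delta> J)" for x
  proof (rule ccontr)
    assume "x \<notin> closure J"
    then have "0 < emeasure (hausdorff_measure_on \<delta> J) (- closure J)"
      using that unfolding measure_support_def by blast
    also have "\<dots> = ?H (- closure J \<inter> J)" by (rule em) auto
    also have "- closure J \<inter> J = {}" using closure_subset by blast
    finally show False by simp
  qed
  \<comment> \<open>The support lies in the closure of \<open>J\<close>, while \<open>ge\<close>
    speaks of centers in \<open>J\<close>. Moving the center by less than \<open>r / 2\<close> and
    using the radius \<open>r / 3\<close> costs a factor 3.\<close>
  have lower_ball: "ennreal (\<kappa> / (12 * K) * r powr \<delta>) \<le> emeasure (hausdorff_measure_on \<delta> J) (ball x r)"
    if x: "x \<in> closure J" and r: "0 < r" "r \<le> 1" for x r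
  proof -
    obtain y where y: "y \<in> J" "dist y x < r / 2"
      using x r closure_approachable[of x J] by (meson half_gt_zero)
    have "r powr \<delta> \<le> 3 * (r / 3) powr \<delta>" using powr_scale[of 3 "r / 3"] r by simp
    then have "\<kappa> / (12 * K) * r powr \<delta> \<le> \<kappa> / (12 * K) * (3 * (r / 3) powr \<delta>)"
      using \<kappa>(1) K_pos by (intro mult_left_mono) auto
    also have "\<dots> = \<kappa> * (r / 3) powr \<delta> / (4 * K)" by simp
    finally have "ennreal (\<kappa> / (12 * K) * r powr \<delta>) \<le> ennreal (\<kappa> * (r / 3) powr \<delta> / (4 * K))"
      by (rule ennreal_leI)
    also have "\<dots> \<le> ?H (J \<inter> cball y (r / 3))" using y r by (intro ge) auto
    also have "\<dots> \<le> ?H (ball x r \<inter> J)"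
    proof (rule hausdorff_outer_measure_mono)
      have "z \<in> ball x r" if "z \<in> cball y (r / 3)" for z
        using that y(2) r dist_triangle[of x z y] by (simp add: dist_commute)
      then show "J \<inter> cball y (r / 3) \<subseteq> ball x r \<inter> J" by blast
    qed
    also have "\<dots> = emeasure (hausdorff_measure_on \<delta> J) (ball x r)" by (rule em[symmetric]) auto
    finally show ?thesis .
  qed
  have sets: "sets (hausdorff_measure_on \<delta> J) = sets borel"
    and space: "space (hausdorff_measure_on \<delta> J) = UNIV"
    using sets.sigma_sets_eq[of "borel :: real measure"]
    by (auto simp: hausdorff_measure_on_def sets_measure_of_conv space_measure_of_conv)
  have "ahlfors_regular \<delta> (hausdorff_measure_on \<delta> J)"
    unfolding ahlfors_regular_def
  proof (intro conjI)
    show "sets (hausdorff_measure_on \<delta> J) = sets borel" by (rule sets)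
    show "emeasure (hausdorff_measure_on \<delta> J) (space (hausdorff_measure_on \<delta> J)) \<noteq> 0"
      using pos by (simp add: space em)
    show "locally_finite_measure (hausdorff_measure_on \<delta> J)"
      unfolding locally_finite_measure_def
    proof
      fix x
      have "emeasure (hausdorff_measure_on \<delta> J) (ball x 1) < \<infinity>"
        using upper_ball[of 1 x] by (simp add: le_less_trans)
      then show "\<exists>U. open U \<and> x \<in> U \<and> emeasure (hausdorff_measure_on \<delta> J) U < \<infinity>"
        by (intro exI[of _ "ball x 1"]) auto
    qed
    show "\<exists>C1 C2. 0 < C1 \<and> 0 < C2 \<and> (\<forall>x\<in>measure_support (hausdorff_measure_on \<delta> J). \<forall>r.
        0 < r \<and> r \<le> 1 \<longrightarrow> ennreal (C1 * r powr \<delta>) \<le> emeasure (hausdorff_measure_on \<delta> J) (ball x r) \<and>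
        emeasure (hausdorff_measure_on \<delta> J) (ball x r) \<le> ennreal (C2 * r powr \<delta>))"
      using \<kappa>(1) K_pos lower_ball upper_ball supp
      by (intro exI[of _ "\<kappa> / (12 * K)"] exI[of _ "4 * K"]) auto
  qed
  then show ?thesis
    using hausdorff_dim_eqI[of \<delta> J] \<delta>_pos pos fin by simp
qed

end

subsection \<open>Subcritical alphabets\<close>

context cf_exponent
begin

lemma mass_words_mult_le:
  assumes "0 \<notin> X"
  shows "mass \<delta> (words X (n * k)) \<le> mass \<delta> (words X n) ^ k"
proof (induction k)
  case (Suc k)
  have "mass \<delta> (words X (n + n * k)) \<le> mass \<delta> (words X n) * mass \<delta> (words X (n * k))"
    by (rule mass_words_add_le[OF assms])
  also have "\<dots> \<le> mass \<delta> (words X n) * mass \<delta> (words X n) ^ k"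
    using Suc.IH by (intro mult_left_mono) auto
  finally show ?case by simp
qed (simp add: mass_finite)

lemma mass_words_mult_ge:
  assumes "0 \<notin> X"
  shows "mass \<delta> (words X n) ^ k \<le> 4 ^ k * mass \<delta> (words X (n * k))"
proof (induction k)
  case (Suc k)
  have "mass \<delta> (words X n) * mass \<delta> (words X n) ^ k
      \<le> mass \<delta> (words X n) * (4 ^ k * mass \<delta> (words X (n * k)))"
    using Suc.IH by (intro mult_left_mono) auto
  also have "\<dots> = 4 ^ k * (mass \<delta> (words X n) * mass \<delta> (words X (n * k)))"
    by (simp add: mult_ac)
  also have "\<dots> \<le> 4 ^ k * (4 * mass \<delta> (words X (n + n * k)))"
    by (intro mult_left_mono mass_words_add_ge[OF assms]) auto
  finally show ?case by (simp add: mult_ac)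
qed (simp add: mass_finite)

text \<open>If level \<open>m\<close> exceeded 4, level \<open>n m\<close> would be at least the
  \<open>n\<close>-th power of a number above 1, but it is at most the \<open>m\<close>-th power of
  a number below 1. So no alphabet has both a level below 1 and a level above 4; excluding one of
  them is how criticality is proved.\<close>

lemma mass_words_le_4:
  assumes X: "0 \<notin> X" and n: "mass \<delta> (words X n) < 1"
  shows "mass \<delta> (words X m) \<le> 4"
proof (rule ccontr)
  assume "\<not> ?thesis"
  then have m: "4 < mass \<delta> (words X m)" by simp
  have n0: "0 < n" using n by (cases n) (auto simp: mass_finite)
  have "mass \<delta> (words X m) ^ n \<le> 4 ^ n * mass \<delta> (words X (n * m))"
    using mass_words_mult_ge[OF X, of m n] by (simp add: mult.commute)
  also have "\<dots> \<le> 4 ^ n * mass \<delta> (words X n) ^ m"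
    by (intro mult_left_mono mass_words_mult_le[OF X]) auto
  also have "\<dots> \<le> 4 ^ n * 1"
    using n by (intro mult_left_mono power_le_one) auto
  finally have le: "mass \<delta> (words X m) ^ n \<le> 4 ^ n" by simp
  show False
  proof (cases "mass \<delta> (words X m)")
    case (real r)
    then have "4 < r" using m by (simp add: ennreal_less_iff flip: ennreal_numeral)
    then have "4 ^ n < r ^ n" using n0 by (intro power_strict_mono) auto
    moreover have "ennreal (r ^ n) \<le> ennreal (4 ^ n)"
      using le real by (simp add: ennreal_power flip: ennreal_numeral)
    ultimately show False using real by (simp add: ennreal_le_iff)
  next
    case top
    then have "mass \<delta> (words X m) ^ n = top" using n0 by (simp add: power_eq_top_ennreal)
    then have "4 ^ n = (top :: ennreal)" using le by (simp add: top_unique)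
    then show False by (simp add: power_eq_top_ennreal)
  qed
qed

text \<open>A new word starts with a letter of \<open>T\<close>, or it starts with a letter of
  \<open>X\<close> and has a new tail. Unrolled, this sums over the \<open>n\<close> positions of
  the first letter from \<open>T\<close>.\<close>

lemma mass_new_words_le:
  assumes X: "0 \<notin> X" and T: "0 \<notin> T" and b: "1 \<le> b" "mass \<delta> (words (X \<union> T) 1) \<le> b"
  shows "mass \<delta> (words (X \<union> T) n - words X n) \<le> of_nat n * b ^ n * mass \<delta> (words T 1)"
proof (induction n)
  case (Suc n)
  let ?Y = "X \<union> T"
  have Y: "0 \<notin> ?Y" using X T by auto
  have Zn: "mass \<delta> (words ?Y n) \<le> b ^ n"
    using mass_words_mult_le[OF Y, of 1 n] power_mono[OF b(2), of n] by (simp add: order_trans)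
  have "words ?Y (Suc n) - words X (Suc n)
      \<subseteq> concat_words (words T 1) (words ?Y n) \<union> concat_words (words X 1) (words ?Y n - words X n)"
  proof
    fix w
    assume w: "w \<in> words ?Y (Suc n) - words X (Suc n)"
    then obtain a v where v: "w = a # v" "a \<in> ?Y" "v \<in> words ?Y n"
      by (auto simp: words_def length_Suc_conv)
    show "w \<in> concat_words (words T 1) (words ?Y n) \<union> concat_words (words X 1) (words ?Y n - words X n)"
    proof (cases "a \<in> T")
      case True
      then show ?thesis using v by (auto intro!: Cons_in_concat_words simp: words_def)
    next
      case False
      then have "v \<notin> words X n" using w v by (auto simp: words_def)
      then have "w \<in> concat_words (words X 1) (words ?Y n - words X n)"
        unfolding v(1) using v False by (intro Cons_in_concat_words) (auto simp: words_def)
      then show ?thesis by blast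
    qed
  qed
  then have "mass \<delta> (words ?Y (Suc n) - words X (Suc n))
      \<le> mass \<delta> (concat_words (words T 1) (words ?Y n)) + mass \<delta> (concat_words (words X 1) (words ?Y n - words X n))"
    using mass_mono mass_Un_le order_trans by meson
  also have "\<dots> \<le> mass \<delta> (words T 1) * mass \<delta> (words ?Y n)
      + mass \<delta> (words X 1) * mass \<delta> (words ?Y n - words X n)"
    using words_pos[OF X] words_pos[OF T] words_pos[OF Y]
    by (intro add_mono mass_concat_le[of _ 1]) (auto simp: words_def)
  also have "\<dots> \<le> mass \<delta> (words T 1) * (b ^ n * b) + b * (of_nat n * b ^ n * mass \<delta> (words T 1))"
  proof (intro add_mono mult_mono)
    have "b ^ n * 1 \<le> b ^ n * b" using b(1) by (intro mult_left_mono) auto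
    then show "mass \<delta> (words ?Y n) \<le> b ^ n * b" using Zn by (simp add: order_trans)
    show "mass \<delta> (words X 1) \<le> b"
      using mass_mono[OF words_mono[of X ?Y 1], of \<delta>] b(2) by (auto intro: order_trans)
  qed (use Suc.IH in auto)
  also have "\<dots> = of_nat (Suc n) * b ^ Suc n * mass \<delta> (words T 1)"
    by (simp add: distrib_left distrib_right mult_ac)
  finally show ?case .
qed simp

text \<open>For fixed length the mass depends continuously on the total weight of the added letters,
  so subcriticality is an open condition.\<close>

lemma mass_words_perturb:
  assumes X: "0 \<notin> X" and n: "mass \<delta> (words X n) < 1" and fin: "mass \<delta> (words X 1) < top"
  shows "\<exists>\<epsilon>>0. \<forall>T. 0 \<notin> T \<longrightarrow> mass \<delta> (words T 1) \<le> ennreal \<epsilon> \<longrightarrow> mass \<delta> (words (X \<union> T) n) < 1"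
proof -
  obtain z where z: "mass \<delta> (words X n) = ennreal z" "0 \<le> z" "z < 1"
    using n by (cases "mass \<delta> (words X n)") (auto simp: ennreal_less_one_iff)
  obtain x where x: "mass \<delta> (words X 1) = ennreal x" "0 \<le> x"
    using fin by (cases "mass \<delta> (words X 1)") auto
  define b where "b = x + 1"
  have b: "1 \<le> b" using x by (simp add: b_def)
  \<comment> \<open>The bound 1 makes \<open>b\<close> an upper bound for the weight of the enlarged
    alphabet. The other entry makes \<open>n b^n \<epsilon>\<close> at most half of the room
    \<open>1 - z\<close>; \<open>n + 1\<close> keeps the denominator positive.\<close>
  define \<epsilon> where "\<epsilon> = min 1 ((1 - z) / (2 * (real n + 1) * b ^ n))"
  have \<epsilon>: "0 < \<epsilon>" using z b by (simp add: \<epsilon>_def)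
  have small: "z + real n * b ^ n * \<epsilon> < 1"
  proof -
    have bn: "0 < b ^ n" using b by simp
    have "real n * b ^ n * \<epsilon> \<le> real n * b ^ n * ((1 - z) / (2 * (real n + 1) * b ^ n))"
      using bn by (intro mult_left_mono) (auto simp: \<epsilon>_def)
    also have "\<dots> = (1 - z) * (real n / (2 * (real n + 1)))" using bn b by simp
    also have "\<dots> \<le> (1 - z) * (1 / 2)" using z by (intro mult_left_mono) (auto simp: field_simps)
    finally show ?thesis using z by simp
  qed
  have "mass \<delta> (words (X \<union> T) n) < 1" if T: "0 \<notin> T" "mass \<delta> (words T 1) \<le> ennreal \<epsilon>" for T
  proof -
    have "words (X \<union> T) 1 = words X 1 \<union> words T 1" unfolding words_1 by auto
    then have "mass \<delta> (words (X \<union> T) 1) \<le> mass \<delta> (words X 1) + mass \<delta> (words T 1)"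
      using mass_Un_le by metis
    also have "\<dots> \<le> ennreal x + ennreal 1"
      using x T(2) ennreal_leI[of \<epsilon> 1] by (intro add_mono) (auto simp: \<epsilon>_def intro: order_trans)
    finally have B: "mass \<delta> (words (X \<union> T) 1) \<le> ennreal b" using x by (simp add: b_def ennreal_plus)
    have "mass \<delta> (words (X \<union> T) n) \<le> mass \<delta> (words X n \<union> (words (X \<union> T) n - words X n))"
      by (intro mass_mono) auto
    also have "\<dots> \<le> mass \<delta> (words X n) + mass \<delta> (words (X \<union> T) n - words X n)"
      by (rule mass_Un_le)
    also have "\<dots> \<le> ennreal z + of_nat n * ennreal b ^ n * mass \<delta> (words T 1)"
      using mass_new_words_le[OF X T(1) _ B, of n] b z ennreal_leI[OF b] by (intro add_mono) auto
    also have "\<dots> \<le> ennreal z + of_nat n * ennreal b ^ n * ennreal \<epsilon>"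
      using T by (intro add_left_mono mult_left_mono) auto
    also have "\<dots> = ennreal (z + real n * b ^ n * \<epsilon>)"
      using z b \<epsilon> by (simp add: ennreal_plus ennreal_mult ennreal_power ennreal_of_nat_eq_real_of_nat)
    also have "\<dots> < ennreal 1" using small z b \<epsilon> by (intro ennreal_lessI) auto
    finally show ?thesis by simp
  qed
  then show ?thesis using \<epsilon> by blast
qed

subsection \<open>Replacing a letter by larger ones\<close>

text \<open>Enlarging one letter of a word from \<open>k\<close> to \<open>k'\<close> multiplies the continuant by at most
  \<open>k'/k\<close>, without any distortion constant.\<close>

lemma wt_replace_letter:
  assumes "0 \<notin> set v" "0 \<notin> set w" "0 < k" "k \<le> k'"
  shows "(real k' / real k) powr (- (2 * \<delta>)) * wt \<delta> ((v @ [k]) @ w) \<le> wt \<delta> ((v @ [k']) @ w)"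
proof -
  define y where "y = cf_map w 0"
  have y: "0 \<le> y" by (simp add: y_def cf_map_nonneg)
  have w: "1 \<le> cf_den w 0" by (rule cf_den_ge_1[OF assms(2)])
  have den: "cf_den ((v @ [a]) @ w) 0 = cf_den v (1 / (real a + y)) * ((real a + y) * cf_den w 0)" for a
    by (simp add: cf_den_append cf_map_append y_def)
  have k: "1 \<le> real k" "real k \<le> real k'" using assms by auto
  have d1: "cf_den v (1 / (real k' + y)) \<le> cf_den v (1 / (real k + y))"
    using k y by (intro cf_den_mono[OF assms(1)] divide_left_mono) auto
  have d0: "1 \<le> cf_den v (1 / (real k' + y))"
    using cf_den_mono[OF assms(1), of 0 "1 / (real k' + y)"] cf_den_ge_1[OF assms(1)] k y by simp
  have "real k * y \<le> real k' * y" using k y by (intro mult_right_mono) auto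
  then have "real k' + y \<le> real k' / real k * (real k + y)" using k by (simp add: field_simps)
  then have "cf_den v (1 / (real k' + y)) * ((real k' + y) * cf_den w 0)
      \<le> cf_den v (1 / (real k + y)) * ((real k' / real k * (real k + y)) * cf_den w 0)"
    using d1 d0 w k y by (intro mult_mono) auto
  then have le: "cf_den ((v @ [k']) @ w) 0 \<le> real k' / real k * cf_den ((v @ [k]) @ w) 0"
    unfolding den by (simp add: mult_ac)
  have "1 \<le> cf_den ((v @ [k']) @ w) 0" using assms by (intro cf_den_ge_1) auto
  then have "(real k' / real k * cf_den ((v @ [k]) @ w) 0) powr (- (2 * \<delta>)) \<le> wt \<delta> ((v @ [k']) @ w)"
    unfolding wt_def using le \<delta>_pos by (intro powr_mono2') auto
  moreover have "(real k' / real k * cf_den ((v @ [k]) @ w) 0) powr (- (2 * \<delta>))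
      = (real k' / real k) powr (- (2 * \<delta>)) * wt \<delta> ((v @ [k]) @ w)"
    unfolding wt_def by (rule powr_mult)
  ultimately show ?thesis by simp
qed

text \<open>Changing \<open>k\<close> into \<open>k'\<close> keeps at least the fraction
  \<open>(k' / k)^(-2 \<delta>)\<close> of the mass. These fractions sum to at least 1 over
  \<open>B\<close>, because \<open>B\<close> outweighs \<open>k\<close>.\<close>

lemma mass_replace_letter:
  assumes "0 \<notin> set v" "\<And>w. w \<in> W \<Longrightarrow> 0 \<notin> set w" "0 < k" "\<And>k'. k' \<in> B \<Longrightarrow> k \<le> k'"
    and B: "ennreal (real k powr (- (2 * \<delta>))) \<le> mass \<delta> (words B 1)"
  shows "mass \<delta> ((@) (v @ [k]) ` W) \<le> mass \<delta> (\<Union>k'\<in>B. (@) (v @ [k']) ` W)"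
proof -
  let ?m = "mass \<delta> ((@) (v @ [k]) ` W)"
  have img: "mass \<delta> ((@) u ` W) = (\<integral>\<^sup>+ w. ennreal (wt \<delta> (u @ w)) \<partial>count_space W)" for u
    using nn_integral_bij_count_space[OF inj_on_imp_bij_betw[of "(@) u" W], of "\<lambda>w. ennreal (wt \<delta> w)"]
    by (simp add: mass_eq_nn_integral inj_on_def)
  have one: "ennreal ((real k' / real k) powr (- (2 * \<delta>))) * ?m \<le> mass \<delta> ((@) (v @ [k']) ` W)"
    if "k' \<in> B" for k'
  proof -
    have "ennreal ((real k' / real k) powr (- (2 * \<delta>))) * ?m
        = (\<integral>\<^sup>+ w. ennreal ((real k' / real k) powr (- (2 * \<delta>))) * ennreal (wt \<delta> ((v @ [k]) @ w)) \<partial>count_space W)"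
      unfolding img by (rule nn_integral_cmult[symmetric]) auto
    also have "\<dots> \<le> (\<integral>\<^sup>+ w. ennreal (wt \<delta> ((v @ [k']) @ w)) \<partial>count_space W)"
    proof (rule nn_integral_mono)
      fix w
      assume "w \<in> space (count_space W)"
      then have "(real k' / real k) powr (- (2 * \<delta>)) * wt \<delta> ((v @ [k]) @ w) \<le> wt \<delta> ((v @ [k']) @ w)"
        using assms that by (intro wt_replace_letter) auto
      then show "ennreal ((real k' / real k) powr (- (2 * \<delta>))) * ennreal (wt \<delta> ((v @ [k]) @ w))
          \<le> ennreal (wt \<delta> ((v @ [k']) @ w))"
        by (subst ennreal_mult[symmetric]) (auto intro: ennreal_leI)
    qed
    finally show ?thesis unfolding img .
  qed
  have k: "0 < real k" using assms(3) by simp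
  have "?m = ennreal (real k powr (2 * \<delta>)) * ennreal (real k powr (- (2 * \<delta>))) * ?m"
    using k by (simp add: ennreal_mult[symmetric] powr_add[symmetric])
  also have "\<dots> \<le> ennreal (real k powr (2 * \<delta>)) * mass \<delta> (words B 1) * ?m"
    using B by (intro mult_right_mono mult_left_mono) auto
  also have "mass \<delta> (words B 1) = (\<integral>\<^sup>+ k'. ennreal (real k' powr (- (2 * \<delta>))) \<partial>count_space B)"
    using nn_integral_bij_count_space[of "\<lambda>a. [a]" B "words B 1" "\<lambda>w. ennreal (wt \<delta> w)"]
    by (simp add: mass_eq_nn_integral words_1[unfolded One_nat_def] bij_betw_def inj_on_def wt_single)
  also have "ennreal (real k powr (2 * \<delta>)) * (\<integral>\<^sup>+ k'. ennreal (real k' powr (- (2 * \<delta>))) \<partial>count_space B) * ?m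
      = (\<integral>\<^sup>+ k'. ennreal (real k powr (2 * \<delta>)) * ennreal (real k' powr (- (2 * \<delta>))) * ?m \<partial>count_space B)"
    by (simp add: nn_integral_cmult nn_integral_multc)
  also have "\<dots> = (\<integral>\<^sup>+ k'. ennreal ((real k' / real k) powr (- (2 * \<delta>))) * ?m \<partial>count_space B)"
    using k by (intro nn_integral_cong)
      (simp add: ennreal_mult[symmetric] powr_divide powr_minus_divide)
  also have "\<dots> \<le> (\<integral>\<^sup>+ k'. mass \<delta> ((@) (v @ [k']) ` W) \<partial>count_space B)"
    using one by (intro nn_integral_mono) auto
  also have "\<dots> = mass \<delta> (\<Union>k'\<in>B. (@) (v @ [k']) ` W)"
    by (rule mass_UN_disjoint[symmetric]) (auto simp: disjoint_family_on_def)
  finally show ?thesis .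
qed

lemma append_words_Suc: "(@) v ` words X (Suc n) = (\<Union>a\<in>X. (@) (v @ [a]) ` words X n)"
proof
  show "(@) v ` words X (Suc n) \<subseteq> (\<Union>a\<in>X. (@) (v @ [a]) ` words X n)"
  proof clarify
    fix w
    assume "w \<in> words X (Suc n)"
    then obtain a u where "w = a # u" "a \<in> X" "u \<in> words X n"
      by (auto simp: words_def length_Suc_conv)
    moreover from this have "v @ w = (v @ [a]) @ u" by simp
    ultimately show "v @ w \<in> (\<Union>a\<in>X. (@) (v @ [a]) ` words X n)" by blast
  qed
qed (auto simp: words_def)

text \<open>Induction with a fixed prefix \<open>v\<close>: behind an occurrence of \<open>k\<close>
  the tail is treated first, then the letter itself. No step loses a constant, so the comparison
  holds at every level; disjointness of \<open>B\<close> and \<open>Y\<close> lets the resulting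
  masses add up.\<close>

lemma mass_words_replace:
  assumes Y: "0 \<notin> Y" and k: "0 < k" and B: "B \<inter> Y = {}" "\<And>k'. k' \<in> B \<Longrightarrow> k \<le> k'"
    and le: "ennreal (real k powr (- (2 * \<delta>))) \<le> mass \<delta> (words B 1)"
  shows "mass \<delta> (words (insert k Y) n) \<le> mass \<delta> (words (Y \<union> B) n)"
proof -
  have YB: "0 \<notin> Y \<union> B" using Y k B(2) by fastforce
  have "mass \<delta> ((@) v ` words (insert k Y) n) \<le> mass \<delta> ((@) v ` words (Y \<union> B) n)"
    if "0 \<notin> set v" for v
    using that
  proof (induction n arbitrary: v)
    case (Suc n)
    let ?A = "\<lambda>a. (@) (v @ [a]) ` words (insert k Y) n" and ?C = "\<lambda>a. (@) (v @ [a]) ` words (Y \<union> B) n"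
    have disj: "disjoint_family_on ?A X" "disjoint_family_on ?C X" for X
      by (auto simp: disjoint_family_on_def)
    have pos: "0 \<notin> set (v @ [a])" if "a \<in> insert k Y" for a using Suc.prems that Y k by (auto intro: gr0I)
    have IH: "mass \<delta> (?A a) \<le> mass \<delta> (?C a)" if "a \<in> insert k Y" for a
      by (rule Suc.IH[OF pos[OF that]])
    have "mass \<delta> ((@) v ` words (insert k Y) (Suc n)) \<le> mass \<delta> ((\<Union>a\<in>Y. ?A a) \<union> ?A k)"
      unfolding append_words_Suc by (rule mass_mono) auto
    also have "\<dots> \<le> mass \<delta> (\<Union>a\<in>Y. ?A a) + mass \<delta> (?A k)"
      by (rule mass_Un_le)
    also have "\<dots> \<le> mass \<delta> (\<Union>a\<in>Y. ?C a) + mass \<delta> (\<Union>a\<in>B. ?C a)"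
    proof (rule add_mono)
      show "mass \<delta> (\<Union>a\<in>Y. ?A a) \<le> mass \<delta> (\<Union>a\<in>Y. ?C a)"
        unfolding mass_UN_disjoint[OF countableI_type disj(1)] mass_UN_disjoint[OF countableI_type disj(2)]
        by (intro nn_integral_mono IH) auto
      have "mass \<delta> (?C k) \<le> mass \<delta> (\<Union>a\<in>B. ?C a)"
        using Suc.prems k B(2) le words_pos[OF YB] by (intro mass_replace_letter) auto
      then show "mass \<delta> (?A k) \<le> mass \<delta> (\<Union>a\<in>B. ?C a)" using IH[of k] by (auto intro: order_trans)
    qed
    also have "\<dots> = mass \<delta> ((\<Union>a\<in>Y. ?C a) \<union> (\<Union>a\<in>B. ?C a))"
      unfolding mass_def using B(1) by (intro plus_emeasure) auto
    also have "(\<Union>a\<in>Y. ?C a) \<union> (\<Union>a\<in>B. ?C a) = (@) v ` words (Y \<union> B) (Suc n)"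
      unfolding append_words_Suc by auto
    finally show ?case .
  qed simp
  from this[of "[]"] show ?thesis by simp
qed

subsection \<open>Greedy selection of a critical alphabet\<close>

lemma upper_regular_mass_finite:
  assumes "upper_regular \<delta> C X" "0 \<notin> X"
  shows "mass \<delta> (words X 1) < top"
proof -
  have "{b \<in> X. 1 \<le> real b} = X" using assms(2) by (auto simp: Suc_le_eq intro: gr0I)
  then show ?thesis
    using mass_tail_le[OF assms(1), of 1] by (simp add: le_less_trans[OF _ ennreal_less_top])
qed

lemma upper_regular_mass_tail_small:
  assumes U: "0 < C" and \<epsilon>: "0 < \<epsilon>"
  shows "\<exists>N\<ge>1. \<forall>m\<ge>N. \<forall>X. upper_regular \<delta> C X \<longrightarrow> (\<forall>b\<in>X. m \<le> real b) \<longrightarrow> mass \<delta> (words X 1) \<le> ennreal \<epsilon>"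
proof -
  define N where "N = max 1 ((tail_const C / \<epsilon>) powr (1 / \<delta>))"
  have "mass \<delta> (words X 1) \<le> ennreal \<epsilon>"
    if m: "N \<le> m" and X: "upper_regular \<delta> C X" "\<forall>b\<in>X. m \<le> real b" for m X
  proof -
    have m1: "1 \<le> m" using m by (simp add: N_def)
    have "tail_const C / \<epsilon> = ((tail_const C / \<epsilon>) powr (1 / \<delta>)) powr \<delta>"
      using tail_const_pos[OF U] \<epsilon> \<delta>_pos by (simp add: powr_powr)
    also have "\<dots> \<le> m powr \<delta>" using m \<delta>_pos by (intro powr_mono2) (auto simp: N_def)
    finally have "tail_const C * m powr (- \<delta>) \<le> \<epsilon>"
      using m1 \<epsilon> by (simp add: powr_minus field_simps)
    moreover have "{b \<in> X. m \<le> real b} = X" using X(2) by auto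
    ultimately show ?thesis
      using mass_tail_le[OF X(1) m1] ennreal_leI order_trans by metis
  qed
  then show ?thesis by (intro exI[of _ N]) (auto simp: N_def)
qed

lemma upper_regular_subset:
  assumes "upper_regular \<delta> C X" "Y \<subseteq> X"
  shows "upper_regular \<delta> C Y"
  unfolding upper_regular_def
proof (intro conjI allI impI)
  show "0 < C" using assms by (simp add: upper_regular_def)
  fix a R :: real
  assume R: "1 \<le> R"
  have "finite {b \<in> X. a \<le> real b \<and> real b \<le> a + R}"
    using finite_nat_real_le[of "\<lambda>b. b \<in> X \<and> a \<le> real b" "a + R"] by (simp add: conj_ac)
  then have "card {b \<in> Y. a \<le> real b \<and> real b \<le> a + R} \<le> card {b \<in> X. a \<le> real b \<and> real b \<le> a + R}"
    by (rule card_mono) (use assms(2) in auto)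
  then show "real (card {b \<in> Y. a \<le> real b \<and> real b \<le> a + R}) \<le> C * R powr \<delta>"
    using assms(1) R unfolding upper_regular_def by (meson of_nat_le_iff order_trans)
qed

text \<open>Stage \<open>k\<close> has decided on the letters below \<open>k\<close> only, so
  \<open>k\<close> is tested together with the base and the smaller accepted letters.\<close>

primrec greedy :: "nat set \<Rightarrow> nat set \<Rightarrow> nat \<Rightarrow> nat set" where
  "greedy Y S 0 = {}"
| "greedy Y S (Suc k) = (if k \<in> S \<and> (\<forall>n. mass \<delta> (words (Y \<union> insert k (greedy Y S k)) n) \<le> 4)
     then insert k (greedy Y S k) else greedy Y S k)"

lemma greedy_subset: "greedy Y S k \<subseteq> S \<inter> {..<k}"
  by (induction k) (auto split: if_splits)

lemma greedy_mono: "j \<le> k \<Longrightarrow> greedy Y S j \<subseteq> greedy Y S k"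
  by (rule lift_Suc_mono_le[of "greedy Y S"]) auto

text \<open>Suppose the result \<open>Y \<union> G\<close> is subcritical. Then all large elements of \<open>S\<close> were accepted. The
  last rejected letter \<open>k\<close> was rejected because it would have made the alphabet critical; but the
  accepted letters beyond \<open>k\<close> outweigh \<open>k\<close>.\<close>

lemma critical_alphabet_exists:
  assumes Y: "0 \<notin> Y" and S: "0 \<notin> S" "Y \<inter> S = {}" and U: "upper_regular \<delta> C (Y \<union> S)"
    and sub: "mass \<delta> (words Y n0) < 1"
    and crit: "\<And>n. 1 \<le> mass \<delta> (words (Y \<union> S) n)"
    and tail: "\<And>k. k \<in> S \<Longrightarrow> ennreal (real k powr (- (2 * \<delta>))) \<le> mass \<delta> (words {k' \<in> S. k < k'} 1)"
  shows "\<exists>G\<subseteq>S. \<forall>n. mass \<delta> (words (Y \<union> G) n) \<le> 4 \<and> 1 \<le> mass \<delta> (words (Y \<union> G) n)"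
proof -
  let ?g = "greedy Y S"
  define G where "G = (\<Union>k. ?g k)"
  have GS: "G \<subseteq> S" using greedy_subset by (fastforce simp: G_def)
  have YS: "0 \<notin> Y \<union> S" using Y S by auto
  have good_mono: "mass \<delta> (words A n) \<le> 4" if "A \<subseteq> A'" "mass \<delta> (words A' n) \<le> 4" for A A' n
    using mass_mono[OF words_mono[OF that(1)]] that(2) order_trans by blast
  have good_g: "mass \<delta> (words (Y \<union> ?g k) n) \<le> 4" for k n
    by (induction k) (use mass_words_le_4[OF Y sub] in auto)
  \<comment> \<open>Each word has finitely many letters and thus occurs at a finite stage;
    continuity from below carries the bound over.\<close>
  have good_G: "mass \<delta> (words (Y \<union> G) n) \<le> 4" for n
  proof -
    have mono: "incseq (\<lambda>k. words (Y \<union> ?g k) n)"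
      unfolding incseq_def by (intro allI impI words_mono Un_mono greedy_mono order_refl)
    have "words (Y \<union> G) n \<subseteq> (\<Union>k. words (Y \<union> ?g k) n)"
    proof
      fix w
      assume w: "w \<in> words (Y \<union> G) n"
      define k where "k = Suc (Max (insert 0 (set w)))"
      have "a \<in> Y \<union> ?g k" if a: "a \<in> set w" for a
      proof -
        have ak: "a < k" using a Max_ge[of "insert 0 (set w)" a] by (simp add: k_def less_Suc_eq_le)
        have "a \<in> Y \<or> a \<in> G" using w a by (auto simp: words_def)
        moreover have "a \<in> ?g k" if "a \<in> ?g j" for j
        proof -
          have "a \<in> ?g (Suc a)"
          proof (rule ccontr)
            assume na: "a \<notin> ?g (Suc a)"
            have "a \<notin> ?g i" for i
              by (induction i) (use na in \<open>auto split: if_splits\<close>)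
            then show False using that by blast
          qed
          then show ?thesis using greedy_mono[of "Suc a" k] ak by auto
        qed
        ultimately show ?thesis by (auto simp: G_def)
      qed
      then show "w \<in> (\<Union>k. words (Y \<union> ?g k) n)" using w by (auto simp: words_def)
    qed
    then have "mass \<delta> (words (Y \<union> G) n) \<le> (SUP k. mass \<delta> (words (Y \<union> ?g k) n))"
      unfolding mass_incseq[OF mono, symmetric] by (rule mass_mono)
    also have "\<dots> \<le> 4" by (intro SUP_least good_g)
    finally show ?thesis .
  qed
  have "1 \<le> mass \<delta> (words (Y \<union> G) n)" for n
  proof (rule ccontr)
    assume "\<not> ?thesis"
    then have lt: "mass \<delta> (words (Y \<union> G) n) < 1" by simp
    have YG: "0 \<notin> Y \<union> G" using YS GS by auto
    have "mass \<delta> (words (Y \<union> G) 1) < top"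
      using upper_regular_mass_finite[OF upper_regular_subset[OF U] YG] GS by blast
    then obtain \<epsilon> where \<epsilon>: "0 < \<epsilon>"
      "\<And>T. 0 \<notin> T \<Longrightarrow> mass \<delta> (words T 1) \<le> ennreal \<epsilon> \<Longrightarrow> mass \<delta> (words (Y \<union> G \<union> T) n) < 1"
      using mass_words_perturb[OF YG lt] by blast
    have C: "0 < C" using U by (simp add: upper_regular_def)
    obtain N where N: "\<And>m X. N \<le> m \<Longrightarrow> upper_regular \<delta> C X \<Longrightarrow> \<forall>b\<in>X. m \<le> real b \<Longrightarrow>
        mass \<delta> (words X 1) \<le> ennreal \<epsilon>"
      using upper_regular_mass_tail_small[OF C \<epsilon>(1)] by blast
    \<comment> \<open>A sufficiently light letter keeps \<open>Y \<union> G\<close> subcritical,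
      hence with all levels at most 4, so the greedy test cannot have rejected it.\<close>
    have large: "k \<in> G" if k: "k \<in> S" "N \<le> real k" for k
    proof -
      have "upper_regular \<delta> C {k}" using upper_regular_subset[OF U, of "{k}"] k by auto
      then have "mass \<delta> (words {k} 1) \<le> ennreal \<epsilon>" using N[of "real k" "{k}"] k by auto
      then have "mass \<delta> (words (Y \<union> G \<union> {k}) n) < 1" using \<epsilon>(2)[of "{k}"] k S by auto
      then have good: "mass \<delta> (words (Y \<union> G \<union> {k}) m) \<le> 4" for m
        using YG k S by (intro mass_words_le_4[of _ n]) auto
      have "Y \<union> insert k (?g k) \<subseteq> Y \<union> G \<union> {k}" by (auto simp: G_def)
      then have "\<forall>m. mass \<delta> (words (Y \<union> insert k (?g k)) m) \<le> 4" using good good_mono by blast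
      then have "k \<in> ?g (Suc k)" using k by simp
      then show ?thesis unfolding G_def by blast
    qed
    have "S - G \<noteq> {}"
    proof
      assume "S - G = {}"
      then have "G = S" using GS by auto
      then show False using crit[of n] lt by simp
    qed
    moreover have fin: "finite (S - G)"
    proof (rule finite_subset)
      show "S - G \<subseteq> {b. True \<and> real b \<le> N}" using large by force
    qed (rule finite_nat_real_le)
    ultimately have "Max (S - G) \<in> S - G" by (rule Max_in[rotated])
    then obtain k where k: "k = Max (S - G)" "k \<in> S" "k \<notin> G" by auto
    let ?B = "{k' \<in> S. k < k'}"
    have BG: "?B \<subseteq> G"
    proof
      fix k'
      assume k': "k' \<in> ?B"
      then have "\<not> k' \<le> Max (S - G)" using k(1) by simp
      then show "k' \<in> G" using k' Max_ge[OF fin, of k'] by blast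
    qed
    have gk: "?g k \<subseteq> G" by (auto simp: G_def)
    have "k \<notin> ?g (Suc k)" using k(3) by (auto simp: G_def simp del: greedy.simps)
    then obtain m where m: "\<not> mass \<delta> (words (insert k (Y \<union> ?g k)) m) \<le> 4"
      using k(2) by (auto split: if_splits)
    have pos: "0 \<notin> insert k (Y \<union> ?g k)" using k(2) S Y greedy_subset[of Y S k] by auto
    \<comment> \<open>Rejection means that some level exceeds 4, and then no level is below
      1.\<close>
    have "\<not> mass \<delta> (words (insert k (Y \<union> ?g k)) n) < 1"
      using mass_words_le_4[OF pos, of n m] m by blast
    then have "1 \<le> mass \<delta> (words (insert k (Y \<union> ?g k)) n)" by simp
    also have "\<dots> \<le> mass \<delta> (words ((Y \<union> ?g k) \<union> ?B) n)"
    proof (rule mass_words_replace)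
      show "0 \<notin> Y \<union> ?g k" using S Y greedy_subset[of Y S k] by auto
      show "0 < k" using k(2) S by (auto intro: gr0I)
      show "?B \<inter> (Y \<union> ?g k) = {}" using S(2) greedy_subset[of Y S k] by auto
      show "ennreal (real k powr (- (2 * \<delta>))) \<le> mass \<delta> (words ?B 1)" by (rule tail[OF k(2)])
    qed auto
    also have "\<dots> \<le> mass \<delta> (words (Y \<union> G) n)"
      using gk BG by (intro mass_mono words_mono) auto
    finally show False using lt by simp
  qed
  then show ?thesis using GS good_G by blast
qed

end

subsection \<open>The full alphabet\<close>

lemma wt_1_eq: "0 \<notin> set w \<Longrightarrow> wt 1 w = 1 / (cf_den w 0)\<^sup>2"
  using cf_den_ge_1[of w] powr_realpow[of "cf_den w 0" 2] by (simp add: wt_def powr_minus_divide)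

lemma emeasure_cyl_le:
  assumes w: "0 \<notin> set w"
  shows "emeasure lborel (cyl w) \<le> ennreal (wt 1 w)"
proof -
  obtain m where m: "m \<in> cyl w" "\<And>x. x \<in> cyl w \<Longrightarrow> m \<le> x"
    using compact_attains_inf[OF compact_cyl[OF w] cyl_nonempty] by blast
  let ?d = "1 / (cf_den w 0)\<^sup>2"
  have "cyl w \<subseteq> {m..m + ?d}"
    using m cyl_dist_le[OF w _ m(1)] by fastforce
  then have "emeasure lborel (cyl w) \<le> emeasure lborel {m..m + ?d}"
    by (intro emeasure_mono) auto
  also have "\<dots> = ennreal ?d" by simp
  finally show ?thesis by (simp add: wt_1_eq[OF w])
qed

lemma emeasure_cyl_ge:
  assumes w: "0 \<notin> set w"
  shows "ennreal (wt 1 w) \<le> 4 * emeasure lborel (cyl w)"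
proof -
  have q: "1 \<le> cf_den w 0" by (rule cf_den_ge_1[OF w])
  have conn: "connected (cyl w)"
    unfolding cyl_def
    by (intro connected_continuous_image continuous_on_subset[OF continuous_on_cf_map[OF w]]) auto
  define p r where "p = min (cf_map w 0) (cf_map w 1)" and "r = max (cf_map w 0) (cf_map w 1)"
  have pr: "p \<in> cyl w" "r \<in> cyl w" "p \<le> r" "r - p = \<bar>cf_map w 1 - cf_map w 0\<bar>"
    by (auto simp: p_def r_def cyl_def min_def max_def)
  have sub: "{p..r} \<subseteq> cyl w" by (rule connected_contains_Icc[OF conn pr(1,2)])
  have "wt 1 w \<le> 4 * (r - p)"
    using cyl_endpoints_dist[OF w] q unfolding wt_1_eq[OF w] pr(4) by (simp add: field_simps)
  then have "ennreal (wt 1 w) \<le> ennreal (4 * (r - p))" by (rule ennreal_leI)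
  also have "\<dots> = ennreal 4 * ennreal (r - p)" using pr(3) by (intro ennreal_mult) auto
  also have "\<dots> = 4 * emeasure lborel {p..r}" using pr(3) by simp
  also have "\<dots> \<le> 4 * emeasure lborel (cyl w)"
    using compact_cyl[OF w] sub by (intro mult_left_mono emeasure_mono) (auto intro: borel_compact)
  finally show ?thesis .
qed

text \<open>The cylinders of level \<open>n\<close> partition the irrationals of the unit interval.\<close>

lemma mass_full_alphabet:
  "1 \<le> mass 1 (words {0<..} n)" "mass 1 (words {0<..} n) \<le> 4"
proof -
  let ?W = "words {0<..} n"
  have pos: "0 \<notin> set w" if "w \<in> ?W" for w using that by (auto simp: words_def)
  have null: "(\<rat> :: real set) \<in> null_sets lborel" by (intro countable_imp_null_set_lborel countable_rat)
  have meas: "cyl w \<in> sets lborel" if "w \<in> ?W" for w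
    using compact_cyl[OF pos[OF that]] by (auto intro: borel_compact)
  have "(\<Union>w\<in>?W. cyl w - \<rat>) = {0..1} - \<rat>"
  proof
    show "(\<Union>w\<in>?W. cyl w - \<rat>) \<subseteq> {0..1} - \<rat>"
      using cyl_subset_unit pos by blast
    show "{0..1} - \<rat> \<subseteq> (\<Union>w\<in>?W. cyl w - \<rat>)"
    proof
      fix x :: real
      assume x: "x \<in> {0..1} - \<rat>"
      then obtain \<omega> where \<omega>: "has_cf_expansion x \<omega>" using irrational_has_cf_expansion by auto
      have "prefix_word \<omega> n \<in> ?W" using has_cf_expansionD(1)[OF \<omega>] by (auto simp: words_def)
      then show "x \<in> (\<Union>w\<in>?W. cyl w - \<rat>)" using has_cf_expansionD(2)[OF \<omega>] x by blast
    qed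
  qed
  then have "emeasure lborel (\<Union>w\<in>?W. cyl w - \<rat>) = emeasure lborel ({0..1} - \<rat> :: real set)" by simp
  also have "\<dots> = emeasure lborel {0..1 :: real}" by (rule emeasure_Diff_null_set[OF null]) auto
  also have "\<dots> = 1" by simp
  finally have "1 = emeasure lborel (\<Union>w\<in>?W. cyl w - \<rat>)" by simp
  also have "\<dots> = (\<integral>\<^sup>+ w. emeasure lborel (cyl w - \<rat>) \<partial>count_space ?W)"
  proof (rule emeasure_UN_countable)
    show "disjoint_family_on (\<lambda>w. cyl w - \<rat>) ?W"
      unfolding disjoint_family_on_def
    proof (intro ballI impI)
      fix v w
      assume vw: "v \<in> ?W" "w \<in> ?W" "v \<noteq> w"
      then have "length v = length w" by (simp add: words_def)
      then show "(cyl v - \<rat>) \<inter> (cyl w - \<rat>) = {}"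
        using irrational_cyl_unique[of v w] vw pos by blast
    qed
  qed (use meas null in auto)
  also have "\<dots> = (\<integral>\<^sup>+ w. emeasure lborel (cyl w) \<partial>count_space ?W)"
    using meas by (intro nn_integral_cong emeasure_Diff_null_set[OF null]) auto
  finally have one: "1 = (\<integral>\<^sup>+ w. emeasure lborel (cyl w) \<partial>count_space ?W)" .
  have "(\<integral>\<^sup>+ w. emeasure lborel (cyl w) \<partial>count_space ?W) \<le> mass 1 ?W"
    unfolding mass_eq_nn_integral using emeasure_cyl_le pos by (intro nn_integral_mono) auto
  then show "1 \<le> mass 1 ?W" using one by simp
  have "mass 1 ?W \<le> (\<integral>\<^sup>+ w. 4 * emeasure lborel (cyl w) \<partial>count_space ?W)"
    unfolding mass_eq_nn_integral using emeasure_cyl_ge pos by (intro nn_integral_mono) auto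
  also have "\<dots> = 4 * (\<integral>\<^sup>+ w. emeasure lborel (cyl w) \<partial>count_space ?W)"
    by (rule nn_integral_cmult) auto
  finally show "mass 1 ?W \<le> 4" using one by simp
qed

context cf_exponent
begin

text \<open>For exponent 1 every level of the full alphabet has mass at least 1. Passing to
  \<open>\<delta> < 1\<close> multiplies each weight by \<open>q^(2 (1 - \<delta>))\<close>, with
  \<open>q\<close> the continuant, which grows exponentially with the length; continuity from below
  then gives a finite alphabet.\<close>

lemma ex_supercritical_interval:
  assumes \<delta>1: "\<delta> < 1"
  shows "\<exists>n M. 4 < mass \<delta> (words {1..M} n)"
proof -
  have "(1 :: real) < 2 powr (2 * (1 - \<delta>))" using \<delta>1 by simp
  then obtain m where m: "4 < (2 powr (2 * (1 - \<delta>)) :: real) ^ m" using real_arch_pow by blast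
  define n where "n = 2 * m"
  let ?c = "(2 powr (2 * (1 - \<delta>))) ^ m :: real"
  have wt: "?c * wt 1 w \<le> wt \<delta> w" if "w \<in> words {0<..} n" for w
  proof -
    have w: "0 \<notin> set w" "length w = n" using that by (auto simp: words_def)
    have "?c = (2 ^ m) powr (2 * (1 - \<delta>))"
      by (simp add: powr_realpow[symmetric] powr_powr mult.commute)
    also have "\<dots> \<le> cf_den w 0 powr (2 * (1 - \<delta>))"
      using cf_den_ge_power[OF w(1)] w(2) \<delta>1 by (intro powr_mono2) (auto simp: n_def)
    finally have "?c * wt 1 w \<le> cf_den w 0 powr (2 * (1 - \<delta>)) * wt 1 w"
      by (intro mult_right_mono) auto
    also have "\<dots> = wt \<delta> w" by (simp add: wt_def powr_add[symmetric] algebra_simps)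
    finally show ?thesis .
  qed
  have "ennreal 4 < ennreal ?c" using m by (intro ennreal_lessI) auto
  also have "\<dots> \<le> ennreal ?c * mass 1 (words {0<..} n)"
    using mult_left_mono[OF mass_full_alphabet(1), of "ennreal ?c" n] by simp
  also have "\<dots> = (\<integral>\<^sup>+ w. ennreal ?c * ennreal (wt 1 w) \<partial>count_space (words {0<..} n))"
    by (simp add: mass_eq_nn_integral nn_integral_cmult)
  also have "\<dots> \<le> mass \<delta> (words {0<..} n)"
    unfolding mass_eq_nn_integral using wt
    by (intro nn_integral_mono) (auto simp: ennreal_mult[symmetric] intro!: ennreal_leI)
  also have "words {0<..} n = (\<Union>M. words {1..M} n)"
  proof
    show "words {0<..} n \<subseteq> (\<Union>M. words {1..M} n)"
    proof
      fix w
      assume w: "w \<in> words {0<..} n"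
      have "a \<le> Max (set w)" if "a \<in> set w" for a using that by simp
      then have "w \<in> words {1..Max (set w)} n" using w by (auto simp: words_def Suc_le_eq)
      then show "w \<in> (\<Union>M. words {1..M} n)" by blast
    qed
  qed (auto simp: words_def)
  also have "mass \<delta> (\<Union>M. words {1..M} n) = (SUP M. mass \<delta> (words {1..M} n))"
    by (rule mass_incseq) (auto simp: incseq_def words_def)
  finally show ?thesis by (auto simp: less_SUP_iff)
qed

text \<open>\<open>P\<close> says that no level is below 1. It holds for some interval, as a level
  above 4 excludes a level below 1, and \<open>Suc M\<close> is the least instance.\<close>

lemma ex_critical_interval:
  assumes \<delta>1: "\<delta> < 1"
  shows "\<exists>M\<ge>1. (\<exists>n. mass \<delta> (words {1..M} n) < 1) \<and> (\<forall>n. 1 \<le> mass \<delta> (words {1..Suc M} n))"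
proof -
  define P where "P M \<longleftrightarrow> (\<forall>n. 1 \<le> mass \<delta> (words {1..M} n))" for M :: nat
  obtain n M where nM: "4 < mass \<delta> (words {1..M} n)" using ex_supercritical_interval[OF \<delta>1] by blast
  have "P M"
    unfolding P_def
  proof (intro allI)
    fix k
    have "\<not> mass \<delta> (words {1..M} k) < 1"
      using mass_words_le_4[of "{1..M}" k n] nM by auto
    then show "1 \<le> mass \<delta> (words {1..M} k)" by simp
  qed
  define L where "L = (LEAST M. P M)"
  have PL: "P L" unfolding L_def by (rule LeastI[of P, OF \<open>P M\<close>])
  have "\<not> P 0"
  proof -
    have "words {1..0} 1 = {}" by (auto simp: words_def length_Suc_conv)
    then show ?thesis unfolding P_def by (metis mass_empty not_one_le_zero)
  qed
  \<comment> \<open>Length 2 matters: the word \<open>[1]\<close> has weight 1, whereas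
    \<open>[1, 1]\<close> has continuant 2.\<close>
  have "\<not> P 1"
  proof -
    have "words {1..1 :: nat} 2 = {[1, 1]}"
      by (auto simp: words_def length_Suc_conv numeral_2_eq_2)
    then have "mass \<delta> (words {1..1} 2) = ennreal (2 powr (- (2 * \<delta>)))"
      by (simp add: mass_finite wt_def)
    also have "\<dots> < ennreal 1"
      using powr_less_mono[of "- (2 * \<delta>)" 0 "2::real"] \<delta>_pos by (intro ennreal_lessI) auto
    finally show ?thesis by (auto simp: P_def not_le intro!: exI[of _ 2])
  qed
  then have "L \<noteq> 0" "L \<noteq> 1" using PL \<open>\<not> P 0\<close> by metis+
  then obtain K where K: "L = Suc K" "1 \<le> K" by (cases L) auto
  have "\<not> P K" using not_less_Least[of K P] K by (simp add: L_def)
  then show ?thesis using PL K unfolding P_def by (intro exI[of _ K]) (auto simp: not_le)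
qed

end

subsection \<open>Regular sets of integers\<close>

text \<open>For \<open>\<delta> < 1\<close> the sums of finitely many distinct members of a sequence growing like
  \<open>2\<^bsup>j/\<delta>\<^esup>\<close> form a discrete analogue of a Cantor set.\<close>

lemma regular_set_exists:
  fixes \<delta> :: real
  assumes \<delta>: "0 < \<delta>" "\<delta> < 1"
  shows "\<exists>S :: nat set. 0 \<in> S \<and> (\<forall>s\<in>S. even s) \<and> upper_regular \<delta> 2 S \<and> (\<exists>c. lower_regular \<delta> c S)"
proof -
  \<comment> \<open>Enlarging the scale by \<open>b\<close> doubles the number of sums, as dimension
    \<open>\<delta>\<close> requires. The gaps need \<open>b > 2\<close>, that is,
    \<open>\<delta> < 1\<close>.\<close>
  define b where "b = (2 :: real) powr (1 / \<delta>)"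
  have b2: "2 < b"
    using powr_less_mono[of 1 "1 / \<delta>" "2::real"] \<delta> by (simp add: b_def)
  have b_powr: "(b ^ j) powr \<delta> = 2 ^ j" for j
    using \<delta> by (simp add: b_def powr_realpow[symmetric] powr_powr)
  \<comment> \<open>Solved from two requirements: \<open>B b^j\<close> bounds the sum of all terms
    before \<open>L j\<close>, a geometric series, and \<open>2 A - B = 4\<close> leaves a gap of at
    least \<open>b^j\<close> after rounding.\<close>
  define A where "A = 2 * (b - 1) / (b - 2)"
  define B where "B = 2 * A / (b - 1)"
  have "2 * A = 4 / (b - 2) * (b - 1)" using b2 by (simp add: A_def)
  then have "B = 4 / (b - 2) * (b - 1) / (b - 1)" by (simp only: B_def)
  also have "\<dots> = 4 / (b - 2)" by (rule nonzero_mult_div_cancel_right) (use b2 in simp)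
  finally have B_eq: "B = 4 / (b - 2)" .
  have A: "0 < A" "2 * A - B = 4" and B: "0 < B"
    using b2 unfolding B_eq A_def by (auto simp: diff_divide_distrib[symmetric] divide_simps)
  \<comment> \<open>The factor 2 outside the floor makes all sums even, which later keeps two
    translates disjoint.\<close>
  define L where "L j = 2 * nat \<lfloor>A * b ^ j\<rfloor>" for j :: nat
  have L: "real (L j) \<le> 2 * A * b ^ j" "2 * A * b ^ j - 2 \<le> real (L j)" for j
  proof -
    have "0 \<le> A * b ^ j" using A b2 by simp
    then have "real (L j) = 2 * of_int \<lfloor>A * b ^ j\<rfloor>" by (simp add: L_def)
    then show "real (L j) \<le> 2 * A * b ^ j" "2 * A * b ^ j - 2 \<le> real (L j)" by linarith+
  qed
  have sumL: "real (\<Sum>i<j. L i) \<le> B * b ^ j" for j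
  proof -
    have "real (\<Sum>i<j. L i) \<le> (\<Sum>i<j. 2 * A * b ^ i)"
      unfolding of_nat_sum by (intro sum_mono L)
    also have "\<dots> = B * (b ^ j - 1)"
      using b2 by (simp add: sum_distrib_left[symmetric] geometric_sum B_def)
    also have "\<dots> \<le> B * b ^ j" using B by simp
    finally show ?thesis .
  qed
  have gap: "b ^ j \<le> real (L j) - real (\<Sum>i<j. L i)" for j
  proof -
    have "4 * b ^ j - 2 = (2 * A * b ^ j - 2) - B * b ^ j"
      by (simp add: A(2)[symmetric] algebra_simps)
    also have "\<dots> \<le> real (L j) - real (\<Sum>i<j. L i)" using L(2)[of j] sumL[of j] by linarith
    finally show ?thesis using one_le_power[of b j] b2 by linarith
  qed
  define s where "s F = sum L F" for F :: "nat set"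
  have s_Un: "s (F \<union> F') = s F + s F'" if "finite F" "finite F'" "F \<inter> F' = {}" for F F'
    using that by (simp add: s_def sum.union_disjoint)
  have s_le: "s F \<le> (\<Sum>i<j. L i)" if "F \<subseteq> {..<j}" for F j
    unfolding s_def using that by (intro sum_mono2) auto
  have sep1: "b ^ j \<le> real (s F') - real (s F)"
    if F: "finite F" "finite F'" and j: "j \<in> F'" "j \<notin> F" "F \<inter> {j<..} = F' \<inter> {j<..}" for F F' j
  proof -
    have "F = (F \<inter> {j<..}) \<union> (F \<inter> {..<j})" using j(2) by (auto simp: not_less le_less)
    from arg_cong[OF this, of s] have "s F = s (F \<inter> {j<..}) + s (F \<inter> {..<j})"
      using s_Un[of "F \<inter> {j<..}" "F \<inter> {..<j}"] F by fastforce
    moreover have "s (F \<inter> {..<j}) \<le> (\<Sum>i<j. L i)" by (rule s_le) auto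
    moreover have "s (F \<inter> {j<..} \<union> {j}) \<le> s F'"
      unfolding s_def using F j by (intro sum_mono2) auto
    moreover have "s (F \<inter> {j<..} \<union> {j}) = s (F \<inter> {j<..}) + L j"
      using s_Un[of "F \<inter> {j<..}" "{j}"] F by (simp add: s_def)
    ultimately show ?thesis using gap[of j] by linarith
  qed
  \<comment> \<open>The sums are compared at the largest index where the sets differ; all smaller
    terms together cannot close the gap there.\<close>
  have sep: "\<exists>j. F \<inter> {j<..} = F' \<inter> {j<..} \<and> b ^ j \<le> \<bar>real (s F') - real (s F)\<bar>"
    if F: "finite F" "finite F'" "F \<noteq> F'" for F F'
  proof -
    let ?D = "(F - F') \<union> (F' - F)"
    have D: "finite ?D" "?D \<noteq> {}" using F by auto
    define j where "j = Max ?D"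
    have j: "j \<in> ?D" unfolding j_def by (rule Max_in[OF D])
    have "i \<notin> ?D" if "j < i" for i using Max_ge[OF D(1), of i] that by (auto simp: j_def)
    then have eq: "F \<inter> {j<..} = F' \<inter> {j<..}" by blast
    have "b ^ j \<le> \<bar>real (s F') - real (s F)\<bar>"
    proof (cases "j \<in> F'")
      case True
      then show ?thesis using sep1[OF F(1,2) True _ eq] j by simp
    next
      case False
      then show ?thesis using sep1[OF F(2,1) _ False eq[symmetric]] j by simp
    qed
    then show ?thesis using eq by blast
  qed
  have b_pos: "0 < b ^ j" for j using b2 by simp
  have s_inj: "F = F'" if "finite F" "finite F'" "s F = s F'" for F F'
    using sep[of F F'] that b_pos by (metis abs_zero cancel_comm_monoid_add_class.diff_cancel not_le)
  define S where "S = s ` {F. finite F}"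
  have "0 \<in> S" unfolding S_def by (rule image_eqI[of _ _ "{}"]) (auto simp: s_def)
  moreover have "\<forall>n\<in>S. even n" by (auto simp: S_def s_def L_def intro!: dvd_sum)
  moreover have "upper_regular \<delta> 2 S"
    unfolding upper_regular_def
  proof (intro conjI allI impI)
    fix a R :: real
    assume R: "1 \<le> R"
    let ?W = "{n \<in> S. a \<le> real n \<and> real n \<le> a + R}"
    show "real (card ?W) \<le> 2 * R powr \<delta>"
    proof (cases "?W = {}")
      case True
      then show ?thesis by (simp only: card.empty) simp
    next
      case False
      then obtain F0 where F0: "finite F0" "s F0 \<in> ?W" by (auto simp: S_def)
      obtain j where j: "b ^ j \<le> R" "R < b ^ Suc j" using ex_power_bracket[of b R] b2 R by auto
      \<comment> \<open>A difference at an index above \<open>j\<close> would separate two sums by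
        at least \<open>b^(j+1) > R\<close>. So only indices up to \<open>j\<close> are free, which
        leaves \<open>2^(j+1) \<le> 2 R^\<delta>\<close> sums.\<close>
      have "?W \<subseteq> (\<lambda>E. s ((F0 \<inter> {j<..}) \<union> E)) ` Pow {..j}"
      proof
        fix n
        assume n: "n \<in> ?W"
        then obtain F where F: "finite F" "n = s F" by (auto simp: S_def)
        have "F \<inter> {j<..} = F0 \<inter> {j<..}"
        proof (cases "F = F0")
          case False
          then obtain i where i: "F \<inter> {i<..} = F0 \<inter> {i<..}" "b ^ i \<le> \<bar>real (s F0) - real (s F)\<bar>"
            using sep[OF F(1) F0(1)] by blast
          have "\<bar>real (s F0) - real (s F)\<bar> \<le> R" using F0(2) n F(2) by auto
          then have "b ^ i < b ^ Suc j" using i j by linarith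
          then have "i < Suc j" by (rule power_less_imp_less_exp[rotated]) (use b2 in simp)
          have "x \<in> F \<longleftrightarrow> x \<in> F0" if "j < x" for x
          proof -
            have "i < x" using \<open>i < Suc j\<close> that by simp
            then show ?thesis using i(1) by blast
          qed
          then show ?thesis by blast
        qed simp
        note eq = this
        have "F = (F \<inter> {j<..}) \<union> (F \<inter> {..j})" by auto
        from arg_cong[OF this, of s] have "n = s ((F0 \<inter> {j<..}) \<union> (F \<inter> {..j}))"
          unfolding F(2) eq .
        then show "n \<in> (\<lambda>E. s ((F0 \<inter> {j<..}) \<union> E)) ` Pow {..j}" by blast
      qed
      then have "card ?W \<le> card (Pow {..j})" by (rule surj_card_le[rotated]) simp
      also have "\<dots> = 2 * 2 ^ j" by (simp add: card_Pow)
      finally have "real (card ?W) \<le> real (2 * 2 ^ j)" by (simp only: of_nat_le_iff)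
      also have "\<dots> = 2 * 2 ^ j" by simp
      also have "(2::real) ^ j = (b ^ j) powr \<delta>" by (rule b_powr[symmetric])
      also have "\<dots> \<le> R powr \<delta>" using j b_pos[of j] \<delta> by (intro powr_mono2) auto
      finally show ?thesis by simp
    qed
  qed simp
  moreover have "lower_regular \<delta> (1 / (2 * max 1 B powr \<delta>)) S"
    unfolding lower_regular_def
  proof (intro conjI ballI allI impI)
    let ?B = "max 1 B"
    have B1: "1 \<le> ?B" by simp
    have Bp: "0 < ?B powr \<delta>" by simp
    then show "0 < 1 / (2 * ?B powr \<delta>)" by simp
    fix a and R :: real
    assume a: "a \<in> S" and R: "1 \<le> R"
    then obtain F where F: "finite F" "a = s F" by (auto simp: S_def)
    let ?W = "{n \<in> S. \<bar>real n - real a\<bar> \<le> R}"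
    have finW: "finite ?W"
      by (rule finite_subset[OF _ finite_nat_real_le[of "\<lambda>b. True" "real a + R"]]) auto
    show "1 / (2 * ?B powr \<delta>) * R powr \<delta> \<le> real (card ?W)"
    proof (cases "R < ?B")
      case True
      then have "R powr \<delta> \<le> ?B powr \<delta>" using R \<delta> by (intro powr_mono2) auto
      then have "R powr \<delta> \<le> 2 * ?B powr \<delta>" using Bp by linarith
      then have "1 / (2 * ?B powr \<delta>) * R powr \<delta> \<le> 1" using Bp by (simp add: pos_divide_le_eq)
      moreover have "a \<in> ?W" using a R by simp
      then have "1 \<le> card ?W" using finW by (metis card_0_eq empty_iff less_one not_le)
      ultimately show ?thesis by linarith
    next
      case False
      then have "?B \<le> R" by (simp only: not_less)
      then have "1 \<le> R / ?B" by (simp add: pos_le_divide_eq)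
      then obtain j where j: "b ^ j \<le> R / ?B" "R / ?B < b ^ Suc j"
        using ex_power_bracket[of b "R / ?B"] b2 by auto
      have jB: "?B * b ^ j \<le> R" "R \<le> ?B * b ^ Suc j"
        using j B1 by (auto simp: pos_le_divide_eq pos_divide_less_eq mult.commute)
      \<comment> \<open>Varying the part of \<open>F\<close> below index \<open>j\<close> moves the
        sum by at most \<open>B b^j \<le> R\<close> and produces \<open>2^j\<close> distinct
        sums.\<close>
      let ?f = "\<lambda>E. s ((F \<inter> {j..}) \<union> E)"
      have fE: "?f E = s (F \<inter> {j..}) + s E" if "E \<subseteq> {..<j}" for E
        using that F finite_subset[OF that] by (intro s_Un) auto
      have "F = (F \<inter> {j..}) \<union> (F \<inter> {..<j})" by auto
      from arg_cong[OF this, of s] have sF: "s F = s (F \<inter> {j..}) + s (F \<inter> {..<j})"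
        using fE[of "F \<inter> {..<j}"] by simp
      have "inj_on ?f (Pow {..<j})"
      proof (rule inj_onI)
        fix E E'
        assume E: "E \<in> Pow {..<j}" "E' \<in> Pow {..<j}" "?f E = ?f E'"
        then have "s E = s E'" using fE by simp
        then show "E = E'" using E finite_subset[of _ "{..<j}"] by (intro s_inj) auto
      qed
      then have "2 ^ j = card (?f ` Pow {..<j})" by (simp add: card_image card_Pow)
      also have "\<dots> \<le> card ?W"
      proof (rule card_mono[OF finW])
        show "?f ` Pow {..<j} \<subseteq> ?W"
        proof clarify
          fix E
          assume E: "E \<subseteq> {..<j}"
          have "real (s E) \<le> real (\<Sum>i<j. L i)" "real (s (F \<inter> {..<j})) \<le> real (\<Sum>i<j. L i)"
            using s_le[OF E] s_le[of "F \<inter> {..<j}" j] by (simp_all del: of_nat_sum)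
          moreover have "real (\<Sum>i<j. L i) \<le> R"
          proof -
            have "B * b ^ j \<le> ?B * b ^ j" using b_pos[of j] by (intro mult_right_mono) auto
            then show ?thesis using sumL[of j] jB(1) by linarith
          qed
          ultimately have "\<bar>real (?f E) - real a\<bar> \<le> R"
            unfolding F(2) sF fE[OF E] by (simp add: abs_le_iff)
          moreover have "?f E \<in> S" using F(1) finite_subset[OF E] by (auto simp: S_def)
          ultimately show "?f E \<in> S \<and> \<bar>real (?f E) - real a\<bar> \<le> R" by blast
        qed
      qed
      finally have "real (2 ^ j) \<le> real (card ?W)" by (simp only: of_nat_le_iff)
      then have "2 ^ j \<le> real (card ?W)" by simp
      moreover have "R powr \<delta> \<le> (?B * b ^ Suc j) powr \<delta>" using jB R \<delta> by (intro powr_mono2) auto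
      moreover have "(?B * b ^ Suc j) powr \<delta> = ?B powr \<delta> * (2 * 2 ^ j)"
        using b_powr[of "Suc j"] by (simp only: powr_mult power_Suc)
      ultimately have "R powr \<delta> \<le> ?B powr \<delta> * (2 * real (card ?W))"
        using Bp by (smt (verit) mult_left_mono)
      then show ?thesis using Bp by (simp add: field_simps)
    qed
  qed
  ultimately show ?thesis by blast
qed

section \<open>Permanence properties of regularity\<close>

lemma upper_regular_Un:
  assumes X: "upper_regular \<delta> C X" and Y: "upper_regular \<delta> D Y"
  shows "upper_regular \<delta> (C + D) (X \<union> Y)"
  unfolding upper_regular_def
proof (intro conjI allI impI)
  show "0 < C + D" using X Y by (simp add: upper_regular_def)
  fix a R :: real
  assume R: "1 \<le> R"
  let ?c = "\<lambda>X. card {b \<in> X. a \<le> real b \<and> real b \<le> a + R}"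
  have "{b \<in> X \<union> Y. a \<le> real b \<and> real b \<le> a + R}
      = {b \<in> X. a \<le> real b \<and> real b \<le> a + R} \<union> {b \<in> Y. a \<le> real b \<and> real b \<le> a + R}" by auto
  then have "?c (X \<union> Y) \<le> ?c X + ?c Y" by (simp add: card_Un_le)
  moreover have "real (?c X) \<le> C * R powr \<delta>" "real (?c Y) \<le> D * R powr \<delta>"
    using X Y R by (auto simp: upper_regular_def)
  ultimately show "real (?c (X \<union> Y)) \<le> (C + D) * R powr \<delta>" by (simp add: algebra_simps)
qed

lemma upper_regular_shift:
  assumes X: "upper_regular \<delta> C X"
  shows "upper_regular \<delta> C ((+) m ` X)"
  unfolding upper_regular_def
proof (intro conjI allI impI)
  show "0 < C" using X by (simp add: upper_regular_def)
  fix a R :: real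
  assume R: "1 \<le> R"
  have "{b \<in> (+) m ` X. a \<le> real b \<and> real b \<le> a + R}
      = (+) m ` {b \<in> X. a - real m \<le> real b \<and> real b \<le> (a - real m) + R}" by auto
  then have "card {b \<in> (+) m ` X. a \<le> real b \<and> real b \<le> a + R}
      = card {b \<in> X. a - real m \<le> real b \<and> real b \<le> (a - real m) + R}"
    by (simp add: card_image)
  then show "real (card {b \<in> (+) m ` X. a \<le> real b \<and> real b \<le> a + R}) \<le> C * R powr \<delta>"
    using X R by (simp only: upper_regular_def)
qed

lemma upper_regular_finite:
  assumes "finite X" "0 \<le> \<delta>"
  shows "upper_regular \<delta> (real (card X) + 1) X"
  unfolding upper_regular_def
proof (intro conjI allI impI)
  fix a R :: real
  assume R: "1 \<le> R"
  have "real (card {b \<in> X. a \<le> real b \<and> real b \<le> a + R}) \<le> (real (card X) + 1) * 1"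
    using card_mono[of X "{b \<in> X. a \<le> real b \<and> real b \<le> a + R}"] assms by simp
  also have "\<dots> \<le> (real (card X) + 1) * R powr \<delta>"
    using R assms by (intro mult_left_mono ge_one_powr_ge_zero) auto
  finally show "real (card {b \<in> X. a \<le> real b \<and> real b \<le> a + R}) \<le> (real (card X) + 1) * R powr \<delta>" .
qed simp

lemma lower_regular_shift:
  assumes X: "lower_regular \<delta> c X"
  shows "lower_regular \<delta> c ((+) m ` X)"
  unfolding lower_regular_def
proof (intro conjI ballI allI impI)
  show "0 < c" using X by (simp add: lower_regular_def)
  fix a and R :: real
  assume a: "a \<in> (+) m ` X" and R: "1 \<le> R"
  then obtain a' where a': "a = m + a'" "a' \<in> X" by auto
  have "{b \<in> (+) m ` X. \<bar>real b - real a\<bar> \<le> R} = (+) m ` {b \<in> X. \<bar>real b - real a'\<bar> \<le> R}"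
    using a' by auto
  then have "card {b \<in> (+) m ` X. \<bar>real b - real a\<bar> \<le> R} = card {b \<in> X. \<bar>real b - real a'\<bar> \<le> R}"
    by (simp add: card_image)
  then show "c * R powr \<delta> \<le> real (card {b \<in> (+) m ` X. \<bar>real b - real a\<bar> \<le> R})"
    using X a' R by (simp add: lower_regular_def)
qed

lemma finite_nat_near: "finite {b \<in> X. \<bar>real b - real a\<bar> \<le> R}"
  by (rule finite_subset[OF _ finite_nat_real_le[of "\<lambda>b. True" "real a + R"]]) auto

text \<open>At scales above \<open>2 D\<close> the ball around \<open>a\<close> contains one of at
  least half the radius around a point of \<open>X\<close>; at smaller scales the point
  \<open>a\<close> alone suffices.\<close>

lemma lower_regular_near:
  assumes X: "lower_regular \<delta> c X" and sub: "X \<subseteq> Y" and D: "1 \<le> D"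
    and near: "\<And>a. a \<in> Y \<Longrightarrow> \<exists>a'\<in>X. \<bar>real a - real a'\<bar> \<le> D" and \<delta>: "0 < \<delta>" "\<delta> \<le> 1"
  shows "lower_regular \<delta> (min (c / 2) (1 / (2 * D))) Y"
  unfolding lower_regular_def
proof (intro conjI ballI allI impI)
  have c: "0 < c" using X by (simp add: lower_regular_def)
  then show "0 < min (c / 2) (1 / (2 * D))" using D by simp
  fix a and R :: real
  assume a: "a \<in> Y" and R: "1 \<le> R"
  let ?W = "{b \<in> Y. \<bar>real b - real a\<bar> \<le> R}"
  show "min (c / 2) (1 / (2 * D)) * R powr \<delta> \<le> real (card ?W)"
  proof (cases "2 * D \<le> R")
    case True
    obtain a' where a': "a' \<in> X" "\<bar>real a - real a'\<bar> \<le> D" using near[OF a] by blast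
    have "min (c / 2) (1 / (2 * D)) * R powr \<delta> \<le> c / 2 * R powr \<delta>" by (intro mult_right_mono) auto
    also have "R powr \<delta> \<le> 2 * (R / 2) powr \<delta>"
      using powr_scale_le[of 2 "R / 2" \<delta>] R \<delta> by simp
    then have "c / 2 * R powr \<delta> \<le> c * (R / 2) powr \<delta>" using c by simp
    also have "\<dots> \<le> c * (R - D) powr \<delta>"
      using True c R D \<delta> by (intro mult_left_mono powr_mono2) auto
    also have "\<dots> \<le> real (card {b \<in> X. \<bar>real b - real a'\<bar> \<le> R - D})"
      using X a' True D by (simp add: lower_regular_def)
    also have "\<dots> \<le> real (card ?W)"
      using a' sub by (intro of_nat_mono card_mono finite_nat_near) auto
    finally show ?thesis .
  next
    case False
    then have "R powr \<delta> \<le> (2 * D) powr \<delta>" using R \<delta> by (intro powr_mono2) auto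
    also have "\<dots> \<le> 2 * D" using powr_scale_le[of "2 * D" 1 \<delta>] D \<delta> by simp
    finally have "1 / (2 * D) * R powr \<delta> \<le> 1" using D by (simp add: field_simps)
    moreover have "min (c / 2) (1 / (2 * D)) * R powr \<delta> \<le> 1 / (2 * D) * R powr \<delta>"
      by (intro mult_right_mono) auto
    moreover have "a \<in> ?W" using a R by simp
    then have "1 \<le> card ?W" using finite_nat_near[of Y a R] by (metis card_0_eq empty_iff less_one not_le)
    ultimately show ?thesis by linarith
  qed
qed

lemma lower_regular_infinite:
  assumes X: "lower_regular \<delta> c X" and "X \<noteq> {}" "0 < \<delta>"
  shows "infinite X"
proof
  assume fin: "finite X"
  have c: "0 < c" using X by (simp add: lower_regular_def)
  obtain a where a: "a \<in> X" using assms by blast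
  define R where "R = max 1 (((real (card X) + 1) / c) powr (1 / \<delta>))"
  have "(real (card X) + 1) / c = (((real (card X) + 1) / c) powr (1 / \<delta>)) powr \<delta>"
    using c assms by (simp add: powr_powr)
  also have "\<dots> \<le> R powr \<delta>" using assms by (intro powr_mono2) (auto simp: R_def)
  finally have "real (card X) + 1 \<le> c * R powr \<delta>" using c by (simp add: pos_divide_le_eq mult.commute)
  also have "\<dots> \<le> real (card {b \<in> X. \<bar>real b - real a\<bar> \<le> R})"
    using X a by (simp add: lower_regular_def R_def)
  also have "\<dots> \<le> real (card X)" using fin by (intro of_nat_mono card_mono) auto
  finally show False by simp
qed

subsection \<open>Choice of the alphabet\<close>

text \<open>Telescoping, from \<open>1 / i^2 \<ge> 1 / i - 1 / (i + 1)\<close>.\<close>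

lemma sum_inverse_squares_ge:
  fixes k m :: nat
  assumes "k \<le> m"
  shows "1 / (real k + 1) - 1 / (real m + 1) \<le> (\<Sum>i\<in>{k<..m}. 1 / (real i)\<^sup>2)"
  using assms
proof (induction m rule: dec_induct)
  case (step m)
  have "1 / (real m + 1) - 1 / (real m + 2) = 1 / ((real m + 1) * (real m + 2))"
    by (simp add: field_simps)
  also have "\<dots> \<le> 1 / (real m + 1)\<^sup>2"
    by (intro divide_left_mono) (auto simp: power2_eq_square)
  finally have "1 / (real m + 1) - 1 / (real m + 2) \<le> 1 / (real (Suc m))\<^sup>2" by (simp add: add_ac)
  moreover have "{k<..Suc m} = insert (Suc m) {k<..m}" using step.hyps by auto
  ultimately show ?case using step.IH by (simp add: add_ac)
qed simp

context cf_exponent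
begin

text \<open>Since \<open>(k / i)^(2 \<delta>) \<ge> (k / i)^2\<close> for \<open>i > k\<close>, it
  suffices to treat exponent 2, where summing up to \<open>8 k\<close> is enough. At
  \<open>\<delta> = 1\<close> the letter 1 outweighs all larger integers together, whence
  \<open>k \<ge> 2\<close>.\<close>

lemma powr_le_sum_larger:
  assumes k: "2 \<le> (k :: nat)"
  shows "real k powr (- (2 * \<delta>)) \<le> (\<Sum>i\<in>{k<..8 * k}. real i powr (- (2 * \<delta>)))"
proof -
  define x where "x = real k"
  have x: "2 \<le> x" using k by (simp add: x_def)
  have "x * x * 2 \<le> x * x * x" "2 * x \<le> x * x" using x by (auto intro!: mult_left_mono mult_right_mono)
  moreover have "(x + 1) * (8 * x + 1) = 8 * (x * x) + 9 * x + 1" by (simp add: algebra_simps)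
  moreover have "7 * x * x * x = 7 * (x * x * x)" "x * x * 2 = 2 * (x * x)" by simp_all
  ultimately have "(x + 1) * (8 * x + 1) \<le> 7 * x * x * x" using x by linarith
  then have "1 \<le> x\<^sup>2 * (7 * x / ((x + 1) * (8 * x + 1)))"
    using x by (simp add: power2_eq_square pos_le_divide_eq mult_ac)
  also have "7 * x / ((x + 1) * (8 * x + 1)) = 1 / (x + 1) - 1 / (8 * x + 1)"
    using x by (simp add: diff_frac_eq)
  finally have "1 \<le> x\<^sup>2 * (1 / (x + 1) - 1 / (8 * x + 1))" .
  also have "\<dots> \<le> x\<^sup>2 * (\<Sum>i\<in>{k<..8 * k}. 1 / (real i)\<^sup>2)"
    using sum_inverse_squares_ge[of k "8 * k"] by (intro mult_left_mono) (auto simp: x_def)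
  also have "\<dots> = (\<Sum>i\<in>{k<..8 * k}. (x / real i)\<^sup>2)"
    by (simp add: sum_distrib_left power_divide)
  finally have "x powr (- (2 * \<delta>)) * 1 \<le> x powr (- (2 * \<delta>)) * (\<Sum>i\<in>{k<..8 * k}. (x / real i)\<^sup>2)"
    by (intro mult_left_mono) auto
  also have "\<dots> = (\<Sum>i\<in>{k<..8 * k}. x powr (- (2 * \<delta>)) * (x / real i)\<^sup>2)"
    by (rule sum_distrib_left)
  also have "\<dots> \<le> (\<Sum>i\<in>{k<..8 * k}. real i powr (- (2 * \<delta>)))"
  proof (rule sum_mono)
    fix i
    assume i: "i \<in> {k<..8 * k}"
    then have xi: "0 < x / real i" "x / real i \<le> 1" using x by (auto simp: x_def)
    have "(x / real i)\<^sup>2 = (x / real i) powr 2" using xi powr_realpow[of "x / real i" 2] by simp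
    also have "\<dots> \<le> (x / real i) powr (2 * \<delta>)" using xi \<delta>_le_1 by (intro powr_mono') auto
    finally have "x powr (- (2 * \<delta>)) * (x / real i)\<^sup>2 \<le> x powr (- (2 * \<delta>)) * (x / real i) powr (2 * \<delta>)"
      by (intro mult_left_mono) auto
    also have "\<dots> = real i powr (- (2 * \<delta>))"
      using x by (simp add: powr_divide powr_minus field_simps)
    finally show "x powr (- (2 * \<delta>)) * (x / real i)\<^sup>2 \<le> real i powr (- (2 * \<delta>))" .
  qed
  finally show ?thesis by (simp add: x_def)
qed

text \<open>A letter that grows by a factor of at most 9 loses at most the factor
  \<open>9^(2 \<delta>) \<le> 81\<close> in weight.\<close>

lemma mass_shift_ge:
  assumes T: "0 \<notin> T" "\<And>t. t \<in> T \<Longrightarrow> real (m + t) \<le> 9 * real t"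
  shows "mass \<delta> (words T 1) \<le> 81 * mass \<delta> (words ((+) m ` T) 1)"
proof -
  have img: "words ((+) m ` T) 1 = map ((+) m) ` words T 1"
    unfolding words_1 by (auto simp: image_iff)
  have "ennreal (1 / 81) * mass \<delta> (words T 1) \<le> mass \<delta> (map ((+) m) ` words T 1)"
  proof (rule mass_image_ge)
    fix w
    assume "w \<in> words T 1"
    then obtain t where t: "t \<in> T" "w = [t]" unfolding words_1 by auto
    have t0: "0 < real t" using t T(1) by (auto intro: gr0I)
    have "(1 / 81 :: real) = 9 powr (- 2)" by (simp add: powr_minus_divide)
    also have "\<dots> \<le> 9 powr (- (2 * \<delta>))" using \<delta>_le_1 by (intro powr_mono) auto
    finally have "1 / 81 * real t powr (- (2 * \<delta>)) \<le> 9 powr (- (2 * \<delta>)) * real t powr (- (2 * \<delta>))"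
      by (intro mult_right_mono) auto
    also have "\<dots> = (9 * real t) powr (- (2 * \<delta>))" by (simp add: powr_mult)
    also have "\<dots> \<le> real (m + t) powr (- (2 * \<delta>))"
      using T(2)[OF t(1)] t0 \<delta>_pos by (intro powr_mono2') auto
    finally show "1 / 81 * wt \<delta> w \<le> wt \<delta> (map ((+) m) w)" by (simp add: t(2) wt_single)
  qed (auto simp: inj_on_def)
  then have "81 * (ennreal (1 / 81) * mass \<delta> (words T 1)) \<le> 81 * mass \<delta> (words ((+) m ` T) 1)"
    unfolding img by (rule mult_left_mono) auto
  moreover have "81 * ennreal (1 / 81) = 1"
    using ennreal_mult[of 81 "1 / 81"] by simp
  ultimately show ?thesis by (simp add: mult.assoc[symmetric])
qed

lemma regular_alphabet_exists:
  assumes \<delta>1: "\<delta> < 1"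
  shows "\<exists>I C c. regular_alphabet \<delta> I C c"
proof -
  obtain S c where S: "0 \<in> S" "\<And>s. s \<in> S \<Longrightarrow> even s" "upper_regular \<delta> 2 S" "lower_regular \<delta> c S"
    using regular_set_exists[OF \<delta>_pos \<delta>1] by blast
  obtain M n0 where M: "1 \<le> M" "mass \<delta> (words {1..M} n0) < 1" "\<And>n. 1 \<le> mass \<delta> (words {1..Suc M} n)"
    using ex_critical_interval[OF \<delta>1] by blast
  define T where "T = (+) 1 ` S"
  have T: "upper_regular \<delta> 2 T" "lower_regular \<delta> c T" "0 \<notin> T" "1 \<in> T"
    unfolding T_def using S(1) upper_regular_shift[OF S(3), of 1] lower_regular_shift[OF S(4), of 1]
    by auto
  obtain \<kappa> where \<kappa>: "0 < \<kappa>"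
    "\<And>N. 1 \<le> N \<Longrightarrow> ennreal (\<kappa> * N powr (- \<delta>)) \<le> mass \<delta> (words {b \<in> T. N \<le> real b} 1)"
    using lower_tail[OF T] by blast
  \<comment> \<open>Chosen so that \<open>81 \<le> \<kappa> k^\<delta>\<close> whenever
    \<open>8 k > N1\<close>; such a \<open>k\<close> is outweighed by the tail of \<open>T\<close>
    from \<open>k\<close> on, even after the shift by \<open>N1\<close>.\<close>
  define N1 where "N1 = Suc M + 8 * nat \<lceil>(81 / \<kappa>) powr (1 / \<delta>)\<rceil>"
  have N1: "M < N1" "(81 / \<kappa>) powr (1 / \<delta>) \<le> real N1 / 8"
    by (auto simp: N1_def) linarith
  \<comment> \<open>The interval contributes \<open>Suc M\<close>, which takes \<open>{1..M}\<close>
    out of the subcritical range, and supplies the letters up to \<open>8 k\<close> that outweigh a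
    small \<open>k\<close>.\<close>
  define S1 where "S1 = {Suc M..N1} \<union> (+) N1 ` T"
  obtain \<epsilon> where \<epsilon>: "0 < \<epsilon>"
    "\<And>X. 0 \<notin> X \<Longrightarrow> mass \<delta> (words X 1) \<le> ennreal \<epsilon> \<Longrightarrow> mass \<delta> (words ({1..M} \<union> X) n0) < 1"
  proof -
    have "mass \<delta> (words {1..M} 1) < top"
      by (simp add: mass_words_1_finite[unfolded One_nat_def])
    then show ?thesis using mass_words_perturb[OF _ M(2)] that by auto
  qed
  obtain N0 where N0: "\<And>m X. N0 \<le> m \<Longrightarrow> upper_regular \<delta> 2 X \<Longrightarrow> \<forall>b\<in>X. m \<le> real b \<Longrightarrow>
      mass \<delta> (words X 1) \<le> ennreal \<epsilon>"
    using upper_regular_mass_tail_small[of 2 \<epsilon>] \<epsilon>(1) by auto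
  \<comment> \<open>Far enough out for the weight of the translate of \<open>S\<close> to stay below
    \<open>\<epsilon>\<close>, and at an even distance from \<open>N1\<close>, so that parity
    separates this translate from that of \<open>T\<close>.\<close>
  define N2 where "N2 = N1 + 2 * Suc (nat \<lceil>N0\<rceil>)"
  have N2: "N1 < N2" "N0 \<le> real N2" by (auto simp: N2_def) linarith
  define S0 where "S0 = (+) N2 ` S"
  define Y where "Y = {1..M} \<union> S0"
  have S0: "upper_regular \<delta> 2 S0" "lower_regular \<delta> c S0" "N2 \<in> S0" "0 \<notin> S0"
    using S N2 by (auto simp: S0_def upper_regular_shift lower_regular_shift image_iff)
  have Y0: "0 \<notin> Y" using S0 by (simp add: Y_def)
  have S10: "0 \<notin> S1" using T by (auto simp: S1_def)
  have disj: "Y \<inter> S1 = {}"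
  proof -
    have "{1..M} \<inter> S1 = {}" using N1 by (auto simp: S1_def)
    moreover have "S0 \<inter> {Suc M..N1} = {}" using N2 by (auto simp: S0_def)
    moreover have "N2 + s \<noteq> N1 + t" if "s \<in> S" "t \<in> T" for s t
    proof
      assume "N2 + s = N1 + t"
      then have "2 * Suc (nat \<lceil>N0\<rceil>) + s = t" by (simp add: N2_def)
      moreover have "odd t" using that S(2) by (auto simp: T_def)
      ultimately show False using S(2)[OF that(1)] by auto
    qed
    ultimately show ?thesis by (auto simp: Y_def S0_def S1_def)
  qed
  have sub: "mass \<delta> (words Y n0) < 1"
    unfolding Y_def using S0 N2 N0[of "real N2" S0] by (intro \<epsilon>(2)) (auto simp: S0_def)
  have fin: "upper_regular \<delta> (real (card X) + 1) X" if "finite X" for X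
    by (rule upper_regular_finite[OF that]) (use \<delta>_pos in simp)
  have U: "\<exists>C. upper_regular \<delta> C (Y \<union> S1)"
    unfolding Y_def S1_def
    using upper_regular_Un[OF upper_regular_Un[OF fin[of "{1..M}"] S0(1)]
        upper_regular_Un[OF fin[of "{Suc M..N1}"] upper_regular_shift[OF T(1), of N1]]]
    by blast
  then obtain C where C: "upper_regular \<delta> C (Y \<union> S1)" by blast
  have crit: "1 \<le> mass \<delta> (words (Y \<union> S1) n)" for n
  proof -
    have "{1..Suc M} \<subseteq> Y \<union> S1" using N1 by (auto simp: Y_def S1_def)
    then show ?thesis using M(3)[of n] mass_mono[OF words_mono] order_trans by blast
  qed
  have tail: "ennreal (real k powr (- (2 * \<delta>))) \<le> mass \<delta> (words {k' \<in> S1. k < k'} 1)"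
    if k: "k \<in> S1" for k
  proof -
    have k2: "2 \<le> k" using k M(1) N1(1) by (auto simp: S1_def)
    show ?thesis
    proof (cases "8 * k \<le> N1")
      case True
      have "ennreal (real k powr (- (2 * \<delta>))) \<le> ennreal (\<Sum>i\<in>{k<..8 * k}. real i powr (- (2 * \<delta>)))"
        by (intro ennreal_leI powr_le_sum_larger[OF k2])
      also have "\<dots> = mass \<delta> (words {k<..8 * k} 1)"
        by (rule mass_words_1_finite[symmetric]) simp
      also have "\<dots> \<le> mass \<delta> (words {k' \<in> S1. k < k'} 1)"
      proof (intro mass_mono words_mono)
        have "Suc M \<le> k" using k k2 True by (auto simp: S1_def)
        then show "{k<..8 * k} \<subseteq> {k' \<in> S1. k < k'}" using True by (auto simp: S1_def)
      qed
      finally show ?thesis .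
    next
      case False
      \<comment> \<open>Here \<open>t \<ge> k > N1 / 8\<close> gives
        \<open>N1 + t \<le> 9 t\<close>, and the shifted tail lies entirely above
        \<open>k\<close>.\<close>
      let ?T = "{t \<in> T. real k \<le> real t}"
      have "(81 / \<kappa>) powr (1 / \<delta>) \<le> real k" using False N1(2) by linarith
      then have "((81 / \<kappa>) powr (1 / \<delta>)) powr \<delta> \<le> real k powr \<delta>"
        using \<delta>_pos by (intro powr_mono2) auto
      then have "81 \<le> \<kappa> * real k powr \<delta>"
        using \<delta>_pos \<kappa>(1) by (simp add: powr_powr pos_divide_le_eq mult.commute)
      then have "81 * real k powr (- (2 * \<delta>)) \<le> \<kappa> * real k powr \<delta> * real k powr (- (2 * \<delta>))"
        by (intro mult_right_mono) auto
      also have "\<dots> = \<kappa> * real k powr (- \<delta>)" by (simp add: mult.assoc powr_add[symmetric])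
      finally have "ennreal (81 * real k powr (- (2 * \<delta>))) \<le> ennreal (\<kappa> * real k powr (- \<delta>))"
        by (rule ennreal_leI)
      also have "\<dots> \<le> mass \<delta> (words ?T 1)" using k2 by (intro \<kappa>(2)) simp
      also have "\<dots> \<le> 81 * mass \<delta> (words ((+) N1 ` ?T) 1)"
      proof (rule mass_shift_ge)
        show "0 \<notin> ?T" using T(3) by simp
        show "real (N1 + t) \<le> 9 * real t" if "t \<in> ?T" for t using that False by simp
      qed
      also have "\<dots> \<le> 81 * mass \<delta> (words {k' \<in> S1. k < k'} 1)"
      proof (intro mult_left_mono mass_mono words_mono)
        show "(+) N1 ` ?T \<subseteq> {k' \<in> S1. k < k'}" using N1(1) by (auto simp: S1_def)
      qed simp
      finally have "81 * ennreal (real k powr (- (2 * \<delta>))) \<le> 81 * mass \<delta> (words {k' \<in> S1. k < k'} 1)"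
        by (simp add: ennreal_mult)
      then show ?thesis by (simp add: ennreal_mult_le_mult_iff)
    qed
  qed
  obtain G where G: "G \<subseteq> S1" "\<And>n. mass \<delta> (words (Y \<union> G) n) \<le> 4" "\<And>n. 1 \<le> mass \<delta> (words (Y \<union> G) n)"
    using critical_alphabet_exists[OF Y0 S10 disj C sub crit tail] by blast
  \<comment> \<open>A candidate \<open>N1 + 1 + s\<close> is matched with \<open>N2 + s\<close>, at
    a distance independent of \<open>s\<close>; the finitely many letters up to \<open>N1\<close>
    are matched with \<open>N2\<close>.\<close>
  have near: "\<exists>a'\<in>S0. \<bar>real a - real a'\<bar> \<le> real N2" if a: "a \<in> Y \<union> G" for a
  proof -
    consider "a \<in> S0" | "a \<le> N1" | t where "t \<in> T" "a = N1 + t"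
      using a G(1) N1(1) by (auto simp: Y_def S1_def)
    then show ?thesis
    proof cases
      case 1
      then show ?thesis by (intro bexI[of _ a]) auto
    next
      case 2
      then show ?thesis using N2(1) S0(3) by (intro bexI[of _ N2]) auto
    next
      case 3
      then obtain s where "s \<in> S" "a = N1 + Suc s" by (auto simp: T_def)
      then show ?thesis using N2(1) by (intro bexI[of _ "N2 + s"]) (auto simp: S0_def)
    qed
  qed
  have "lower_regular \<delta> (min (c / 2) (1 / (2 * real N2))) (Y \<union> G)"
    using N2(1) \<delta>_pos \<delta>_le_1 near by (intro lower_regular_near[OF S0(2)]) (auto simp: Y_def)
  moreover have "upper_regular \<delta> C (Y \<union> G)" by (rule upper_regular_subset[OF C]) (use G(1) in auto)
  moreover have "0 \<notin> Y \<union> G" using Y0 S10 G(1) by auto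
  moreover have "Y \<union> G \<noteq> {}" using S0(3) by (auto simp: Y_def)
  ultimately have "regular_alphabet \<delta> (Y \<union> G) C (min (c / 2) (1 / (2 * real N2)))"
    using G(2,3) by unfold_locales
  then show ?thesis by blast
qed

end

lemma regular_alphabet_full: "regular_alphabet 1 {0<..} 2 (1 / 2)"
proof (unfold_locales)
  show "upper_regular 1 2 {0<..}"
    unfolding upper_regular_def
  proof (intro conjI allI impI)
    fix a R :: real
    assume R: "1 \<le> R"
    have "{b \<in> {0<..}. a \<le> real b \<and> real b \<le> a + R} \<subseteq> nat ` {\<lceil>a\<rceil>..\<lfloor>a + R\<rfloor>}"
    proof
      fix b :: nat
      assume "b \<in> {b \<in> {0<..}. a \<le> real b \<and> real b \<le> a + R}"
      then have "int b \<in> {\<lceil>a\<rceil>..\<lfloor>a + R\<rfloor>}" by (auto simp: ceiling_le_iff le_floor_iff)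
      then show "b \<in> nat ` {\<lceil>a\<rceil>..\<lfloor>a + R\<rfloor>}" by (metis image_eqI nat_int)
    qed
    then have "card {b \<in> {0<..}. a \<le> real b \<and> real b \<le> a + R} \<le> card {\<lceil>a\<rceil>..\<lfloor>a + R\<rfloor>}"
      by (rule surj_card_le[rotated]) simp
    also have "real (card {\<lceil>a\<rceil>..\<lfloor>a + R\<rfloor>}) \<le> R + 1"
    proof -
      have "real_of_int (\<lfloor>a + R\<rfloor> - \<lceil>a\<rceil> + 1) \<le> R + 1" by linarith
      then show ?thesis using R by simp
    qed
    finally show "real (card {b \<in> {0<..}. a \<le> real b \<and> real b \<le> a + R}) \<le> 2 * R powr 1"
      using R by simp
  qed simp
  show "lower_regular 1 (1 / 2) {0<..}"
    unfolding lower_regular_def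
  proof (intro conjI ballI allI impI)
    fix a :: nat and R :: real
    assume a: "a \<in> {0<..}" and R: "1 \<le> R"
    have "{a..a + nat \<lfloor>R\<rfloor>} \<subseteq> {b \<in> {0<..}. \<bar>real b - real a\<bar> \<le> R}"
    proof
      fix b
      assume b: "b \<in> {a..a + nat \<lfloor>R\<rfloor>}"
      then have "real b \<le> real a + real (nat \<lfloor>R\<rfloor>)" by (simp flip: of_nat_add)
      also have "real (nat \<lfloor>R\<rfloor>) \<le> R" using R by simp
      finally show "b \<in> {b \<in> {0<..}. \<bar>real b - real a\<bar> \<le> R}" using a b by auto
    qed
    then have "card {a..a + nat \<lfloor>R\<rfloor>} \<le> card {b \<in> {0<..}. \<bar>real b - real a\<bar> \<le> R}"
      by (rule card_mono[OF finite_nat_near])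
    moreover have "R \<le> real (card {a..a + nat \<lfloor>R\<rfloor>})" by simp linarith
    ultimately show "1 / 2 * R powr 1 \<le> real (card {b \<in> {0<..}. \<bar>real b - real a\<bar> \<le> R})"
      using R by simp
  qed simp
qed (use mass_full_alphabet in auto)

theorem theorem7p1:
  fixes \<delta> :: real
  assumes "0 < \<delta>" and "\<delta> \<le> 1"
  shows "\<exists>I :: nat set. infinite I \<and> (\<forall>i\<in>I. 0 < i) \<and>
           hausdorff_dim (cf_set I) = ereal \<delta> \<and>
           ahlfors_regular \<delta> (hausdorff_measure_on \<delta> (cf_set I))"
proof -
  interpret cf_exponent \<delta> by unfold_locales (rule assms)+
  have "\<exists>I C c. regular_alphabet \<delta> I C c"
    using regular_alphabet_exists regular_alphabet_full assms(2) by (cases "\<delta> = 1") auto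
  then obtain I C c where "regular_alphabet \<delta> I C c" by blast
  then interpret regular_alphabet \<delta> I C c .
  show ?thesis
  proof (intro exI[of _ I] conjI)
    show "infinite I" by (rule lower_regular_infinite[OF lower I_nonempty \<delta>_pos])
    show "\<forall>i\<in>I. 0 < i" using I_pos by (auto intro: gr0I)
  qed (use hausdorff_dim_and_ahlfors_regular in auto)
qed

end
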